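(* Let $p$ be a prime number and let $P$ be a finite $p$-group. If the center $Z(P)$ is non-cyclic, then $\partial P=0$ in the Roquette category $\mathcal{R}_p$ (i.e. $\partial P$ is a zero object).
   Context: Roquette category. For finite groups $G,H$, let $B(H,G)$ be the Grothendieck group (for disjoint union) of finite $(H,G)$-bisets, i.e. the Burnside group of $H\times G^{op}$. Composition $B(K,H)\times B(H,G)\to B(K,G)$ is the bilinear map induced by $(V,U)\mapsto V\times_H U$, and $\mathrm{Id}_G\in B(G,G)$ is the class of $G$ with left and right multiplication. Write $\mathbf{1}$ for the trivial group and $B(G)=B(G,\mathbf{1})$. Let $X$ be a Sylow $p$-subgroup of $\mathrm{PGL}(3,\mathbb{F}_p)$, and let $\delta=\mathbb{L}-\mathbb{P}\in B(X)$, where $\mathbb{L}$ and $\mathbb{P}$ are the $X$-sets of lines and points of the projective plane over $\mathbb{F}_p$; equivalently $\delta=(X/I-X/IZ)-(X/J-X/JZ)$, where $I,J$ are non-conjugate non-central subgroups of order $p$ of $X$ and $Z=Z(X)$. Let $B_\delta$ be the subfunctor of $B$ (on finite $p$-groups) generated by $\delta$, i.e. $B_\delta(P)=\{\varphi\circ\delta\mid\varphi\in B(P,X)\}\subseteq B(P)$ (this does not depend on the choices), and let $B_\delta(Q,P)\subseteq B(Q,P)$ correspond to $B_\delta(Q\times P^{op})\subseteq B(Q\times P^{op})$. The category $\mathcal{R}_p^\sharp$ has the finite $p$-groups as objects, $\mathrm{Hom}(P,Q)=B(Q,P)/B_\delta(Q,P)$, composition induced by that of bisets, and identities the images of $\mathrm{Id}_P$.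 The Roquette category $\mathcal{R}_p$ is its idempotent additive completion: objects are formal finite direct sums of pairs $(P,e)$ with $P$ a finite $p$-group and $e$ an idempotent of $\mathrm{End}_{\mathcal{R}_p^\sharp}(P)$; morphisms are matrices whose entry from $(P,e)$ to $(Q,f)$ lies in $f\,\mathrm{Hom}_{\mathcal{R}_p^\sharp}(P,Q)\,e$, composed by matrix multiplication. A finite $p$-group $P$ is viewed as the object $(P,\mathrm{Id}_P)$. Edge. For a finite $p$-group $P$, let $f_{\mathbf 1}^P=\sum_{M\trianglelefteq P}\mu(\mathbf{1},M)\,[P/M]\in B(P,P)$, where $\mu$ is the Möbius function of the poset of normal subgroups of $P$ and $P/M$ is the $(P,P)$-biset with left and right multiplication. It is an idempotent, and the edge of $P$ is the object $\partial P=(P,f_{\mathbf 1}^P)$ of $\mathcal{R}_p$. *)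

theory Defs
  imports "HOL-Algebra.Elementary_Groups" "HOL-Number_Theory.Residues"
begin

section \<open>Groups\<close>

definition p_group :: "nat \<Rightarrow> ('a, 'c) monoid_scheme \<Rightarrow> bool" where
  "p_group p P \<longleftrightarrow> group P \<and> (\<exists>n::nat. order P = p ^ n)"

definition sylow_subgroup :: "nat \<Rightarrow> ('a, 'c) monoid_scheme \<Rightarrow> 'a set \<Rightarrow> bool" where
  "sylow_subgroup p G S \<longleftrightarrow> subgroup S G \<and> card S = p ^ multiplicity p (order G)"

definition group_center :: "('a, 'c) monoid_scheme \<Rightarrow> 'a set" where
  "group_center G = {z \<in> carrier G. \<forall>x\<in>carrier G. z \<otimes>\<^bsub>G\<^esub> x = x \<otimes>\<^bsub>G\<^esub> z}"

definition opp_group :: "'a monoid \<Rightarrow> 'a monoid" where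
  "opp_group G = G\<lparr>mult := \<lambda>x y. y \<otimes>\<^bsub>G\<^esub> x\<rparr>"

abbreviation unit_group :: "unit monoid" where
  "unit_group \<equiv> singleton_group ()"

text \<open>The Moebius function of the poset \<open>A\<close>; the value for infinite \<open>A\<close> and \<open>x < y\<close> is a dummy.\<close>

function moebius :: "'a::order set \<Rightarrow> 'a \<Rightarrow> 'a \<Rightarrow> int" where
  "moebius A x y =
     (if x = y then 1
      else if x < y \<and> finite A then - (\<Sum>z\<in>{z \<in> A. x \<le> z \<and> z < y}. moebius A x z)
      else 0)"
  by auto
termination
proof (relation "measure (\<lambda>(A, x, y). card {z \<in> A. z < y})", goal_cases)
  case (2 A x y z)
  then have "{w \<in> A. w < z} \<subset> {w \<in> A. w < y}" by auto
  with 2 show ?case by (auto intro: psubset_card_mono)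
qed auto

declare moebius.simps [simp del]


section \<open>Bisets\<close>

record ('h, 'g, 'u) biset =
  bset :: "'u set"
  lact :: "'h \<Rightarrow> 'u \<Rightarrow> 'u"
  ract :: "'u \<Rightarrow> 'g \<Rightarrow> 'u"

text \<open>\<open>finite_biset H G U\<close>: \<open>U\<close> is a finite \<open>(H, G)\<close>-biset (left \<open>H\<close>-action, right \<open>G\<close>-action).\<close>

definition finite_biset :: "'h monoid \<Rightarrow> 'g monoid \<Rightarrow> ('h, 'g, 'u) biset \<Rightarrow> bool" where
  "finite_biset H G U \<longleftrightarrow>
     finite (bset U) \<and>
     (\<forall>h\<in>carrier H. \<forall>u\<in>bset U. lact U h u \<in> bset U) \<and>
     (\<forall>u\<in>bset U. lact U \<one>\<^bsub>H\<^esub> u = u) \<and>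
     (\<forall>h\<in>carrier H. \<forall>k\<in>carrier H. \<forall>u\<in>bset U.
        lact U (h \<otimes>\<^bsub>H\<^esub> k) u = lact U h (lact U k u)) \<and>
     (\<forall>g\<in>carrier G. \<forall>u\<in>bset U. ract U u g \<in> bset U) \<and>
     (\<forall>u\<in>bset U. ract U u \<one>\<^bsub>G\<^esub> = u) \<and>
     (\<forall>g\<in>carrier G. \<forall>k\<in>carrier G. \<forall>u\<in>bset U.
        ract U u (g \<otimes>\<^bsub>G\<^esub> k) = ract U (ract U u g) k) \<and>
     (\<forall>h\<in>carrier H. \<forall>g\<in>carrier G. \<forall>u\<in>bset U.
        ract U (lact U h u) g = lact U h (ract U u g))"

definition biset_iso ::
  "'h monoid \<Rightarrow> 'g monoid \<Rightarrow> ('h, 'g, 'u) biset \<Rightarrow> ('h, 'g, 'v) biset \<Rightarrow> bool" where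
  "biset_iso H G U V \<longleftrightarrow>
     (\<exists>f. bij_betw f (bset U) (bset V) \<and>
        (\<forall>h\<in>carrier H. \<forall>u\<in>bset U. f (lact U h u) = lact V h (f u)) \<and>
        (\<forall>g\<in>carrier G. \<forall>u\<in>bset U. f (ract U u g) = ract V (f u) g))"

definition empty_biset :: "('h, 'g, nat) biset" where
  "empty_biset = \<lparr>bset = {}, lact = (\<lambda>h u. u), ract = (\<lambda>u g. u)\<rparr>"

definition biset_sum ::
  "('h, 'g, 'u) biset \<Rightarrow> ('h, 'g, 'v) biset \<Rightarrow> ('h, 'g, 'u + 'v) biset" (infixl "\<uplus>" 65) where
  "U \<uplus> V = \<lparr>bset = bset U <+> bset V,
             lact = (\<lambda>h. map_sum (lact U h) (lact V h)),
             ract = (\<lambda>x g. map_sum (\<lambda>u. ract U u g) (\<lambda>v. ract V v g) x)\<rparr>"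

text \<open>The composition \<open>V \<times>\<^sub>H U\<close> of a \<open>(K, H)\<close>-biset \<open>V\<close> and an \<open>(H, G)\<close>-biset \<open>U\<close>. As \<open>H\<close> is a
  group, the identifications \<open>(v h, u) \<sim> (v, h u)\<close> already form an equivalence relation.\<close>

definition tensor_rel ::
  "'h monoid \<Rightarrow> ('k, 'h, 'v) biset \<Rightarrow> ('h, 'g, 'u) biset \<Rightarrow> (('v \<times> 'u) \<times> ('v \<times> 'u)) set" where
  "tensor_rel H V U =
     {((ract V v h, u), (v, lact U h u)) | v h u. v \<in> bset V \<and> h \<in> carrier H \<and> u \<in> bset U}"

definition biset_tensor ::
  "'h monoid \<Rightarrow> ('k, 'h, 'v) biset \<Rightarrow> ('h, 'g, 'u) biset \<Rightarrow> ('k, 'g, ('v \<times> 'u) set) biset" where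
  "biset_tensor H V U =
     \<lparr>bset = (bset V \<times> bset U) // tensor_rel H V U,
      lact = (\<lambda>k C. map_prod (lact V k) id ` C),
      ract = (\<lambda>C g. map_prod id (\<lambda>u. ract U u g) ` C)\<rparr>"

definition quotient_biset :: "'a monoid \<Rightarrow> 'a set \<Rightarrow> ('a, 'a, 'a set) biset" where
  "quotient_biset P M =
     \<lparr>bset = rcosets\<^bsub>P\<^esub> M, lact = (\<lambda>x C. x <#\<^bsub>P\<^esub> C), ract = (\<lambda>C x. C #>\<^bsub>P\<^esub> x)\<rparr>"

definition identity_biset :: "'a monoid \<Rightarrow> ('a, 'a, 'a) biset" where
  "identity_biset P = \<lparr>bset = carrier P, lact = monoid.mult P, ract = monoid.mult P\<rparr>"


section \<open>The biset Burnside group\<close>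

text \<open>\<open>biset_diff H G U V\<close> is the formal difference \<open>[U] - [V]\<close> in the Grothendieck group of finite
  \<open>(H, G)\<close>-bisets. It is represented as the set of all pairs \<open>(U', V')\<close> of finite bisets with
  \<open>U + V' + W \<cong> U' + V + W\<close> for some finite \<open>W\<close>. Every finite biset is isomorphic to one
  whose underlying set consists of natural numbers, so \<open>U'\<close>, \<open>V'\<close>, \<open>W\<close> range over the
  latter, while \<open>U\<close> and \<open>V\<close> may have arbitrary element types.\<close>

type_synonym ('h, 'g) vbiset = "(('h, 'g, nat) biset \<times> ('h, 'g, nat) biset) set"

definition biset_diff ::
  "'h monoid \<Rightarrow> 'g monoid \<Rightarrow> ('h, 'g, 'u) biset \<Rightarrow> ('h, 'g, 'v) biset \<Rightarrow> ('h, 'g) vbiset" where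
  "biset_diff H G U V =
     {(U', V'). finite_biset H G U' \<and> finite_biset H G V' \<and>
        (\<exists>W :: ('h, 'g, nat) biset. finite_biset H G W \<and>
           biset_iso H G (U \<uplus> V' \<uplus> W) (U' \<uplus> V \<uplus> W))}"

definition biset_class :: "'h monoid \<Rightarrow> 'g monoid \<Rightarrow> ('h, 'g, 'u) biset \<Rightarrow> ('h, 'g) vbiset" where
  "biset_class H G U = biset_diff H G U empty_biset"

text \<open>The abelian group \<open>B(H, G)\<close>. As for abelian groups in HOL-Algebra that are not part of a ring,
  it is a \<open>monoid\<close> record, so that its addition is written \<open>\<otimes>\<close>, its zero \<open>\<one>\<close>, and integer multiples
  are powers. Operations on classes are defined by taking the union over all
  representatives; all members of this union coincide.\<close>

definition burnside :: "'h monoid \<Rightarrow> 'g monoid \<Rightarrow> ('h, 'g) vbiset monoid" where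
  "burnside H G =
     \<lparr>carrier = {biset_diff H G U V | (U :: ('h, 'g, nat) biset) (V :: ('h, 'g, nat) biset).
                   finite_biset H G U \<and> finite_biset H G V},
      monoid.mult = (\<lambda>a b. \<Union>(U, V)\<in>a. \<Union>(U', V')\<in>b. biset_diff H G (U \<uplus> U') (V \<uplus> V')),
      one = biset_diff H G empty_biset empty_biset\<rparr>"

definition burnside_comp ::
  "'k monoid \<Rightarrow> 'h monoid \<Rightarrow> 'g monoid \<Rightarrow> ('k, 'h) vbiset \<Rightarrow> ('h, 'g) vbiset \<Rightarrow> ('k, 'g) vbiset" where
  "burnside_comp K H G a b =
     (\<Union>(V, V')\<in>a. \<Union>(U, U')\<in>b.
        biset_diff K G (biset_tensor H V U \<uplus> biset_tensor H V' U')
                       (biset_tensor H V U' \<uplus> biset_tensor H V' U))"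

text \<open>The identification \<open>B(Q, P) \<cong> B(Q \<times> P\<^sup>o\<^sup>p, 1)\<close>, where \<open>(q, x) u = q u x\<close>.\<close>

definition biset_to_left :: "('q, 'p, 'u) biset \<Rightarrow> ('q \<times> 'p, unit, 'u) biset" where
  "biset_to_left U = \<lparr>bset = bset U, lact = (\<lambda>(q, x) u. lact U q (ract U u x)), ract = (\<lambda>u _. u)\<rparr>"

definition burnside_to_left ::
  "'q monoid \<Rightarrow> 'p monoid \<Rightarrow> ('q, 'p) vbiset \<Rightarrow> ('q \<times> 'p, unit) vbiset" where
  "burnside_to_left Q P a =
     (\<Union>(U, V)\<in>a. biset_diff (Q \<times>\<times> opp_group P) unit_group (biset_to_left U) (biset_to_left V))"


section \<open>The projective linear group and the projective plane\<close>

text \<open>Vectors and matrices are extensional functions on index sets \<open>{..<n}\<close> and \<open>{..<n} \<times> {..<n}\<close>.\<close>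

definition vec_space :: "nat \<Rightarrow> ('r, 'c) ring_scheme \<Rightarrow> (nat \<Rightarrow> 'r) set" where
  "vec_space n R = {..<n} \<rightarrow>\<^sub>E carrier R"

definition vec_zero :: "nat \<Rightarrow> ('r, 'c) ring_scheme \<Rightarrow> nat \<Rightarrow> 'r" where
  "vec_zero n R = (\<lambda>i\<in>{..<n}. \<zero>\<^bsub>R\<^esub>)"

definition vec_smult :: "nat \<Rightarrow> ('r, 'c) ring_scheme \<Rightarrow> 'r \<Rightarrow> (nat \<Rightarrow> 'r) \<Rightarrow> nat \<Rightarrow> 'r" where
  "vec_smult n R c v = (\<lambda>i\<in>{..<n}. c \<otimes>\<^bsub>R\<^esub> v i)"

definition vec_add :: "nat \<Rightarrow> ('r, 'c) ring_scheme \<Rightarrow> (nat \<Rightarrow> 'r) \<Rightarrow> (nat \<Rightarrow> 'r) \<Rightarrow> nat \<Rightarrow> 'r" where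
  "vec_add n R v w = (\<lambda>i\<in>{..<n}. v i \<oplus>\<^bsub>R\<^esub> w i)"

definition scalar_mat :: "nat \<Rightarrow> ('r, 'c) ring_scheme \<Rightarrow> 'r \<Rightarrow> nat \<times> nat \<Rightarrow> 'r" where
  "scalar_mat n R c = (\<lambda>(i, j)\<in>{..<n} \<times> {..<n}. if i = j then c else \<zero>\<^bsub>R\<^esub>)"

definition mat_monoid :: "nat \<Rightarrow> ('r, 'c) ring_scheme \<Rightarrow> (nat \<times> nat \<Rightarrow> 'r) monoid" where
  "mat_monoid n R =
     \<lparr>carrier = {..<n} \<times> {..<n} \<rightarrow>\<^sub>E carrier R,
      monoid.mult = (\<lambda>A B. \<lambda>(i, j)\<in>{..<n} \<times> {..<n}. \<Oplus>\<^bsub>R\<^esub>k\<in>{..<n}. A (i, k) \<otimes>\<^bsub>R\<^esub> B (k, j)),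
      one = scalar_mat n R \<one>\<^bsub>R\<^esub>\<rparr>"

definition mat_vec ::
  "nat \<Rightarrow> ('r, 'c) ring_scheme \<Rightarrow> (nat \<times> nat \<Rightarrow> 'r) \<Rightarrow> (nat \<Rightarrow> 'r) \<Rightarrow> nat \<Rightarrow> 'r" where
  "mat_vec n R A v = (\<lambda>i\<in>{..<n}. \<Oplus>\<^bsub>R\<^esub>k\<in>{..<n}. A (i, k) \<otimes>\<^bsub>R\<^esub> v k)"

definition GL :: "nat \<Rightarrow> ('r, 'c) ring_scheme \<Rightarrow> (nat \<times> nat \<Rightarrow> 'r) monoid" where
  "GL n R = units_of (mat_monoid n R)"

definition PGL :: "nat \<Rightarrow> ('r, 'c) ring_scheme \<Rightarrow> (nat \<times> nat \<Rightarrow> 'r) set monoid" where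
  "PGL n R = GL n R Mod (scalar_mat n R ` Units R)"

text \<open>Points and lines of the projective plane over a field, as the one- and two-dimensional subspaces
  of the three-dimensional vector space.\<close>

definition proj_points :: "('r, 'c) ring_scheme \<Rightarrow> (nat \<Rightarrow> 'r) set set" where
  "proj_points R =
     {{vec_smult 3 R c v | c. c \<in> carrier R} | v. v \<in> vec_space 3 R \<and> v \<noteq> vec_zero 3 R}"

definition proj_lines :: "('r, 'c) ring_scheme \<Rightarrow> (nat \<Rightarrow> 'r) set set" where
  "proj_lines R =
     {{vec_add 3 R (vec_smult 3 R a v) (vec_smult 3 R b w) | a b. a \<in> carrier R \<and> b \<in> carrier R}
      | v w. v \<in> vec_space 3 R \<and> w \<in> vec_space 3 R \<and>
          (\<forall>a\<in>carrier R. \<forall>b\<in>carrier R.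
             vec_add 3 R (vec_smult 3 R a v) (vec_smult 3 R b w) = vec_zero 3 R \<longrightarrow>
             a = \<zero>\<^bsub>R\<^esub> \<and> b = \<zero>\<^bsub>R\<^esub>)}"

text \<open>A class in \<open>PGL\<close> is a set of matrices that differ by non-zero scalars, hence
  all of them map a given subspace to the same subspace.\<close>

definition proj_biset ::
  "('r, 'c) ring_scheme \<Rightarrow> (nat \<Rightarrow> 'r) set set
     \<Rightarrow> ((nat \<times> nat \<Rightarrow> 'r) set, unit, (nat \<Rightarrow> 'r) set) biset" where
  "proj_biset R S =
     \<lparr>bset = S, lact = (\<lambda>C W. {mat_vec 3 R A w | A w. A \<in> C \<and> w \<in> W}), ract = (\<lambda>W _. W)\<rparr>"


section \<open>The element \<open>\<delta>\<close> and the subfunctor it generates\<close>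

text \<open>\<open>X\<close> is the carrier of a Sylow \<open>p\<close>-subgroup of \<open>PGL(3, p)\<close>; everything below is
  parametrised by its choice.\<close>

abbreviation prime_field :: "nat \<Rightarrow> int ring" where
  "prime_field p \<equiv> residue_ring (int p)"

type_synonym pgl_elem = "(nat \<times> nat \<Rightarrow> int) set"

definition sylow_group :: "nat \<Rightarrow> pgl_elem set \<Rightarrow> pgl_elem monoid" where
  "sylow_group p X = (PGL 3 (prime_field p))\<lparr>carrier := X\<rparr>"

definition delta :: "nat \<Rightarrow> pgl_elem set \<Rightarrow> (pgl_elem, unit) vbiset" where
  "delta p X = biset_diff (sylow_group p X) unit_group
     (proj_biset (prime_field p) (proj_lines (prime_field p)))
     (proj_biset (prime_field p) (proj_points (prime_field p)))"

definition B_delta :: "nat \<Rightarrow> pgl_elem set \<Rightarrow> 'a monoid \<Rightarrow> ('a, unit) vbiset set" where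
  "B_delta p X P =
     {burnside_comp P (sylow_group p X) unit_group \<phi> (delta p X) | \<phi>.
        \<phi> \<in> carrier (burnside P (sylow_group p X))}"

definition B_delta2 ::
  "nat \<Rightarrow> pgl_elem set \<Rightarrow> 'q monoid \<Rightarrow> 'p monoid \<Rightarrow> ('q, 'p) vbiset set" where
  "B_delta2 p X Q P =
     {a \<in> carrier (burnside Q P). burnside_to_left Q P a \<in> B_delta p X (Q \<times>\<times> opp_group P)}"


section \<open>Preadditive categories and idempotent additive completion\<close>

text \<open>\<open>Hom C x y\<close> is the abelian group of morphisms from \<open>x\<close> to \<open>y\<close> (again a \<open>monoid\<close> record), and
  \<open>Comp C x y z g f\<close> is the composite of \<open>f : x \<rightarrow> y\<close> and \<open>g : y \<rightarrow> z\<close>.\<close>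

record ('o, 'm) precat =
  Obj :: "'o set"
  Hom :: "'o \<Rightarrow> 'o \<Rightarrow> 'm monoid"
  Comp :: "'o \<Rightarrow> 'o \<Rightarrow> 'o \<Rightarrow> 'm \<Rightarrow> 'm \<Rightarrow> 'm"
  Ident :: "'o \<Rightarrow> 'm"

definition zero_object :: "('o, 'm) precat \<Rightarrow> 'o \<Rightarrow> bool" where
  "zero_object C Z \<longleftrightarrow> Z \<in> Obj C \<and>
     (\<forall>Y\<in>Obj C. (\<exists>!f. f \<in> carrier (Hom C Z Y)) \<and> (\<exists>!f. f \<in> carrier (Hom C Y Z)))"

definition idem_objs :: "('o, 'm) precat \<Rightarrow> ('o \<times> 'm) set" where
  "idem_objs C = {(x, e). x \<in> Obj C \<and> e \<in> carrier (Hom C x x) \<and> Comp C x x x e e = e}"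

definition idem_hom :: "('o, 'm) precat \<Rightarrow> 'o \<times> 'm \<Rightarrow> 'o \<times> 'm \<Rightarrow> 'm set" where
  "idem_hom C = (\<lambda>(x, e) (y, f). {Comp C x y y f (Comp C x x y \<phi> e) | \<phi>. \<phi> \<in> carrier (Hom C x y)})"

text \<open>A formal finite direct sum of pairs \<open>(x, e)\<close> is the list of its summands. The entry of a matrix
  at \<open>(j, i)\<close> is the component from the \<open>i\<close>-th summand of the source to the \<open>j\<close>-th
  summand of the target.\<close>

definition idem_add_completion ::
  "('o, 'm) precat \<Rightarrow> (('o \<times> 'm) list, nat \<times> nat \<Rightarrow> 'm) precat" where
  "idem_add_completion C =
     \<lparr>Obj = {xs. set xs \<subseteq> idem_objs C},
      Hom = (\<lambda>xs ys.
        \<lparr>carrier = (\<Pi>\<^sub>E (j, i)\<in>{..<length ys} \<times> {..<length xs}. idem_hom C (xs ! i) (ys ! j)),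
         monoid.mult = (\<lambda>a b. \<lambda>(j, i)\<in>{..<length ys} \<times> {..<length xs}.
           a (j, i) \<otimes>\<^bsub>Hom C (fst (xs ! i)) (fst (ys ! j))\<^esub> b (j, i)),
         one = (\<lambda>(j, i)\<in>{..<length ys} \<times> {..<length xs}.
           \<one>\<^bsub>Hom C (fst (xs ! i)) (fst (ys ! j))\<^esub>)\<rparr>),
      Comp = (\<lambda>xs ys zs b a. \<lambda>(k, i)\<in>{..<length zs} \<times> {..<length xs}.
        \<Otimes>\<^bsub>Hom C (fst (xs ! i)) (fst (zs ! k))\<^esub>j\<in>{..<length ys}.
          Comp C (fst (xs ! i)) (fst (ys ! j)) (fst (zs ! k)) (b (k, j)) (a (j, i))),
      Ident = (\<lambda>xs. \<lambda>(j, i)\<in>{..<length xs} \<times> {..<length xs}.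
        if i = j then snd (xs ! i) else \<one>\<^bsub>Hom C (fst (xs ! i)) (fst (xs ! j))\<^esub>)\<rparr>"


section \<open>The Roquette category and edges\<close>

text \<open>The finite \<open>p\<close>-groups are those with elements in an arbitrary type \<open>'a\<close>; up to isomorphism
  these are all finite \<open>p\<close>-groups as soon as \<open>'a\<close> is infinite.
  Elements of \<open>B(Q, P)/B\<^sub>\<delta>(Q, P)\<close> are cosets of \<open>B\<^sub>\<delta>(Q, P)\<close>.\<close>

definition roquette_class ::
  "nat \<Rightarrow> pgl_elem set \<Rightarrow> 'a monoid \<Rightarrow> 'a monoid \<Rightarrow> ('a, 'a) vbiset \<Rightarrow> ('a, 'a) vbiset set" where
  "roquette_class p X Q P a = B_delta2 p X Q P #>\<^bsub>burnside Q P\<^esub> a"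

definition roquette_sharp :: "nat \<Rightarrow> pgl_elem set \<Rightarrow> ('a monoid, ('a, 'a) vbiset set) precat" where
  "roquette_sharp p X =
     \<lparr>Obj = {P. p_group p P},
      Hom = (\<lambda>P Q. burnside Q P Mod B_delta2 p X Q P),
      Comp = (\<lambda>P Q R g f. \<Union>b\<in>g. \<Union>a\<in>f. roquette_class p X R P (burnside_comp R Q P b a)),
      Ident = (\<lambda>P. roquette_class p X P P (biset_class P P (identity_biset P)))\<rparr>"

definition roquette ::
  "nat \<Rightarrow> pgl_elem set
     \<Rightarrow> (('a monoid \<times> ('a, 'a) vbiset set) list, nat \<times> nat \<Rightarrow> ('a, 'a) vbiset set) precat" where
  "roquette p X = idem_add_completion (roquette_sharp p X)"

definition f_one :: "'a monoid \<Rightarrow> ('a, 'a) vbiset" where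
  "f_one P = (\<Otimes>\<^bsub>burnside P P\<^esub>M\<in>{M. M \<lhd> P}.
     biset_class P P (quotient_biset P M) [^]\<^bsub>burnside P P\<^esub> moebius {M. M \<lhd> P} {\<one>\<^bsub>P\<^esub>} M)"

definition edge :: "nat \<Rightarrow> pgl_elem set \<Rightarrow> 'a monoid \<Rightarrow> ('a monoid \<times> ('a, 'a) vbiset set) list" where
  "edge p X P = [(P, roquette_class p X P P (f_one P))]"

end

theory Submission
  imports Defs "HOL-Library.Function_Algebras" "HOL-Algebra.SndIsomorphismGrp"
    "HOL-Algebra.Multiplicative_Group"
begin

text \<open>By Burnside's theorem a virtual biset is determined by its marks, the numbers of fixed points of
  all subsets of \<open>H \<times> G\<close>, so \<open>B(H, G)\<close> is a group of integer-valued functions and its elements can be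
  compared by counting. The elements of \<open>B\<^sub>\<delta>(Q, P)\<close> are absorbed by composition on either side, so the
  edge of \<open>P\<close> vanishes as soon as \<open>f\<^sub>1 \<in> B\<^sub>\<delta>(P, P)\<close>.

  Some conjugate of the group of translations of the affine plane lies in the Sylow subgroup \<open>X\<close>. A
  non-cyclic center contains a copy \<open>E\<close> of it, which gives a \<open>(P \<times> P\<^sup>o\<^sup>p, X)\<close>-biset \<open>P/N \<times>\<^sub>E X\<close> for every
  normal subgroup \<open>N\<close>. Its composite with an \<open>X\<close>-set \<open>Y\<close> is the sum of the \<open>P/N Stab\<^sub>E(y)\<close> over the
  \<open>E\<close>-orbits of \<open>Y\<close>. Weighting by \<open>\<mu>(1, N)\<close> and summing over \<open>N\<close>, Weisner's theorem kills every
  non-free orbit, while every free orbit contributes \<open>f\<^sub>1\<close>. Translations have no free orbit on the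
  lines and exactly one, the affine points, on the points; so \<open>f\<^sub>1\<close> is minus a multiple of \<open>\<delta>\<close>.\<close>

section \<open>Bisets and their marks\<close>

text \<open>The Sylow subgroup \<open>X\<close> and the non-cyclic center are arbitrary, so neither
  offers a preferred copy of the translation group. Both are therefore reached from Z x Z by
  homomorphisms, \<open>\<sigma>\<close> into a conjugate of the translations inside
  \<open>X\<close> and \<open>\<beta>\<close> into the center, with common kernel pZ x pZ. Freeness
  of an orbit is measured by the image of its stabilizers under \<open>\<beta>\<close>, which spares
  an identification of two quotients. Elements of B(H, G) are sets of pairs of bisets up to stable
  isomorphism, and tensor products leave the element type \<open>nat\<close>. Marks remove both
  difficulties at once: they do not depend on the element type, turn disjoint union into addition
  and determine the isomorphism class. Passing to one-sided bisets merely replaces x by its inverse.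
  Weisner's theorem applies because a nontrivial subgroup F of the center is normal in P, so N
  \<mapsto> N F is the join with a fixed element above the bottom of the poset of normal subgroups.
  The marks at a fixed set are then arbitrary integer weights on that poset.\<close>

lemma finite_bisetD:
  assumes "finite_biset H G U"
  shows "finite (bset U)"
    and "\<And>h u. h \<in> carrier H \<Longrightarrow> u \<in> bset U \<Longrightarrow> lact U h u \<in> bset U"
    and "\<And>u. u \<in> bset U \<Longrightarrow> lact U \<one>\<^bsub>H\<^esub> u = u"
    and "\<And>h k u. h \<in> carrier H \<Longrightarrow> k \<in> carrier H \<Longrightarrow> u \<in> bset U \<Longrightarrow>
           lact U (h \<otimes>\<^bsub>H\<^esub> k) u = lact U h (lact U k u)"
    and "\<And>g u. g \<in> carrier G \<Longrightarrow> u \<in> bset U \<Longrightarrow> ract U u g \<in> bset U"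
    and "\<And>u. u \<in> bset U \<Longrightarrow> ract U u \<one>\<^bsub>G\<^esub> = u"
    and "\<And>g k u. g \<in> carrier G \<Longrightarrow> k \<in> carrier G \<Longrightarrow> u \<in> bset U \<Longrightarrow>
           ract U u (g \<otimes>\<^bsub>G\<^esub> k) = ract U (ract U u g) k"
    and "\<And>h g u. h \<in> carrier H \<Longrightarrow> g \<in> carrier G \<Longrightarrow> u \<in> bset U \<Longrightarrow>
           ract U (lact U h u) g = lact U h (ract U u g)"
  using assms unfolding finite_biset_def by auto

lemma finite_biset_lact_inv:
  assumes "finite_biset H G U" "group H" "h \<in> carrier H" "u \<in> bset U"
  shows "lact U (inv\<^bsub>H\<^esub> h) (lact U h u) = u" "lact U h (lact U (inv\<^bsub>H\<^esub> h) u) = u"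
proof -
  interpret H: group H by fact
  note U = finite_bisetD[OF assms(1)]
  show "lact U (inv\<^bsub>H\<^esub> h) (lact U h u) = u"
    using U(4)[of "inv\<^bsub>H\<^esub> h" h u] U(3) assms by simp
  show "lact U h (lact U (inv\<^bsub>H\<^esub> h) u) = u"
    using U(4)[of h "inv\<^bsub>H\<^esub> h" u] U(3) assms by simp
qed

lemma finite_biset_ract_inv:
  assumes "finite_biset H G U" "group G" "g \<in> carrier G" "u \<in> bset U"
  shows "ract U (ract U u g) (inv\<^bsub>G\<^esub> g) = u" "ract U (ract U u (inv\<^bsub>G\<^esub> g)) g = u"
proof -
  interpret G: group G by fact
  note U = finite_bisetD[OF assms(1)]
  show "ract U (ract U u g) (inv\<^bsub>G\<^esub> g) = u"
    using U(7)[of g "inv\<^bsub>G\<^esub> g" u] U(6) assms by simp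
  show "ract U (ract U u (inv\<^bsub>G\<^esub> g)) g = u"
    using U(7)[of "inv\<^bsub>G\<^esub> g" g u] U(6) assms by simp
qed

text \<open>A bijection between two quotients of one parameter set \<open>Z\<close>: hypothesis
  \<open>ab\<close> makes it well defined and injective at once, and equivariance is checked on
  parameters, never on classes. Orbits and tensor products are compared in this way below.\<close>

lemma biset_iso_via:
  assumes a: "a ` Z = bset U" and b: "b ` Z = bset V"
    and ab: "\<And>z z'. z \<in> Z \<Longrightarrow> z' \<in> Z \<Longrightarrow> a z = a z' \<longleftrightarrow> b z = b z'"
    and l: "\<And>h z. h \<in> carrier H \<Longrightarrow> z \<in> Z \<Longrightarrow>
              \<exists>z'\<in>Z. a z' = lact U h (a z) \<and> b z' = lact V h (b z)"
    and r: "\<And>g z. g \<in> carrier G \<Longrightarrow> z \<in> Z \<Longrightarrow>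
              \<exists>z'\<in>Z. a z' = ract U (a z) g \<and> b z' = ract V (b z) g"
  shows "biset_iso H G U V"
proof -
  define f where "f u = b (inv_into Z a u)" for u
  have f: "f (a z) = b z" if "z \<in> Z" for z
  proof -
    have "inv_into Z a (a z) \<in> Z" "a (inv_into Z a (a z)) = a z"
      using that by (auto intro: inv_into_into f_inv_into_f)
    then show ?thesis unfolding f_def using ab that by blast
  qed
  have "bij_betw f (bset U) (bset V)"
  proof (rule bij_betw_imageI)
    show "inj_on f (bset U)"
      using f ab by (auto simp: inj_on_def a[symmetric])
    show "f ` bset U = bset V"
      using f by (force simp: a[symmetric] b[symmetric])
  qed
  moreover have "f (lact U h u) = lact V h (f u)" if "h \<in> carrier H" "u \<in> bset U" for h u
    using that l f unfolding a[symmetric] by (metis imageE)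
  moreover have "f (ract U u g) = ract V (f u) g" if "g \<in> carrier G" "u \<in> bset U" for g u
    using that r f unfolding a[symmetric] by (metis imageE)
  ultimately show ?thesis unfolding biset_iso_def by blast
qed

lemma finite_biset_sum:
  assumes "finite_biset H G U" "finite_biset H G V"
  shows "finite_biset H G (U \<uplus> V)"
  using assms unfolding finite_biset_def biset_sum_def by auto

lemma finite_biset_empty: "finite_biset H G empty_biset"
  unfolding finite_biset_def empty_biset_def by auto

text \<open>This is the stabilizer of \<open>u\<close> for the left action of the direct product
  given by (h, g) u = h u g^-1.\<close>

definition stab :: "'h monoid \<Rightarrow> 'g monoid \<Rightarrow> ('h, 'g, 'u) biset \<Rightarrow> 'u \<Rightarrow> ('h \<times> 'g) set" where
  "stab H G U u = {(h, g). h \<in> carrier H \<and> g \<in> carrier G \<and> lact U h u = ract U u g}"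

lemma stab_subset: "stab H G U u \<subseteq> carrier H \<times> carrier G"
  by (auto simp: stab_def)

definition fixpts :: "('h, 'g, 'u) biset \<Rightarrow> ('h \<times> 'g) set \<Rightarrow> 'u set" where
  "fixpts U K = {u \<in> bset U. \<forall>(h, g)\<in>K. lact U h u = ract U u g}"

text \<open>The table of marks, with arbitrary subsets in place of subgroups: a set and the subgroup
  it generates fix the same points. The value 0 off \<open>carrier H \<times> carrier G\<close>
  makes equality of marks an equality of functions.\<close>

definition mark :: "'h monoid \<Rightarrow> 'g monoid \<Rightarrow> ('h, 'g, 'u) biset \<Rightarrow> ('h \<times> 'g) set \<Rightarrow> int" where
  "mark H G U = (\<lambda>K. if K \<subseteq> carrier H \<times> carrier G then int (card (fixpts U K)) else 0)"

lemma mem_fixpts_iff: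
  assumes "K \<subseteq> carrier H \<times> carrier G"
  shows "u \<in> fixpts U K \<longleftrightarrow> u \<in> bset U \<and> K \<subseteq> stab H G U u"
  using assms unfolding fixpts_def stab_def by auto

text \<open>Fixed points are counted one by one, so the pieces \<open>A i\<close> may form any
  finite partition, stable or not.\<close>

lemma mark_disjoint_union:
  assumes "finite I" "\<And>i. i \<in> I \<Longrightarrow> finite (A i)" "\<And>i j. i \<in> I \<Longrightarrow> j \<in> I \<Longrightarrow> i \<noteq> j \<Longrightarrow> A i \<inter> A j = {}"
    and "bset U = (\<Union>i\<in>I. A i)"
  shows "mark H G U = (\<Sum>i\<in>I. mark H G (U\<lparr>bset := A i\<rparr>))"
proof
  fix K
  have "card (\<Union>i\<in>I. fixpts (U\<lparr>bset := A i\<rparr>) K) = (\<Sum>i\<in>I. card (fixpts (U\<lparr>bset := A i\<rparr>) K))"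
    using assms(1,2,3) by (intro card_UN_disjoint) (auto simp: fixpts_def)
  moreover have "fixpts U K = (\<Union>i\<in>I. fixpts (U\<lparr>bset := A i\<rparr>) K)"
    by (auto simp: fixpts_def assms(4))
  moreover have "(\<Sum>i\<in>I. F i) K = (\<Sum>i\<in>I. F i K)" for F :: "'a \<Rightarrow> _ \<Rightarrow> int"
    using assms(1) by (induction rule: finite_induct) auto
  ultimately show "mark H G U K = (\<Sum>i\<in>I. mark H G (U\<lparr>bset := A i\<rparr>)) K"
    unfolding mark_def by auto
qed

lemma mark_sum:
  assumes "finite_biset H G U" "finite_biset H G V"
  shows "mark H G (U \<uplus> V) = mark H G U + mark H G V"
proof
  fix K
  have "fixpts (U \<uplus> V) K = fixpts U K <+> fixpts V K"
    by (auto simp: fixpts_def biset_sum_def)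
  moreover have "finite (fixpts U K)" "finite (fixpts V K)"
    using finite_bisetD(1)[OF assms(1)] finite_bisetD(1)[OF assms(2)] by (auto simp: fixpts_def)
  ultimately show "mark H G (U \<uplus> V) K = (mark H G U + mark H G V) K"
    by (auto simp: mark_def card_Plus)
qed

lemma mark_empty: "mark H G empty_biset = 0"
  by (auto simp: mark_def fixpts_def empty_biset_def fun_eq_iff)

lemma mark_iso:
  assumes "biset_iso H G U V" "finite_biset H G U"
  shows "mark H G U = mark H G V"
proof
  fix K
  obtain f where f: "bij_betw f (bset U) (bset V)"
    and l: "\<And>h u. h \<in> carrier H \<Longrightarrow> u \<in> bset U \<Longrightarrow> f (lact U h u) = lact V h (f u)"
    and r: "\<And>g u. g \<in> carrier G \<Longrightarrow> u \<in> bset U \<Longrightarrow> f (ract U u g) = ract V (f u) g"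
    using assms(1) unfolding biset_iso_def by blast
  note closed = finite_bisetD(2,5)[OF assms(2)]
  have "bij_betw f (fixpts U K) (fixpts V K)" if K: "K \<subseteq> carrier H \<times> carrier G"
  proof (rule bij_betw_imageI)
    show "inj_on f (fixpts U K)"
      using f by (auto simp: bij_betw_def fixpts_def inj_on_def)
    have "f u \<in> fixpts V K \<longleftrightarrow> u \<in> fixpts U K" if "u \<in> bset U" for u
    proof -
      have "lact V h (f u) = ract V (f u) g \<longleftrightarrow> lact U h u = ract U u g" if "(h, g) \<in> K" for h g
      proof -
        have hg: "h \<in> carrier H" "g \<in> carrier G" using K that by auto
        then have "lact V h (f u) = f (lact U h u)" "ract V (f u) g = f (ract U u g)"
          using l r \<open>u \<in> bset U\<close> by auto
        moreover have "inj_on f (bset U)" using f by (simp add: bij_betw_def)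
        ultimately show ?thesis using closed hg \<open>u \<in> bset U\<close> by (simp add: inj_on_eq_iff)
      qed
      then show ?thesis
        using that f by (auto simp: fixpts_def bij_betw_def)
    qed
    moreover have "bset V = f ` bset U" using f by (simp add: bij_betw_def)
    moreover have "fixpts U K \<subseteq> bset U" "fixpts V K \<subseteq> bset V" by (auto simp: fixpts_def)
    ultimately show "f ` fixpts U K = fixpts V K" by (auto simp: subset_iff)
  qed
  then show "mark H G U K = mark H G V K"
    unfolding mark_def by (auto dest: bij_betw_same_card)
qed

section \<open>Orbits and Burnside's theorem\<close>

definition orbit_of :: "'h monoid \<Rightarrow> 'g monoid \<Rightarrow> ('h, 'g, 'u) biset \<Rightarrow> 'u \<Rightarrow> 'u set" where
  "orbit_of H G U u = (\<lambda>(h, g). ract U (lact U h u) g) ` (carrier H \<times> carrier G)"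

lemma orbit_of_stable:
  assumes "finite_biset H G U" "group H" "group G" "u \<in> bset U"
  shows "orbit_of H G U u \<subseteq> bset U"
    and "u \<in> orbit_of H G U u"
    and "\<And>h w. h \<in> carrier H \<Longrightarrow> w \<in> bset U \<Longrightarrow>
           lact U h w \<in> orbit_of H G U u \<longleftrightarrow> w \<in> orbit_of H G U u"
    and "\<And>g w. g \<in> carrier G \<Longrightarrow> w \<in> bset U \<Longrightarrow>
           ract U w g \<in> orbit_of H G U u \<longleftrightarrow> w \<in> orbit_of H G U u"
proof -
  interpret H: group H by fact
  interpret G: group G by fact
  note U = finite_bisetD[OF assms(1)]
  note linv = finite_biset_lact_inv[OF assms(1,2)] and rinv = finite_biset_ract_inv[OF assms(1,3)]
  show sub: "orbit_of H G U u \<subseteq> bset U"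
    using U assms(4) by (auto simp: orbit_of_def)
  show "u \<in> orbit_of H G U u"
    unfolding orbit_of_def using U assms(4) by (intro image_eqI[of _ _ "(\<one>\<^bsub>H\<^esub>, \<one>\<^bsub>G\<^esub>)"]) auto
  have l: "lact U h w \<in> orbit_of H G U u" if "h \<in> carrier H" "w \<in> orbit_of H G U u" for h w
  proof -
    from that obtain k g where kg: "k \<in> carrier H" "g \<in> carrier G" "w = ract U (lact U k u) g"
      by (auto simp: orbit_of_def)
    have "lact U h w = ract U (lact U (h \<otimes>\<^bsub>H\<^esub> k) u) g"
      using kg that U assms(4) by simp
    then show ?thesis unfolding orbit_of_def using kg that
      by (intro image_eqI[of _ _ "(h \<otimes>\<^bsub>H\<^esub> k, g)"]) auto
  qed
  have r: "ract U w h \<in> orbit_of H G U u" if "h \<in> carrier G" "w \<in> orbit_of H G U u" for h w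
  proof -
    from that obtain k g where kg: "k \<in> carrier H" "g \<in> carrier G" "w = ract U (lact U k u) g"
      by (auto simp: orbit_of_def)
    have "ract U w h = ract U (lact U k u) (g \<otimes>\<^bsub>G\<^esub> h)"
      using kg that U assms(4) by simp
    then show ?thesis unfolding orbit_of_def using kg that
      by (intro image_eqI[of _ _ "(k, g \<otimes>\<^bsub>G\<^esub> h)"]) auto
  qed
  show "lact U h w \<in> orbit_of H G U u \<longleftrightarrow> w \<in> orbit_of H G U u"
    if "h \<in> carrier H" "w \<in> bset U" for h w
    using l[of h w] l[of "inv\<^bsub>H\<^esub> h" "lact U h w"] linv(1) that by auto
  show "ract U w g \<in> orbit_of H G U u \<longleftrightarrow> w \<in> orbit_of H G U u"
    if "g \<in> carrier G" "w \<in> bset U" for g w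
    using r[of g w] r[of "inv\<^bsub>G\<^esub> g" "ract U w g"] rinv(1) that by auto
qed

lemma finite_biset_restrict:
  assumes "finite_biset H G U" "A \<subseteq> bset U"
    and "\<And>h w. h \<in> carrier H \<Longrightarrow> w \<in> A \<Longrightarrow> lact U h w \<in> A"
    and "\<And>g w. g \<in> carrier G \<Longrightarrow> w \<in> A \<Longrightarrow> ract U w g \<in> A"
  shows "finite_biset H G (U\<lparr>bset := A\<rparr>)"
  using assms(1) unfolding finite_biset_def
  using assms(2,3,4) by (auto intro: finite_subset simp: subset_iff)

text \<open>Both orbits are images of \<open>carrier H \<times> carrier G\<close>, and the
  stabilizer alone decides which parameters have the same image.\<close>

lemma orbit_iso_stab:
  assumes "finite_biset H G U" "finite_biset H G V" "group H" "group G"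
    and "u \<in> bset U" "v \<in> bset V" "stab H G U u = stab H G V v"
  shows "biset_iso H G (U\<lparr>bset := orbit_of H G U u\<rparr>) (V\<lparr>bset := orbit_of H G V v\<rparr>)"
proof -
  interpret H: group H by fact
  interpret G: group G by fact
  \<comment> \<open>Cancelling \<open>h'\<close> on the left and \<open>g\<close> on the right turns
    the equation into membership of one pair in the stabilizer. It is stated for every element type,
    as \<open>U\<close> and \<open>V\<close> may have different ones.\<close>
  have key: "ract W (lact W h w) g = ract W (lact W h' w) g' \<longleftrightarrow>
      (inv\<^bsub>H\<^esub> h' \<otimes>\<^bsub>H\<^esub> h, g' \<otimes>\<^bsub>G\<^esub> inv\<^bsub>G\<^esub> g) \<in> stab H G W w"
    if W: "finite_biset H G W" and "w \<in> bset W"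
      and hg: "h \<in> carrier H" "g \<in> carrier G" "h' \<in> carrier H" "g' \<in> carrier G"
    for W :: "('a, 'b, 'x) biset" and w h g h' g'
  proof -
    note W' = finite_bisetD[OF W]
    note li = finite_biset_lact_inv[OF W assms(3)] and ri = finite_biset_ract_inv[OF W assms(4)]
    let ?L = "lact W (inv\<^bsub>H\<^esub> h') (lact W h w)" and ?R = "ract W (ract W w g') (inv\<^bsub>G\<^esub> g)"
    have 1: "lact W h' (ract W ?L g) = ract W (lact W h w) g"
      using hg that(2) W' li by simp
    have 2: "lact W h' (ract W ?R g) = ract W (lact W h' w) g'"
      using hg that(2) W' ri by simp
    have 3: "ract W (lact W (inv\<^bsub>H\<^esub> h') (ract W (lact W h w) g)) (inv\<^bsub>G\<^esub> g) = ?L"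
      using hg that(2) W' ri by simp
    have 4: "ract W (lact W (inv\<^bsub>H\<^esub> h') (ract W (lact W h' w) g')) (inv\<^bsub>G\<^esub> g) = ?R"
      using hg that(2) W' li by simp
    have "ract W (lact W h w) g = ract W (lact W h' w) g' \<longleftrightarrow> ?L = ?R"
      using 1 2 3 4 by metis
    then show ?thesis
      using hg that(2) W' by (simp add: stab_def)
  qed
  note U = finite_bisetD[OF assms(1)] and V = finite_bisetD[OF assms(2)]
  show ?thesis
  proof (rule biset_iso_via[where Z = "carrier H \<times> carrier G"
        and a = "\<lambda>(h, g). ract U (lact U h u) g" and b = "\<lambda>(h, g). ract V (lact V h v) g"], goal_cases)
    case 1 show ?case by (simp add: orbit_of_def)
  next
    case 2 show ?case by (simp add: orbit_of_def)
  next
    case (3 z z')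
    then show ?case
      using key[OF assms(1,5)] key[OF assms(2,6)] assms(7) by (auto split: prod.splits)
  next
    case (4 k z)
    obtain h g where "z = (h, g)" by (cases z)
    with 4 show ?case
      using U V assms(5,6) by (intro bexI[of _ "(k \<otimes>\<^bsub>H\<^esub> h, g)"]) auto
  next
    case (5 k z)
    obtain h g where "z = (h, g)" by (cases z)
    with 5 show ?case
      using U V assms(5,6) by (intro bexI[of _ "(h, g \<otimes>\<^bsub>G\<^esub> k)"]) auto
  qed
qed

lemma mark_orbit_split:
  assumes "finite_biset H G U" "group H" "group G" "u \<in> bset U"
  shows "mark H G U = mark H G (U\<lparr>bset := orbit_of H G U u\<rparr>)
           + mark H G (U\<lparr>bset := bset U - orbit_of H G U u\<rparr>)"
proof -
  let ?O = "orbit_of H G U u"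
  have "mark H G U = (\<Sum>b\<in>(UNIV :: bool set). mark H G (U\<lparr>bset := if b then ?O else bset U - ?O\<rparr>))"
    using finite_bisetD(1)[OF assms(1)] orbit_of_stable(1)[OF assms]
    by (intro mark_disjoint_union) (auto simp: finite_subset UNIV_bool)
  then show ?thesis by (simp add: UNIV_bool add.commute)
qed

text \<open>Burnside's theorem. A point of \<open>U\<close> whose stabilizer is maximal has a partner in \<open>V\<close> with the
  same stabilizer; the two orbits are isomorphic and can be removed.\<close>

theorem iso_if_mark_eq:
  assumes "finite_biset H G U" "finite_biset H G V" "group H" "group G"
    and "mark H G U = mark H G V"
  shows "biset_iso H G U V"
  using assms(1,2,5)
proof (induction "card (bset U)" arbitrary: U V rule: less_induct)
  case less
  interpret H: group H by fact
  interpret G: group G by fact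
  note U = finite_bisetD[OF less.prems(1)] and V = finite_bisetD[OF less.prems(2)]
  have fixpts_empty: "fixpts U K = {} \<longleftrightarrow> fixpts V K = {}" if "K \<subseteq> carrier H \<times> carrier G" for K
  proof -
    have "card (fixpts U K) = card (fixpts V K)"
      using fun_cong[OF less.prems(3), of K] that by (simp add: mark_def)
    moreover have "finite (fixpts U K)" "finite (fixpts V K)"
      using U(1) V(1) by (auto simp: fixpts_def)
    ultimately show ?thesis by (metis card_0_eq)
  qed
  show ?case
  proof (cases "bset U = {}")
    case True
    then have "bset V = {}"
      using fixpts_empty[of "{}"] by (simp add: fixpts_def)
    with True show ?thesis
      unfolding biset_iso_def by (auto simp: bij_betw_def)
  next
    case False
    define S where "S = stab H G U ` bset U"
    have "finite S" "S \<noteq> {}" using U(1) False by (auto simp: S_def)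
    then obtain K where K: "K \<in> S" "\<And>L. L \<in> S \<Longrightarrow> K \<subseteq> L \<Longrightarrow> K = L"
      by (metis finite_has_maximal)
    then obtain u where u: "u \<in> bset U" "K = stab H G U u" by (auto simp: S_def)
    have Ksub: "K \<subseteq> carrier H \<times> carrier G" by (auto simp: u stab_def)
    have "u \<in> fixpts U K" using u Ksub by (simp add: mem_fixpts_iff)
    then obtain v where "v \<in> fixpts V K" using fixpts_empty[OF Ksub] by blast
    then have v: "v \<in> bset V" "K \<subseteq> stab H G V v" using Ksub by (simp_all add: mem_fixpts_iff)
    \<comment> \<open>The argument now runs back from \<open>V\<close> to \<open>U\<close>: the
      stabilizer of \<open>v\<close> lies in that of some point of \<open>U\<close>, and maximality
      of \<open>K\<close> forces equality all around.\<close>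
    have "v \<in> fixpts V (stab H G V v)"
      using v(1) by (subst mem_fixpts_iff[OF stab_subset]) simp
    then obtain u' where "u' \<in> fixpts U (stab H G V v)" using fixpts_empty[OF stab_subset[of H G V v]] by blast
    then have "u' \<in> bset U" "stab H G V v \<subseteq> stab H G U u'"
      using stab_subset[of H G V v] by (simp_all add: mem_fixpts_iff)
    with v K have stab_eq: "stab H G U u = stab H G V v" unfolding S_def u(2) by blast
    let ?O = "orbit_of H G U u" and ?O' = "orbit_of H G V v"
    note iso = orbit_iso_stab[OF less.prems(1,2) assms(3,4) u(1) v(1) stab_eq]
    note st = orbit_of_stable[OF less.prems(1) assms(3,4) u(1)]
      and st' = orbit_of_stable[OF less.prems(2) assms(3,4) v(1)]
    let ?U = "U\<lparr>bset := bset U - ?O\<rparr>" and ?V = "V\<lparr>bset := bset V - ?O'\<rparr>"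
    have fU: "finite_biset H G ?U" and fO: "finite_biset H G (U\<lparr>bset := ?O\<rparr>)"
      using less.prems(1) st U by (auto intro!: finite_biset_restrict)
    have fV: "finite_biset H G ?V"
      using less.prems(2) st' V by (auto intro!: finite_biset_restrict)
    have "mark H G ?U = mark H G ?V"
      using mark_orbit_split[OF less.prems(1) assms(3,4) u(1)] less.prems(3)
        mark_orbit_split[OF less.prems(2) assms(3,4) v(1)] mark_iso[OF iso fO] by simp
    moreover have "card (bset ?U) < card (bset U)"
      using U(1) st(1,2) u(1) by (auto intro!: psubset_card_mono)
    ultimately have "biset_iso H G ?U ?V"
      using less.hyps fU fV by blast
    then obtain f where f: "bij_betw f (bset U - ?O) (bset V - ?O')"
      and fl: "\<And>h w. h \<in> carrier H \<Longrightarrow> w \<in> bset U - ?O \<Longrightarrow> f (lact U h w) = lact V h (f w)"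
      and fr: "\<And>g w. g \<in> carrier G \<Longrightarrow> w \<in> bset U - ?O \<Longrightarrow> f (ract U w g) = ract V (f w) g"
      unfolding biset_iso_def by auto
    from iso obtain k where k: "bij_betw k ?O ?O'"
      and kl: "\<And>h w. h \<in> carrier H \<Longrightarrow> w \<in> ?O \<Longrightarrow> k (lact U h w) = lact V h (k w)"
      and kr: "\<And>g w. g \<in> carrier G \<Longrightarrow> w \<in> ?O \<Longrightarrow> k (ract U w g) = ract V (k w) g"
      unfolding biset_iso_def by auto
    let ?q = "\<lambda>w. if w \<in> ?O then k w else f w"
    have "bij_betw ?q (?O \<union> (bset U - ?O)) (?O' \<union> (bset V - ?O'))"
    proof (rule bij_betw_combine)
      show "bij_betw ?q ?O ?O'" using k by (simp cong: bij_betw_cong)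
      show "bij_betw ?q (bset U - ?O) (bset V - ?O')"
        using f by (subst bij_betw_cong[of _ _ f]) auto
    qed auto
    moreover have "?O \<union> (bset U - ?O) = bset U" "?O' \<union> (bset V - ?O') = bset V"
      using st(1) st'(1) by auto
    ultimately have "bij_betw ?q (bset U) (bset V)" by simp
    then show ?thesis
      unfolding biset_iso_def
      using fl fr kl kr st st' by (intro exI[of _ ?q]) auto
  qed
qed

section \<open>The Burnside group as a group of virtual marks\<close>

text \<open>The element of B(H, G) with virtual marks \<open>d\<close>, as a set of representatives
  in the encoding of \<open>biset_diff\<close>; stable isomorphism is replaced by an equation
  between functions.\<close>

definition vclass :: "'h monoid \<Rightarrow> 'g monoid \<Rightarrow> (('h \<times> 'g) set \<Rightarrow> int) \<Rightarrow> ('h, 'g) vbiset" where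
  "vclass H G d = {(U, V). finite_biset H G U \<and> finite_biset H G V \<and> mark H G U - mark H G V = d}"

text \<open>The image of B(H, G) under the mark homomorphism. Not every integer-valued function
  occurs.\<close>

definition vmarks :: "'h monoid \<Rightarrow> 'g monoid \<Rightarrow> (('h \<times> 'g) set \<Rightarrow> int) set" where
  "vmarks H G = {mark H G U - mark H G V | (U :: ('h, 'g, nat) biset) (V :: ('h, 'g, nat) biset).
                   finite_biset H G U \<and> finite_biset H G V}"

text \<open>An auxiliary summand \<open>W\<close> adds the same marks to both sides and cancels;
  Burnside's theorem then turns equal marks back into an isomorphism, even with \<open>W\<close>
  empty.\<close>

lemma biset_diff_eq_vclass:
  assumes "finite_biset H G U" "finite_biset H G V" "group H" "group G"
  shows "biset_diff H G U V = vclass H G (mark H G U - mark H G V)"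
proof -
  have "(\<exists>W :: ('a, 'b, nat) biset. finite_biset H G W \<and> biset_iso H G (U \<uplus> V' \<uplus> W) (U' \<uplus> V \<uplus> W))
      \<longleftrightarrow> mark H G U' - mark H G V' = mark H G U - mark H G V"
    if f: "finite_biset H G U'" "finite_biset H G V'" for U' V' :: "('a, 'b, nat) biset"
  proof -
    have "biset_iso H G (U \<uplus> V' \<uplus> W) (U' \<uplus> V \<uplus> W) \<longleftrightarrow>
        mark H G U' - mark H G V' = mark H G U - mark H G V"
      if W: "finite_biset H G W" for W :: "('a, 'b, nat) biset"
    proof -
      have "biset_iso H G (U \<uplus> V' \<uplus> W) (U' \<uplus> V \<uplus> W) \<longleftrightarrow>
          mark H G (U \<uplus> V' \<uplus> W) = mark H G (U' \<uplus> V \<uplus> W)"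
        using f W assms by (meson mark_iso iso_if_mark_eq finite_biset_sum)
      also have "\<dots> \<longleftrightarrow> mark H G U + mark H G V' + mark H G W = mark H G U' + mark H G V + mark H G W"
        using f W assms by (simp add: mark_sum finite_biset_sum)
      also have "\<dots> \<longleftrightarrow> mark H G U' - mark H G V' = mark H G U - mark H G V"
        by (auto simp: algebra_simps)
      finally show ?thesis .
    qed
    then show ?thesis using finite_biset_empty by blast
  qed
  then show ?thesis unfolding biset_diff_def vclass_def by blast
qed

text \<open>Tensor products and sets of cosets do not consist of natural numbers; transport along an
  injection leads back to the representatives used in \<open>burnside\<close>.\<close>

lemma ex_nat_biset:
  assumes "finite_biset H G U"
  obtains U' :: "('h, 'g, nat) biset"
  where "finite_biset H G U'" "biset_iso H G U U'"
proof -
  note U = finite_bisetD[OF assms]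
  obtain e :: "_ \<Rightarrow> nat" where e: "inj_on e (bset U)"
    using U(1) finite_imp_inj_to_nat_seg by metis
  define d where "d = inv_into (bset U) e"
  have d: "d (e u) = u" if "u \<in> bset U" for u
    using e that by (simp add: d_def)
  let ?U' = "\<lparr>bset = e ` bset U, lact = \<lambda>h n. e (lact U h (d n)),
    ract = \<lambda>n g. e (ract U (d n) g)\<rparr> :: ('h, 'g, nat) biset"
  have "finite_biset H G ?U'"
    unfolding finite_biset_def using U d by auto
  moreover have "biset_iso H G U ?U'"
    unfolding biset_iso_def using e d by (intro exI[of _ e]) (auto simp: bij_betw_def)
  ultimately show thesis by (rule that)
qed

lemma mark_diff_in_vmarks:
  assumes "finite_biset H G U" "finite_biset H G V"
  shows "mark H G U - mark H G V \<in> vmarks H G"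
proof -
  obtain U' :: "('a, 'b, nat) biset" where U': "finite_biset H G U'" "biset_iso H G U U'"
    using ex_nat_biset[OF assms(1)] by blast
  obtain V' :: "('a, 'b, nat) biset" where V': "finite_biset H G V'" "biset_iso H G V V'"
    using ex_nat_biset[OF assms(2)] by blast
  have "mark H G U = mark H G U'" "mark H G V = mark H G V'"
    using mark_iso U'(2) V'(2) assms by blast+
  then show ?thesis
    using U'(1) V'(1) unfolding vmarks_def by auto
qed

lemma mark_in_vmarks:
  assumes "finite_biset H G U"
  shows "mark H G U \<in> vmarks H G"
  using mark_diff_in_vmarks[OF assms finite_biset_empty] by (simp add: mark_empty)

lemma vmarksE:
  assumes "d \<in> vmarks H G"
  obtains U V :: "('h, 'g, nat) biset"
  where "finite_biset H G U" "finite_biset H G V" "d = mark H G U - mark H G V"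
  using assms unfolding vmarks_def by blast

lemma zero_in_vmarks: "0 \<in> vmarks H G"
  using mark_in_vmarks[OF finite_biset_empty, of H G] by (simp add: mark_empty)

lemma add_in_vmarks:
  assumes "d \<in> vmarks H G" "d' \<in> vmarks H G"
  shows "d + d' \<in> vmarks H G"
proof -
  obtain U V :: "('a, 'b, nat) biset"
    where U: "finite_biset H G U" "finite_biset H G V" "d = mark H G U - mark H G V"
    using vmarksE[OF assms(1)] .
  obtain U' V' :: "('a, 'b, nat) biset"
    where U': "finite_biset H G U'" "finite_biset H G V'" "d' = mark H G U' - mark H G V'"
    using vmarksE[OF assms(2)] .
  have "d + d' = mark H G (U \<uplus> U') - mark H G (V \<uplus> V')"
    using U U' by (simp add: mark_sum)
  then show ?thesis
    using U U' by (simp add: mark_diff_in_vmarks finite_biset_sum)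
qed

lemma minus_in_vmarks:
  assumes "d \<in> vmarks H G"
  shows "- d \<in> vmarks H G"
  using assms by (metis minus_diff_eq mark_diff_in_vmarks vmarksE)

text \<open>Induction upwards and downwards from 0. The set \<open>D\<close> is left open because
  both \<open>vmarks\<close> and \<open>ideal_marks\<close> are additive groups of this
  kind.\<close>

lemma scale_closed:
  fixes d :: "'x \<Rightarrow> int"
  assumes zero: "0 \<in> D" and add: "\<And>d d'. d \<in> D \<Longrightarrow> d' \<in> D \<Longrightarrow> d + d' \<in> D"
    and minus: "\<And>d. d \<in> D \<Longrightarrow> - d \<in> D" and d: "d \<in> D"
  shows "(\<lambda>K. n * d K) \<in> D"
proof (induction n rule: int_induct[where k = 0])
  case base
  have "(\<lambda>K. 0 * d K) = 0" by auto
  then show ?case using zero by simp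
next
  case (step1 n)
  have "(\<lambda>K. (n + 1) * d K) = (\<lambda>K. n * d K) + d" by (auto simp: algebra_simps)
  then show ?case using add[OF step1(2) d] by simp
next
  case (step2 n)
  have "(\<lambda>K. (n - 1) * d K) = (\<lambda>K. n * d K) + - d" by (auto simp: algebra_simps)
  then show ?case using add[OF step2(2) minus[OF d]] by simp
qed

lemma scale_in_vmarks: "d \<in> vmarks H G \<Longrightarrow> (\<lambda>K. n * d K) \<in> vmarks H G"
  by (rule scale_closed[OF zero_in_vmarks add_in_vmarks minus_in_vmarks])

text \<open>A representative determines its marks, and the class of \<open>d\<close> has one; it is
  therefore enough that one of the two functions is virtual.\<close>

lemma vclass_inject:
  assumes "d \<in> vmarks H G"
  shows "vclass H G d = vclass H G d' \<longleftrightarrow> d = d'"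
proof -
  obtain x where "x \<in> vclass H G d"
    using assms unfolding vmarks_def vclass_def by blast
  then show ?thesis unfolding vclass_def by force
qed

text \<open>Operations on classes are unions over representatives. Such a union is the common value
  of its members, provided that the class is nonempty, which is what membership in
  \<open>vmarks\<close> ensures.\<close>

lemma UN_vclass:
  assumes "d \<in> vmarks H G"
    and "\<And>U V. finite_biset H G U \<Longrightarrow> finite_biset H G V \<Longrightarrow> d = mark H G U - mark H G V \<Longrightarrow> F (U, V) = A"
  shows "(\<Union>x\<in>vclass H G d. F x) = A"
proof -
  have "F x = A" if "x \<in> vclass H G d" for x
    using that assms(2) unfolding vclass_def by blast
  moreover have "vclass H G d \<noteq> {}"
    using assms(1) unfolding vmarks_def vclass_def by blast
  ultimately show ?thesis by simp
qed

lemma carrier_burnside: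
  assumes "group H" "group G"
  shows "carrier (burnside H G) = vclass H G ` vmarks H G"
proof (intro subset_antisym subsetI)
  fix x assume "x \<in> carrier (burnside H G)"
  then obtain U V :: "('a, 'b, nat) biset"
    where "finite_biset H G U" "finite_biset H G V" "x = biset_diff H G U V"
    unfolding burnside_def by auto
  then show "x \<in> vclass H G ` vmarks H G"
    by (simp add: biset_diff_eq_vclass[OF _ _ assms] mark_diff_in_vmarks)
next
  fix x assume "x \<in> vclass H G ` vmarks H G"
  then obtain d where "d \<in> vmarks H G" "x = vclass H G d" by blast
  then obtain U V :: "('a, 'b, nat) biset"
    where "finite_biset H G U" "finite_biset H G V" "x = biset_diff H G U V"
    by (metis vmarksE biset_diff_eq_vclass[OF _ _ assms])
  then show "x \<in> carrier (burnside H G)"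
    unfolding burnside_def by auto
qed

lemma mult_burnside:
  assumes "group H" "group G" "d \<in> vmarks H G" "d' \<in> vmarks H G"
  shows "vclass H G d \<otimes>\<^bsub>burnside H G\<^esub> vclass H G d' = vclass H G (d + d')"
proof -
  have "vclass H G d \<otimes>\<^bsub>burnside H G\<^esub> vclass H G d' =
      (\<Union>x\<in>vclass H G d. \<Union>y\<in>vclass H G d'.
         case x of (U, V) \<Rightarrow> case y of (U', V') \<Rightarrow> biset_diff H G (U \<uplus> U') (V \<uplus> V'))"
    unfolding burnside_def by (simp add: case_prod_unfold)
  also have "\<dots> = vclass H G (d + d')"
  proof (intro UN_vclass assms, goal_cases)
    case (1 U V U' V')
    moreover from this have "mark H G (U \<uplus> U') - mark H G (V \<uplus> V') = d + d'"
      by (simp add: mark_sum)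
    ultimately show ?case
      by (simp add: biset_diff_eq_vclass[OF _ _ assms(1,2)] finite_biset_sum)
  qed
  finally show ?thesis .
qed

lemma one_burnside:
  assumes "group H" "group G"
  shows "\<one>\<^bsub>burnside H G\<^esub> = vclass H G 0"
  using biset_diff_eq_vclass[OF finite_biset_empty finite_biset_empty assms]
  unfolding burnside_def by simp

lemma comm_group_burnside:
  assumes "group H" "group G"
  shows "comm_group (burnside H G)"
proof (rule comm_groupI)
  fix x assume "x \<in> carrier (burnside H G)"
  then obtain d where d: "d \<in> vmarks H G" "x = vclass H G d"
    by (auto simp: carrier_burnside[OF assms])
  have "vclass H G (- d) \<otimes>\<^bsub>burnside H G\<^esub> x = \<one>\<^bsub>burnside H G\<^esub>"
    using d by (simp add: mult_burnside[OF assms] one_burnside[OF assms] minus_in_vmarks)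
  then show "\<exists>y\<in>carrier (burnside H G). y \<otimes>\<^bsub>burnside H G\<^esub> x = \<one>\<^bsub>burnside H G\<^esub>"
    using d by (auto simp: carrier_burnside[OF assms] minus_in_vmarks)
qed (auto simp: carrier_burnside[OF assms] mult_burnside[OF assms] one_burnside[OF assms]
      add_in_vmarks zero_in_vmarks add_ac)

section \<open>Tensor products of bisets\<close>

definition tcls ::
  "'h monoid \<Rightarrow> ('k, 'h, 'v) biset \<Rightarrow> ('h, 'g, 'u) biset \<Rightarrow> 'v \<Rightarrow> 'u \<Rightarrow> ('v \<times> 'u) set" where
  "tcls H V U v u = tensor_rel H V U `` {(v, u)}"

lemma tensor_rel_iff:
  assumes "finite_biset K H V" "finite_biset H G U"
  shows "((v, u), (v', u')) \<in> tensor_rel H V U \<longleftrightarrow>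
    v' \<in> bset V \<and> u \<in> bset U \<and> (\<exists>h\<in>carrier H. v = ract V v' h \<and> u' = lact U h u)"
  unfolding tensor_rel_def by auto

lemma equiv_tensor_rel:
  assumes "finite_biset K H V" "finite_biset H G U" "group H"
  shows "equiv (bset V \<times> bset U) (tensor_rel H V U)"
proof -
  interpret H: group H by fact
  note V = finite_bisetD[OF assms(1)] and U = finite_bisetD[OF assms(2)]
  note rel = tensor_rel_iff[OF assms(1,2)]
  show ?thesis
  proof (rule equivI)
    show "tensor_rel H V U \<subseteq> (bset V \<times> bset U) \<times> (bset V \<times> bset U)"
      using V U unfolding tensor_rel_def by auto
    show "refl_on (bset V \<times> bset U) (tensor_rel H V U)"
    proof (rule refl_onI)
      fix x assume x: "x \<in> bset V \<times> bset U"
      obtain v u where "x = (v, u)" by (cases x)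
      with x show "(x, x) \<in> tensor_rel H V U"
        using V(6) U(3) by (auto simp: rel intro!: bexI[of _ "\<one>\<^bsub>H\<^esub>"])
    qed
    show "sym (tensor_rel H V U)"
    proof (rule symI)
      fix a b assume ab: "(a, b) \<in> tensor_rel H V U"
      obtain v u v' u' where [simp]: "a = (v, u)" "b = (v', u')" by (cases a, cases b)
      from ab obtain h where h: "v' \<in> bset V" "u \<in> bset U" "h \<in> carrier H"
        "v = ract V v' h" "u' = lact U h u" by (auto simp: rel)
      then show "(b, a) \<in> tensor_rel H V U"
        using V U finite_biset_lact_inv(1)[OF assms(2,3), of h u]
          finite_biset_ract_inv(1)[OF assms(1,3), of h v']
        by (auto simp: rel intro!: bexI[of _ "inv\<^bsub>H\<^esub> h"])
    qed
    show "trans (tensor_rel H V U)"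
    proof (rule transI)
      fix a b c assume ab: "(a, b) \<in> tensor_rel H V U" and bc: "(b, c) \<in> tensor_rel H V U"
      obtain v u v' u' v'' u'' where [simp]: "a = (v, u)" "b = (v', u')" "c = (v'', u'')"
        by (cases a, cases b, cases c)
      from ab obtain h where h: "v' \<in> bset V" "u \<in> bset U" "h \<in> carrier H"
        "v = ract V v' h" "u' = lact U h u" by (auto simp: rel)
      from bc obtain k where k: "v'' \<in> bset V" "u' \<in> bset U" "k \<in> carrier H"
        "v' = ract V v'' k" "u'' = lact U k u'" by (auto simp: rel)
      show "(a, c) \<in> tensor_rel H V U"
        using h k V(7) U(4) by (auto simp: rel intro!: bexI[of _ "k \<otimes>\<^bsub>H\<^esub> h"])
    qed
  qed
qed

lemma tcls_eq_iff:
  assumes "finite_biset K H V" "finite_biset H G U" "group H"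
    and "v \<in> bset V" "u \<in> bset U" "v' \<in> bset V" "u' \<in> bset U"
  shows "tcls H V U v u = tcls H V U v' u' \<longleftrightarrow>
    (\<exists>h\<in>carrier H. v = ract V v' h \<and> u' = lact U h u)"
  unfolding tcls_def
  using eq_equiv_class_iff[OF equiv_tensor_rel[OF assms(1-3)], of "(v, u)" "(v', u')"]
    tensor_rel_iff[OF assms(1,2), of v u v' u'] assms by auto

lemma tcls_slide:
  assumes "finite_biset K H V" "finite_biset H G U" "group H"
    and "v \<in> bset V" "u \<in> bset U" "h \<in> carrier H"
  shows "tcls H V U (ract V v h) u = tcls H V U v (lact U h u)"
  using assms finite_bisetD[OF assms(1)] finite_bisetD[OF assms(2)]
  by (subst tcls_eq_iff[OF assms(1-3)]) auto

lemma bset_tensor: "bset (biset_tensor H V U) = (\<lambda>(v, u). tcls H V U v u) ` (bset V \<times> bset U)"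
  unfolding biset_tensor_def tcls_def quotient_def by auto

lemma tcls_in_tensor: "v \<in> bset V \<Longrightarrow> u \<in> bset U \<Longrightarrow> tcls H V U v u \<in> bset (biset_tensor H V U)"
  unfolding bset_tensor by auto

lemma tensorE:
  assumes "C \<in> bset (biset_tensor H V U)"
  obtains v u where "v \<in> bset V" "u \<in> bset U" "C = tcls H V U v u"
  using assms unfolding bset_tensor by auto

text \<open>All actions on tensor products are defined by taking images of classes. Equivariant maps
  carry the class of a pair onto the class of its image, so these actions can be computed on
  representatives.\<close>

lemma image_tcls:
  assumes V: "finite_biset K H V" "finite_biset K' H V'" and U: "finite_biset H G U" "finite_biset H G' U'"
    and H: "group H" and "v \<in> bset V" "u \<in> bset U"
    and f: "\<And>v. v \<in> bset V \<Longrightarrow> f v \<in> bset V'"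
      "\<And>v h. v \<in> bset V \<Longrightarrow> h \<in> carrier H \<Longrightarrow> f (ract V v h) = ract V' (f v) h"
    and g: "\<And>u. u \<in> bset U \<Longrightarrow> g u \<in> bset U'"
      "\<And>u h. u \<in> bset U \<Longrightarrow> h \<in> carrier H \<Longrightarrow> g (lact U h u) = lact U' h (g u)"
  shows "map_prod f g ` tcls H V U v u = tcls H V' U' (f v) (g u)"
proof -
  interpret H: group H by fact
  note V' = finite_bisetD[OF V(1)] finite_bisetD[OF V(2)]
    and U' = finite_bisetD[OF U(1)] finite_bisetD[OF U(2)]
  have mem: "(a, b) \<in> tcls H V U v u \<longleftrightarrow>
      a \<in> bset V \<and> (\<exists>h\<in>carrier H. v = ract V a h \<and> b = lact U h u)" for a b
    unfolding tcls_def using assms(7) by (simp add: tensor_rel_iff[OF V(1) U(1)])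
  have mem': "(a, b) \<in> tcls H V' U' (f v) (g u) \<longleftrightarrow>
      a \<in> bset V' \<and> (\<exists>h\<in>carrier H. f v = ract V' a h \<and> b = lact U' h (g u))" for a b
    unfolding tcls_def using assms(7) g by (simp add: tensor_rel_iff[OF V(2) U(2)])
  show ?thesis
  proof (intro subset_antisym subsetI)
    fix x assume "x \<in> map_prod f g ` tcls H V U v u"
    then show "x \<in> tcls H V' U' (f v) (g u)"
      using f g assms(6,7) by (fastforce simp: mem mem')
  next
    fix x assume x: "x \<in> tcls H V' U' (f v) (g u)"
    obtain a b where ab: "x = (a, b)" by (cases x)
    with x obtain h where h: "a \<in> bset V'" "h \<in> carrier H" "f v = ract V' a h" "b = lact U' h (g u)"
      by (auto simp: mem')
    \<comment> \<open>A preimage of \<open>a\<close>: since f v = a h, the equation a = f (v h^-1)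
      follows.\<close>
    let ?v = "ract V v (inv\<^bsub>H\<^esub> h)"
    have "a = f ?v"
      using h f assms(6) finite_biset_ract_inv(1)[OF V(2) H h(2,1)] by simp
    moreover have "b = g (lact U h u)" using h g assms(7) by simp
    moreover have "(?v, lact U h u) \<in> tcls H V U v u"
      unfolding mem using h(2) assms(6) finite_bisetD(5)[OF V(1)]
        finite_biset_ract_inv(2)[OF V(1) H h(2) assms(6)]
      by (intro conjI bexI[of _ h]) auto
    ultimately show "x \<in> map_prod f g ` tcls H V U v u"
      unfolding ab by (intro image_eqI[of _ _ "(?v, lact U h u)"]) auto
  qed
qed

lemma lact_tensor:
  assumes "finite_biset K H V" "finite_biset H G U" "group H"
    and "v \<in> bset V" "u \<in> bset U" "k \<in> carrier K"
  shows "lact (biset_tensor H V U) k (tcls H V U v u) = tcls H V U (lact V k v) u"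
  using assms finite_bisetD[OF assms(1)]
  unfolding biset_tensor_def biset.simps
  by (subst image_tcls[OF assms(1,1,2,2,3-5)]) auto

lemma ract_tensor:
  assumes "finite_biset K H V" "finite_biset H G U" "group H"
    and "v \<in> bset V" "u \<in> bset U" "g \<in> carrier G"
  shows "ract (biset_tensor H V U) (tcls H V U v u) g = tcls H V U v (ract U u g)"
  using assms finite_bisetD[OF assms(2)]
  unfolding biset_tensor_def biset.simps
  by (subst image_tcls[OF assms(1,1,2,2,3-5)]) auto

lemma finite_biset_tensor:
  assumes "finite_biset K H V" "finite_biset H G U" "group H" "group K" "group G"
  shows "finite_biset K G (biset_tensor H V U)"
proof -
  interpret K: group K by fact
  interpret G: group G by fact
  note V = finite_bisetD[OF assms(1)] and U = finite_bisetD[OF assms(2)]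
  note [simp] = lact_tensor[OF assms(1-3)] ract_tensor[OF assms(1-3)] V U tcls_in_tensor
  have "finite (bset (biset_tensor H V U))" unfolding bset_tensor using V(1) U(1) by simp
  then show ?thesis
    unfolding finite_biset_def by (auto elim!: tensorE)
qed

lemma tensor_iso:
  assumes V: "finite_biset K H V" "finite_biset K H V'"
    and U: "finite_biset H G U" "finite_biset H G U'" and H: "group H"
    and "biset_iso K H V V'" "biset_iso H G U U'"
  shows "biset_iso K G (biset_tensor H V U) (biset_tensor H V' U')"
proof -
  note D = finite_bisetD[OF V(1)] finite_bisetD[OF V(2)] finite_bisetD[OF U(1)] finite_bisetD[OF U(2)]
  obtain f where f: "bij_betw f (bset V) (bset V')"
    "\<And>k v. k \<in> carrier K \<Longrightarrow> v \<in> bset V \<Longrightarrow> f (lact V k v) = lact V' k (f v)"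
    "\<And>h v. h \<in> carrier H \<Longrightarrow> v \<in> bset V \<Longrightarrow> f (ract V v h) = ract V' (f v) h"
    using assms(6) unfolding biset_iso_def by blast
  obtain g where g: "bij_betw g (bset U) (bset U')"
    "\<And>h u. h \<in> carrier H \<Longrightarrow> u \<in> bset U \<Longrightarrow> g (lact U h u) = lact U' h (g u)"
    "\<And>k u. k \<in> carrier G \<Longrightarrow> u \<in> bset U \<Longrightarrow> g (ract U u k) = ract U' (g u) k"
    using assms(7) unfolding biset_iso_def by blast
  have fV: "f v \<in> bset V'" if "v \<in> bset V" for v using f(1) that by (auto simp: bij_betw_def)
  have gU: "g u \<in> bset U'" if "u \<in> bset U" for u using g(1) that by (auto simp: bij_betw_def)
  have finj: "f v = f v' \<longleftrightarrow> v = v'" if "v \<in> bset V" "v' \<in> bset V" for v v'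
    using f(1) that by (auto simp: bij_betw_def inj_on_eq_iff)
  have ginj: "g u = g u' \<longleftrightarrow> u = u'" if "u \<in> bset U" "u' \<in> bset U" for u u'
    using g(1) that by (auto simp: bij_betw_def inj_on_eq_iff)
  show ?thesis
  proof (rule biset_iso_via[where Z = "bset V \<times> bset U" and a = "\<lambda>(v, u). tcls H V U v u"
        and b = "\<lambda>(v, u). tcls H V' U' (f v) (g u)"], goal_cases)
    case 1 show ?case by (simp add: bset_tensor)
  next
    case 2
    have "bset V' \<times> bset U' = map_prod f g ` (bset V \<times> bset U)"
      using f(1) g(1) by (simp add: bij_betw_def map_prod_surj_on)
    then show ?case by (simp add: bset_tensor image_image case_prod_unfold)
  next
    case (3 z z')
    obtain v u v' u' where z: "z = (v, u)" "z' = (v', u')" by (cases z, cases z')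
    with 3 have *: "v \<in> bset V" "u \<in> bset U" "v' \<in> bset V" "u' \<in> bset U" by auto
    have "(f v = ract V' (f v') h \<and> g u' = lact U' h (g u)) \<longleftrightarrow> (v = ract V v' h \<and> u' = lact U h u)"
      if "h \<in> carrier H" for h
      using f(3)[symmetric] g(2)[symmetric] that * D by (simp add: finj ginj)
    then show ?case
      unfolding z prod.case tcls_eq_iff[OF V(1) U(1) H *]
        tcls_eq_iff[OF V(2) U(2) H fV[OF *(1)] gU[OF *(2)] fV[OF *(3)] gU[OF *(4)]] by blast
  next
    case (4 k z)
    then show ?case
      using fV gU f(2) D
      by (intro bexI[of _ "(lact V k (fst z), snd z)"])
         (auto simp: lact_tensor[OF V(1) U(1) H] lact_tensor[OF V(2) U(2) H])
  next
    case (5 k z)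
    then show ?case
      using fV gU g(3) D
      by (intro bexI[of _ "(fst z, ract U (snd z) k)"])
         (auto simp: ract_tensor[OF V(1) U(1) H] ract_tensor[OF V(2) U(2) H])
  qed
qed

lemma biset_sum_sel:
  "bset (U \<uplus> V) = bset U <+> bset V"
  "lact (U \<uplus> V) h = map_sum (lact U h) (lact V h)"
  "ract (U \<uplus> V) x g = map_sum (\<lambda>u. ract U u g) (\<lambda>v. ract V v g) x"
  unfolding biset_sum_def by auto

text \<open>The middle group never mixes the two summands, so a class of pairs lies entirely in one
  of them.\<close>

lemma tensor_sum_left_iso:
  assumes V: "finite_biset K H V" "finite_biset K H V'" and U: "finite_biset H G U" and H: "group H"
  shows "biset_iso K G (biset_tensor H (V \<uplus> V') U) (biset_tensor H V U \<uplus> biset_tensor H V' U)"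
proof -
  note D = finite_bisetD[OF V(1)] finite_bisetD[OF V(2)] finite_bisetD[OF U(1)]
  have VV: "finite_biset K H (V \<uplus> V')" using V by (rule finite_biset_sum)
  define b where "b = (\<lambda>z. case z of (x, u) \<Rightarrow>
    (case x of Inl v \<Rightarrow> Inl (tcls H V U v u) | Inr v \<Rightarrow> Inr (tcls H V' U v u)))"
  have b: "b (Inl v, u) = Inl (tcls H V U v u)" "b (Inr v', u) = Inr (tcls H V' U v' u)" for v v' u
    by (simp_all add: b_def)
  let ?Z = "(bset V <+> bset V') \<times> bset U"
  show ?thesis
  proof (rule biset_iso_via[where Z = ?Z and a = "\<lambda>(x, u). tcls H (V \<uplus> V') U x u" and b = b], goal_cases)
    case 1 show ?case by (simp add: bset_tensor biset_sum_sel)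
  next
    case 2
    have "b ` ?Z = b ` ((\<lambda>(v, u). (Inl v, u)) ` (bset V \<times> bset U) \<union> (\<lambda>(v, u). (Inr v, u)) ` (bset V' \<times> bset U))"
      by (rule arg_cong[where f = "image b"]) auto
    then show ?case unfolding biset_sum_sel bset_tensor
      by (simp add: image_Un image_image case_prod_unfold b Plus_def)
  next
    case (3 z z')
    obtain x u x' u' where z: "z = (x, u)" "z' = (x', u')" by (cases z, cases z')
    show ?case
      using 3 unfolding z
      by (cases x; cases x')
         (auto simp: b biset_sum_sel tcls_eq_iff[OF VV U H] tcls_eq_iff[OF V(1) U H] tcls_eq_iff[OF V(2) U H]
            tcls_slide[OF V(1) U H] tcls_slide[OF V(2) U H])
  next
    case (4 k z)
    obtain x u where z: "z = (x, u)" by (cases z)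
    show ?case
      using 4 D unfolding z
      by (cases x; intro bexI[of _ "(lact (V \<uplus> V') k x, u)"])
         (auto simp: b biset_sum_sel lact_tensor[OF VV U H] lact_tensor[OF V(1) U H] lact_tensor[OF V(2) U H])
  next
    case (5 k z)
    obtain x u where z: "z = (x, u)" by (cases z)
    show ?case
      using 5 D unfolding z
      by (cases x; intro bexI[of _ "(x, ract U u k)"])
         (auto simp: b biset_sum_sel ract_tensor[OF VV U H] ract_tensor[OF V(1) U H] ract_tensor[OF V(2) U H])
  qed
qed

lemma tensor_sum_right_iso:
  assumes V: "finite_biset K H V" and U: "finite_biset H G U" "finite_biset H G U'" and H: "group H"
  shows "biset_iso K G (biset_tensor H V (U \<uplus> U')) (biset_tensor H V U \<uplus> biset_tensor H V U')"
proof -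
  note D = finite_bisetD[OF V(1)] finite_bisetD[OF U(1)] finite_bisetD[OF U(2)]
  have UU: "finite_biset H G (U \<uplus> U')" using U by (rule finite_biset_sum)
  define b where "b = (\<lambda>z. case z of (v, x) \<Rightarrow>
    (case x of Inl u \<Rightarrow> Inl (tcls H V U v u) | Inr u \<Rightarrow> Inr (tcls H V U' v u)))"
  have b: "b (v, Inl u) = Inl (tcls H V U v u)" "b (v, Inr u') = Inr (tcls H V U' v u')" for v u u'
    by (simp_all add: b_def)
  let ?Z = "bset V \<times> (bset U <+> bset U')"
  show ?thesis
  proof (rule biset_iso_via[where Z = ?Z and a = "\<lambda>(v, x). tcls H V (U \<uplus> U') v x" and b = b], goal_cases)
    case 1 show ?case by (simp add: bset_tensor biset_sum_sel)
  next
    case 2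
    have "b ` ?Z = b ` ((\<lambda>(v, u). (v, Inl u)) ` (bset V \<times> bset U) \<union> (\<lambda>(v, u). (v, Inr u)) ` (bset V \<times> bset U'))"
      by (rule arg_cong[where f = "image b"]) auto
    then show ?case unfolding biset_sum_sel bset_tensor
      by (simp add: image_Un image_image case_prod_unfold b Plus_def)
  next
    case (3 z z')
    obtain v x v' x' where z: "z = (v, x)" "z' = (v', x')" by (cases z, cases z')
    show ?case
      using 3 unfolding z
      by (cases x; cases x')
         (auto simp: b biset_sum_sel tcls_eq_iff[OF V UU H] tcls_eq_iff[OF V U(1) H] tcls_eq_iff[OF V U(2) H]
            tcls_slide[OF V U(1) H] tcls_slide[OF V U(2) H])
  next
    case (4 k z)
    obtain v x where z: "z = (v, x)" by (cases z)
    show ?case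
      using 4 D unfolding z
      by (cases x; intro bexI[of _ "(lact V k v, x)"])
         (auto simp: b biset_sum_sel lact_tensor[OF V UU H] lact_tensor[OF V U(1) H] lact_tensor[OF V U(2) H])
  next
    case (5 k z)
    obtain v x where z: "z = (v, x)" by (cases z)
    show ?case
      using 5 D unfolding z
      by (cases x; intro bexI[of _ "(v, ract (U \<uplus> U') x k)"])
         (auto simp: b biset_sum_sel ract_tensor[OF V UU H] ract_tensor[OF V U(1) H] ract_tensor[OF V U(2) H])
  qed
qed

section \<open>Composition on virtual marks\<close>

context
  fixes K :: "'k monoid" and H :: "'h monoid" and G :: "'g monoid"
  assumes KHG: "group K" "group H" "group G"
begin

lemma mark_tensor_sum_left:
  assumes "finite_biset K H V" "finite_biset K H V'" "finite_biset H G U"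
  shows "mark K G (biset_tensor H (V \<uplus> V') U)
    = mark K G (biset_tensor H V U) + mark K G (biset_tensor H V' U)"
  using mark_iso[OF tensor_sum_left_iso[OF assms KHG(2)]] assms KHG
  by (simp add: mark_sum finite_biset_sum finite_biset_tensor)

lemma mark_tensor_sum_right:
  assumes "finite_biset K H V" "finite_biset H G U" "finite_biset H G U'"
  shows "mark K G (biset_tensor H V (U \<uplus> U'))
    = mark K G (biset_tensor H V U) + mark K G (biset_tensor H V U')"
  using mark_iso[OF tensor_sum_right_iso[OF assms KHG(2)]] assms KHG
  by (simp add: mark_sum finite_biset_sum finite_biset_tensor)

text \<open>Equal marks mean isomorphic factors by Burnside's theorem, and the tensor product
  respects isomorphism. Hence composition descends to marks.\<close>

lemma mark_tensor_cong:
  assumes "finite_biset K H V" "finite_biset K H V'" "finite_biset H G U" "finite_biset H G U'"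
    and "mark K H V = mark K H V'" "mark H G U = mark H G U'"
  shows "mark K G (biset_tensor H V U) = mark K G (biset_tensor H V' U')"
  by (rule mark_iso[OF tensor_iso[OF assms(1-4) KHG(2)
        iso_if_mark_eq[OF assms(1,2) KHG(1,2) assms(5)] iso_if_mark_eq[OF assms(3,4) KHG(2,3) assms(6)]]
        finite_biset_tensor[OF assms(1,3) KHG(2,1,3)]])

text \<open>Moving the subtracted terms across turns the equation of virtual marks into one between
  the disjoint unions of \<open>V\<close>, \<open>W'\<close> and of \<open>W\<close>,
  \<open>V'\<close>, to which distributivity applies.\<close>

lemma mark_tensor_diff_cong_left:
  assumes V: "finite_biset K H V" "finite_biset K H V'" "finite_biset K H W" "finite_biset K H W'"
    and "finite_biset H G U"
    and eq: "mark K H V - mark K H V' = mark K H W - mark K H W'"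
  shows "mark K G (biset_tensor H V U) - mark K G (biset_tensor H V' U)
    = mark K G (biset_tensor H W U) - mark K G (biset_tensor H W' U)"
proof -
  have "mark K H (V \<uplus> W') = mark K H (W \<uplus> V')"
    using V eq by (simp add: mark_sum algebra_simps)
  then have "mark K G (biset_tensor H (V \<uplus> W') U) = mark K G (biset_tensor H (W \<uplus> V') U)"
    using assms by (simp add: mark_tensor_cong finite_biset_sum)
  then show ?thesis
    using assms by (simp add: mark_tensor_sum_left algebra_simps)
qed

lemma mark_tensor_diff_cong_right:
  assumes U: "finite_biset H G U" "finite_biset H G U'" "finite_biset H G W" "finite_biset H G W'"
    and "finite_biset K H V"
    and eq: "mark H G U - mark H G U' = mark H G W - mark H G W'"
  shows "mark K G (biset_tensor H V U) - mark K G (biset_tensor H V U')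
    = mark K G (biset_tensor H V W) - mark K G (biset_tensor H V W')"
proof -
  have "mark H G (U \<uplus> W') = mark H G (W \<uplus> U')"
    using U eq by (simp add: mark_sum algebra_simps)
  then have "mark K G (biset_tensor H V (U \<uplus> W')) = mark K G (biset_tensor H V (W \<uplus> U'))"
    using assms by (simp add: mark_tensor_cong finite_biset_sum)
  then show ?thesis
    using assms by (simp add: mark_tensor_sum_right algebra_simps)
qed

lemma burnside_comp_vclass:
  assumes V: "finite_biset K H V" "finite_biset K H V'" and U: "finite_biset H G U" "finite_biset H G U'"
  shows "burnside_comp K H G (vclass K H (mark K H V - mark K H V')) (vclass H G (mark H G U - mark H G U'))
    = vclass K G ((mark K G (biset_tensor H V U) - mark K G (biset_tensor H V U'))
                 - (mark K G (biset_tensor H V' U) - mark K G (biset_tensor H V' U')))"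
  unfolding burnside_comp_def
proof (rule UN_vclass[OF mark_diff_in_vmarks[OF V]], unfold prod.case,
    rule UN_vclass[OF mark_diff_in_vmarks[OF U]], unfold prod.case, goal_cases)
  case (1 W W' T T')
  note t = finite_biset_tensor[OF _ _ KHG(2,1,3)]
  have "mark K G (biset_tensor H W T \<uplus> biset_tensor H W' T')
      - mark K G (biset_tensor H W T' \<uplus> biset_tensor H W' T)
      = (mark K G (biset_tensor H W T) - mark K G (biset_tensor H W T'))
       - (mark K G (biset_tensor H W' T) - mark K G (biset_tensor H W' T'))"
    using 1 by (simp add: mark_sum t)
  \<comment> \<open>The right factors are exchanged while the left ones stay fixed; after regrouping
    the double difference, the left factors are exchanged in the same way.\<close>
  also have "\<dots> = (mark K G (biset_tensor H W U) - mark K G (biset_tensor H W U'))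
       - (mark K G (biset_tensor H W' U) - mark K G (biset_tensor H W' U'))"
    using mark_tensor_diff_cong_right[OF 1(4,5) U 1(1) 1(6)[symmetric]]
      mark_tensor_diff_cong_right[OF 1(4,5) U 1(2) 1(6)[symmetric]] by simp
  also have "\<dots> = (mark K G (biset_tensor H W U) - mark K G (biset_tensor H W' U))
       - (mark K G (biset_tensor H W U') - mark K G (biset_tensor H W' U'))"
    by simp
  also have "\<dots> = (mark K G (biset_tensor H V U) - mark K G (biset_tensor H V' U))
       - (mark K G (biset_tensor H V U') - mark K G (biset_tensor H V' U'))"
    using mark_tensor_diff_cong_left[OF 1(1,2) V U(1) 1(3)[symmetric]]
      mark_tensor_diff_cong_left[OF 1(1,2) V U(2) 1(3)[symmetric]] by simp
  also have "\<dots> = (mark K G (biset_tensor H V U) - mark K G (biset_tensor H V U'))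
       - (mark K G (biset_tensor H V' U) - mark K G (biset_tensor H V' U'))"
    by simp
  finally show ?case
    using 1 by (simp only: biset_diff_eq_vclass[OF _ _ KHG(1,3)] finite_biset_sum t)
qed

end

section \<open>Two-sided and one-sided bisets\<close>

lemma group_opp_group:
  assumes "group G"
  shows "group (opp_group G)"
proof -
  interpret G: group G by fact
  show ?thesis
    by (rule groupI)
       (auto simp: opp_group_def G.m_assoc intro: bexI[of _ "inv\<^bsub>G\<^esub> x" for x])
qed

lemma opp_group_simps [simp]:
  "carrier (opp_group G) = carrier G"
  "\<one>\<^bsub>opp_group G\<^esub> = \<one>\<^bsub>G\<^esub>"
  "x \<otimes>\<^bsub>opp_group G\<^esub> y = y \<otimes>\<^bsub>G\<^esub> x"
  by (simp_all add: opp_group_def)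

lemma group_DirProd_opp:
  assumes "group Q" "group P"
  shows "group (Q \<times>\<times> opp_group P)"
  using assms by (intro DirProd_group group_opp_group)

lemma group_unit: "group unit_group"
  by simp

text \<open>The converse of \<^const>\<open>biset_to_left\<close>; the second group may be arbitrary, in which case its
  action is forgotten.\<close>

definition left_to_biset :: "'q monoid \<Rightarrow> 'p monoid \<Rightarrow> ('q \<times> 'p, 'g, 'u) biset \<Rightarrow> ('q, 'p, 'u) biset" where
  "left_to_biset Q P T =
     \<lparr>bset = bset T, lact = (\<lambda>q. lact T (q, \<one>\<^bsub>P\<^esub>)), ract = (\<lambda>t x. lact T (\<one>\<^bsub>Q\<^esub>, x) t)\<rparr>"

lemma left_to_biset_sel [simp]:
  "bset (left_to_biset Q P T) = bset T"
  "lact (left_to_biset Q P T) q = lact T (q, \<one>\<^bsub>P\<^esub>)"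
  "ract (left_to_biset Q P T) t x = lact T (\<one>\<^bsub>Q\<^esub>, x) t"
  by (simp_all add: left_to_biset_def)

lemma biset_to_left_sel [simp]:
  "bset (biset_to_left U) = bset U"
  "lact (biset_to_left U) (q, x) u = lact U q (ract U u x)"
  "ract (biset_to_left U) u y = u"
  by (simp_all add: biset_to_left_def)

lemma lact_DirProd_opp:
  assumes "finite_biset (Q \<times>\<times> opp_group P) G T" "group Q" "group P"
    and "q \<in> carrier Q" "q' \<in> carrier Q" "x \<in> carrier P" "x' \<in> carrier P" "t \<in> bset T"
  shows "lact T (q, x) (lact T (q', x') t) = lact T (q \<otimes>\<^bsub>Q\<^esub> q', x' \<otimes>\<^bsub>P\<^esub> x) t"
  using finite_bisetD(4)[OF assms(1), of "(q, x)" "(q', x')" t] assms by simp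

lemma finite_left_to_biset:
  assumes T: "finite_biset (Q \<times>\<times> opp_group P) G T" and QP: "group Q" "group P"
  shows "finite_biset Q P (left_to_biset Q P T)"
proof -
  interpret Q: group Q by fact
  interpret P: group P by fact
  note D = finite_bisetD[OF T]
  have one: "lact T (\<one>\<^bsub>Q\<^esub>, \<one>\<^bsub>P\<^esub>) t = t" if "t \<in> bset T" for t
    using D(3)[OF that] by simp
  show ?thesis
    unfolding finite_biset_def using D(1,2) by (auto simp: one lact_DirProd_opp[OF T QP])
qed

lemma finite_biset_to_left:
  assumes "finite_biset Q P U" "group Q" "group P"
  shows "finite_biset (Q \<times>\<times> opp_group P) unit_group (biset_to_left U)"
proof -
  note D = finite_bisetD[OF assms(1)]
  show ?thesis
    unfolding finite_biset_def using D by (auto simp: singleton_group_def)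
qed

lemma mark_left_to_biset_to_left:
  assumes T: "finite_biset (Q \<times>\<times> opp_group P) unit_group T" and QP: "group Q" "group P"
  shows "mark (Q \<times>\<times> opp_group P) unit_group (biset_to_left (left_to_biset Q P T))
    = mark (Q \<times>\<times> opp_group P) unit_group T"
proof -
  interpret Q: group Q by fact
  interpret P: group P by fact
  have "ract T t () = t" if "t \<in> bset T" for t
    using finite_bisetD(6)[OF T that] by (simp add: singleton_group_def)
  then have "biset_iso (Q \<times>\<times> opp_group P) unit_group (biset_to_left (left_to_biset Q P T)) T"
    unfolding biset_iso_def
    by (intro exI[of _ id]) (auto simp: lact_DirProd_opp[OF T QP])
  then show ?thesis
    using T QP by (intro mark_iso finite_biset_to_left finite_left_to_biset)
qed

text \<open>Since \<open>q u x = u\<close> iff \<open>q u = u x\<inverse>\<close>, the marks of \<open>U\<close> as a left biset are its marks at the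
  sets twisted by inversion.\<close>

definition twist :: "'p monoid \<Rightarrow> (('q \<times> 'p) \<times> unit) set \<Rightarrow> ('q \<times> 'p) set" where
  "twist P K = (\<lambda>((q, x), _). (q, inv\<^bsub>P\<^esub> x)) ` K"

text \<open>Off the admissible sets the value is 0, as for \<open>mark\<close>, so that the two can
  agree as functions.\<close>

definition left_marks ::
  "'q monoid \<Rightarrow> 'p monoid \<Rightarrow> (('q \<times> 'p) set \<Rightarrow> int) \<Rightarrow> (('q \<times> 'p) \<times> unit) set \<Rightarrow> int" where
  "left_marks Q P d = (\<lambda>K. if K \<subseteq> (carrier Q \<times> carrier P) \<times> {()} then d (twist P K) else 0)"

lemma left_marks_diff: "left_marks Q P (d - d') = left_marks Q P d - left_marks Q P d'"
  by (auto simp: left_marks_def)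

lemma mark_biset_to_left:
  assumes U: "finite_biset Q P U" and QP: "group Q" "group P"
  shows "mark (Q \<times>\<times> opp_group P) unit_group (biset_to_left U) = left_marks Q P (mark Q P U)"
proof
  fix K :: "(('a \<times> 'b) \<times> unit) set"
  interpret P: group P by fact
  note D = finite_bisetD[OF U]
  have c: "carrier (Q \<times>\<times> opp_group P) \<times> carrier unit_group = (carrier Q \<times> carrier P) \<times> {()}"
    by (auto simp: singleton_group_def)
  show "mark (Q \<times>\<times> opp_group P) unit_group (biset_to_left U) K = left_marks Q P (mark Q P U) K"
  proof (cases "K \<subseteq> (carrier Q \<times> carrier P) \<times> {()}")
    case True
    then have "twist P K \<subseteq> carrier Q \<times> carrier P" by (auto simp: twist_def)
    moreover have "lact U q (ract U u x) = u \<longleftrightarrow> lact U q u = ract U u (inv\<^bsub>P\<^esub> x)"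
      if "u \<in> bset U" "q \<in> carrier Q" "x \<in> carrier P" for u q x
    proof -
      have "lact U q (ract U u x) = u \<longleftrightarrow>
          ract U (lact U q (ract U u x)) (inv\<^bsub>P\<^esub> x) = ract U u (inv\<^bsub>P\<^esub> x)"
        using finite_biset_ract_inv(2)[OF U QP(2)] D that by metis
      then show ?thesis
        using finite_biset_ract_inv(1)[OF U QP(2)] D that by simp
    qed
    then have "fixpts (biset_to_left U) K = fixpts U (twist P K)"
      using True by (force simp: fixpts_def twist_def)
    ultimately show ?thesis
      using True by (simp add: mark_def left_marks_def c)
  qed (simp add: mark_def left_marks_def c)
qed

lemma left_marks_inject:
  assumes "group P" "d \<in> vmarks Q P" "d' \<in> vmarks Q P" "left_marks Q P d = left_marks Q P d'"
  shows "d = d'"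
proof
  fix K
  interpret P: group P by fact
  show "d K = d' K"
  proof (cases "K \<subseteq> carrier Q \<times> carrier P")
    case True
    \<comment> \<open>Inverting the second components once more produces a set whose twist is
      \<open>K\<close>.\<close>
    define L where "L = (\<lambda>(q, x). ((q, inv\<^bsub>P\<^esub> x), ())) ` K"
    have "twist P L = (\<lambda>(q, x). (q, inv\<^bsub>P\<^esub> (inv\<^bsub>P\<^esub> x))) ` K"
      by (simp add: twist_def L_def image_image case_prod_unfold)
    also have "\<dots> = (\<lambda>z. z) ` K"
      using True by (intro image_cong) auto
    finally have "twist P L = K" by simp
    moreover have "L \<subseteq> (carrier Q \<times> carrier P) \<times> {()}" using True by (auto simp: L_def)
    ultimately show ?thesis
      using fun_cong[OF assms(4), of L] by (simp add: left_marks_def)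
  next
    case False
    then have "f K = 0" if "f \<in> vmarks Q P" for f
      using vmarksE[OF that] by (metis mark_def minus_apply diff_zero)
    from this[OF assms(2)] this[OF assms(3)] show ?thesis by simp
  qed
qed

lemma burnside_to_left_vclass:
  assumes "group Q" "group P" "d \<in> vmarks Q P"
  shows "burnside_to_left Q P (vclass Q P d) = vclass (Q \<times>\<times> opp_group P) unit_group (left_marks Q P d)"
  unfolding burnside_to_left_def
proof (rule UN_vclass[OF assms(3)], unfold prod.case, goal_cases)
  case (1 U V)
  note QP = assms(1,2)
  show ?case
    unfolding 1(3) left_marks_diff mark_biset_to_left[OF 1(1) QP, symmetric]
      mark_biset_to_left[OF 1(2) QP, symmetric]
    by (rule biset_diff_eq_vclass[OF finite_biset_to_left[OF 1(1) QP]
          finite_biset_to_left[OF 1(2) QP] group_DirProd_opp[OF QP] group_unit])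
qed

section \<open>The ideal generated by a difference of two sets\<close>

text \<open>The generator is \<open>L - M\<close> for finite left \<open>S\<close>-sets \<open>L\<close> and \<open>M\<close>.\<close>

locale burnside_difference =
  fixes S :: "'s monoid" and L :: "('s, unit, 'l) biset" and M :: "('s, unit, 'm) biset"
  assumes S: "group S" and L: "finite_biset S unit_group L" and M: "finite_biset S unit_group M"
begin

definition comp_marks ::
  "'q monoid \<Rightarrow> 'p monoid \<Rightarrow> ('q \<times> 'p, 's, 'u) biset \<Rightarrow> ('q \<times> 'p) set \<Rightarrow> int" where
  "comp_marks Q P V = mark Q P (left_to_biset Q P (biset_tensor S V L))
     - mark Q P (left_to_biset Q P (biset_tensor S V M))"

text \<open>B_\<delta>(Q, P) on the level of marks, with \<open>L - M\<close> in the role of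
  \<delta>. The two bisets \<open>V\<close> and \<open>V'\<close> represent the virtual biset \<phi>
  = [V] - [V'].\<close>

definition ideal_marks :: "'q monoid \<Rightarrow> 'p monoid \<Rightarrow> (('q \<times> 'p) set \<Rightarrow> int) set" where
  "ideal_marks Q P = {comp_marks Q P V - comp_marks Q P V' |
     (V :: ('q \<times> 'p, 's, nat) biset) (V' :: ('q \<times> 'p, 's, nat) biset).
     finite_biset (Q \<times>\<times> opp_group P) S V \<and> finite_biset (Q \<times>\<times> opp_group P) S V'}"

context
  fixes Q :: "'q monoid" and P :: "'p monoid"
  assumes QP: "group Q" "group P"
begin

lemma finite_tensor:
  assumes "finite_biset (Q \<times>\<times> opp_group P) S V" "finite_biset S unit_group T"
  shows "finite_biset (Q \<times>\<times> opp_group P) unit_group (biset_tensor S V T)"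
  by (rule finite_biset_tensor[OF assms S group_DirProd_opp[OF QP] group_unit])

lemma finite_left_tensor:
  assumes "finite_biset (Q \<times>\<times> opp_group P) S V" "finite_biset S unit_group T"
  shows "finite_biset Q P (left_to_biset Q P (biset_tensor S V T))"
  by (rule finite_left_to_biset[OF finite_tensor[OF assms] QP])

lemma mark_tensor_eq_left_marks:
  assumes "finite_biset (Q \<times>\<times> opp_group P) S V" "finite_biset S unit_group T"
  shows "mark (Q \<times>\<times> opp_group P) unit_group (biset_tensor S V T)
    = left_marks Q P (mark Q P (left_to_biset Q P (biset_tensor S V T)))"
  using mark_left_to_biset_to_left[OF finite_tensor[OF assms] QP]
    mark_biset_to_left[OF finite_left_tensor[OF assms] QP] by (rule trans[OF sym])

lemma left_marks_comp_marks:
  assumes "finite_biset (Q \<times>\<times> opp_group P) S V"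
  shows "left_marks Q P (comp_marks Q P V) = mark (Q \<times>\<times> opp_group P) unit_group (biset_tensor S V L)
     - mark (Q \<times>\<times> opp_group P) unit_group (biset_tensor S V M)"
  unfolding comp_marks_def left_marks_diff
  by (simp add: mark_tensor_eq_left_marks[OF assms L] mark_tensor_eq_left_marks[OF assms M])

lemma comp_marks_in_vmarks:
  assumes "finite_biset (Q \<times>\<times> opp_group P) S V"
  shows "comp_marks Q P V \<in> vmarks Q P"
  unfolding comp_marks_def
  by (rule mark_diff_in_vmarks[OF finite_left_tensor[OF assms L] finite_left_tensor[OF assms M]])

lemma comp_marks_cong:
  assumes "finite_biset (Q \<times>\<times> opp_group P) S V" "finite_biset (Q \<times>\<times> opp_group P) S V'"
    and "mark (Q \<times>\<times> opp_group P) S V = mark (Q \<times>\<times> opp_group P) S V'"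
  shows "comp_marks Q P V = comp_marks Q P V'"
proof (rule left_marks_inject[OF QP(2)])
  note cong = mark_tensor_cong[OF group_DirProd_opp[OF QP] S group_unit assms(1,2) _ _ assms(3) refl]
  show "left_marks Q P (comp_marks Q P V) = left_marks Q P (comp_marks Q P V')"
    by (simp only: left_marks_comp_marks[OF assms(1)] left_marks_comp_marks[OF assms(2)]
        cong[OF L L] cong[OF M M])
qed (use assms in \<open>simp_all add: comp_marks_in_vmarks\<close>)

lemma left_marks_add: "left_marks Q P (d + d') = left_marks Q P d + left_marks Q P d'"
  by (auto simp: left_marks_def)

lemma comp_marks_sum:
  assumes "finite_biset (Q \<times>\<times> opp_group P) S V" "finite_biset (Q \<times>\<times> opp_group P) S V'"
  shows "comp_marks Q P (V \<uplus> V') = comp_marks Q P V + comp_marks Q P V'"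
proof (rule left_marks_inject[OF QP(2)])
  show "left_marks Q P (comp_marks Q P (V \<uplus> V')) = left_marks Q P (comp_marks Q P V + comp_marks Q P V')"
    using assms L M
    by (simp add: left_marks_comp_marks left_marks_add finite_biset_sum
        mark_tensor_sum_left[OF group_DirProd_opp[OF QP] S group_unit])
qed (use assms in \<open>simp_all add: comp_marks_in_vmarks add_in_vmarks finite_biset_sum\<close>)

text \<open>\<open>ideal_marks\<close> ranges over bisets of natural numbers only; the bisets met
  later, made of cosets and classes, enter through isomorphic copies.\<close>

lemma comp_marks_diff_in_ideal:
  assumes "finite_biset (Q \<times>\<times> opp_group P) S V" "finite_biset (Q \<times>\<times> opp_group P) S V'"
  shows "comp_marks Q P V - comp_marks Q P V' \<in> ideal_marks Q P"
proof -
  obtain W :: "('q \<times> 'p, 's, nat) biset"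
    where W: "finite_biset (Q \<times>\<times> opp_group P) S W" "biset_iso (Q \<times>\<times> opp_group P) S V W"
    using ex_nat_biset[OF assms(1)] .
  obtain W' :: "('q \<times> 'p, 's, nat) biset"
    where W': "finite_biset (Q \<times>\<times> opp_group P) S W'" "biset_iso (Q \<times>\<times> opp_group P) S V' W'"
    using ex_nat_biset[OF assms(2)] .
  have "comp_marks Q P V - comp_marks Q P V' = comp_marks Q P W - comp_marks Q P W'"
    using comp_marks_cong[OF assms(1) W(1) mark_iso[OF W(2) assms(1)]]
      comp_marks_cong[OF assms(2) W'(1) mark_iso[OF W'(2) assms(2)]] by simp
  then show ?thesis using W(1) W'(1) unfolding ideal_marks_def by blast
qed

lemma ideal_marksE:
  assumes "d \<in> ideal_marks Q P"
  obtains V V' :: "('q \<times> 'p, 's, nat) biset"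
  where "finite_biset (Q \<times>\<times> opp_group P) S V" "finite_biset (Q \<times>\<times> opp_group P) S V'"
    "d = comp_marks Q P V - comp_marks Q P V'"
  using assms unfolding ideal_marks_def by blast

lemma ideal_marks_subset: "ideal_marks Q P \<subseteq> vmarks Q P"
proof
  fix d assume "d \<in> ideal_marks Q P"
  then obtain V V' :: "('q \<times> 'p, 's, nat) biset"
    where V: "finite_biset (Q \<times>\<times> opp_group P) S V" "finite_biset (Q \<times>\<times> opp_group P) S V'"
    "d = comp_marks Q P V - comp_marks Q P V'" by (rule ideal_marksE)
  then have "d = comp_marks Q P V + - comp_marks Q P V'" by simp
  then show "d \<in> vmarks Q P"
    using comp_marks_in_vmarks[OF V(1)] comp_marks_in_vmarks[OF V(2)]
    by (simp only: add_in_vmarks minus_in_vmarks)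
qed

lemma zero_in_ideal: "0 \<in> ideal_marks Q P"
  using comp_marks_diff_in_ideal[OF finite_biset_empty finite_biset_empty] by simp

lemma minus_in_ideal: "d \<in> ideal_marks Q P \<Longrightarrow> - d \<in> ideal_marks Q P"
  by (metis minus_diff_eq comp_marks_diff_in_ideal ideal_marksE)

lemma add_in_ideal:
  assumes "d \<in> ideal_marks Q P" "d' \<in> ideal_marks Q P"
  shows "d + d' \<in> ideal_marks Q P"
proof -
  obtain V W :: "('q \<times> 'p, 's, nat) biset"
    where V: "finite_biset (Q \<times>\<times> opp_group P) S V" "finite_biset (Q \<times>\<times> opp_group P) S W"
    "d = comp_marks Q P V - comp_marks Q P W" using assms(1) by (rule ideal_marksE)
  obtain V' W' :: "('q \<times> 'p, 's, nat) biset"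
    where V': "finite_biset (Q \<times>\<times> opp_group P) S V'" "finite_biset (Q \<times>\<times> opp_group P) S W'"
    "d' = comp_marks Q P V' - comp_marks Q P W'" using assms(2) by (rule ideal_marksE)
  have "d + d' = comp_marks Q P (V \<uplus> V') - comp_marks Q P (W \<uplus> W')"
    using V V' by (simp add: comp_marks_sum)
  then show ?thesis
    using V V' by (simp only: comp_marks_diff_in_ideal finite_biset_sum)
qed

lemma diff_in_ideal: "d \<in> ideal_marks Q P \<Longrightarrow> d' \<in> ideal_marks Q P \<Longrightarrow> d - d' \<in> ideal_marks Q P"
  using add_in_ideal[of d "- d'"] minus_in_ideal[of d'] by simp

lemma scale_in_ideal: "d \<in> ideal_marks Q P \<Longrightarrow> (\<lambda>K. n * d K) \<in> ideal_marks Q P"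
  by (rule scale_closed[OF zero_in_ideal add_in_ideal minus_in_ideal])

lemma sum_in_ideal:
  assumes "\<And>i. i \<in> I \<Longrightarrow> d i \<in> ideal_marks Q P"
  shows "sum d I \<in> ideal_marks Q P"
  using assms by (induction I rule: infinite_finite_induct) (auto simp: zero_in_ideal add_in_ideal)

text \<open>The left side is \<open>B_delta2\<close> with its definitions unfolded, for an arbitrary
  generator. The detour through one-sided bisets is undone by injectivity of
  \<open>left_marks\<close>.\<close>

lemma multiples_of_generator:
  "{a \<in> carrier (burnside Q P). burnside_to_left Q P a \<in>
      {burnside_comp (Q \<times>\<times> opp_group P) S unit_group \<phi> (biset_diff S unit_group L M) | \<phi>.
         \<phi> \<in> carrier (burnside (Q \<times>\<times> opp_group P) S)}}
   = vclass Q P ` ideal_marks Q P" (is "?A = ?B")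
proof -
  note QP' = group_DirProd_opp[OF QP]
  have comp: "burnside_comp (Q \<times>\<times> opp_group P) S unit_group
        (vclass (Q \<times>\<times> opp_group P) S (mark (Q \<times>\<times> opp_group P) S V - mark (Q \<times>\<times> opp_group P) S V'))
        (biset_diff S unit_group L M)
      = vclass (Q \<times>\<times> opp_group P) unit_group (left_marks Q P (comp_marks Q P V - comp_marks Q P V'))"
    if V: "finite_biset (Q \<times>\<times> opp_group P) S V" "finite_biset (Q \<times>\<times> opp_group P) S V'"
    for V V' :: "('q \<times> 'p, 's, nat) biset"
    unfolding biset_diff_eq_vclass[OF L M S group_unit] left_marks_diff
      left_marks_comp_marks[OF V(1)] left_marks_comp_marks[OF V(2)]
    by (rule burnside_comp_vclass[OF QP' S group_unit V L M])
  show ?thesis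
  proof (intro subset_antisym subsetI)
    fix a assume "a \<in> ?A"
    then obtain \<phi> where a: "a \<in> carrier (burnside Q P)"
      and \<phi>: "\<phi> \<in> carrier (burnside (Q \<times>\<times> opp_group P) S)"
        "burnside_to_left Q P a = burnside_comp (Q \<times>\<times> opp_group P) S unit_group \<phi> (biset_diff S unit_group L M)"
      by blast
    obtain d where d: "d \<in> vmarks Q P" "a = vclass Q P d"
      using a carrier_burnside[OF QP] by blast
    obtain e where "e \<in> vmarks (Q \<times>\<times> opp_group P) S" "\<phi> = vclass (Q \<times>\<times> opp_group P) S e"
      using \<phi>(1) carrier_burnside[OF QP' S] by blast
    then obtain V V' :: "('q \<times> 'p, 's, nat) biset"
      where V: "finite_biset (Q \<times>\<times> opp_group P) S V" "finite_biset (Q \<times>\<times> opp_group P) S V'"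
      and \<phi>': "\<phi> = vclass (Q \<times>\<times> opp_group P) S (mark (Q \<times>\<times> opp_group P) S V - mark (Q \<times>\<times> opp_group P) S V')"
      using vmarksE by metis
    let ?c = "comp_marks Q P V - comp_marks Q P V'"
    have c: "?c \<in> ideal_marks Q P" using V by (rule comp_marks_diff_in_ideal)
    \<comment> \<open>\<open>vclass_inject\<close> asks for a virtual mark, so
      \<open>left_marks Q P d\<close> is first realised by one-sided bisets.\<close>
    have "left_marks Q P d \<in> vmarks (Q \<times>\<times> opp_group P) unit_group"
      using vmarksE[OF d(1)] QP
      by (metis left_marks_diff mark_biset_to_left finite_biset_to_left mark_diff_in_vmarks)
    moreover have "vclass (Q \<times>\<times> opp_group P) unit_group (left_marks Q P d)
        = vclass (Q \<times>\<times> opp_group P) unit_group (left_marks Q P ?c)"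
      using \<phi>(2) burnside_to_left_vclass[OF QP d(1)] comp[OF V] by (simp add: d(2) \<phi>')
    ultimately have "left_marks Q P d = left_marks Q P ?c" by (simp only: vclass_inject)
    then have "d = ?c"
      using left_marks_inject[OF QP(2) d(1)] c ideal_marks_subset by blast
    then show "a \<in> ?B" using c d(2) by blast
  next
    fix a assume "a \<in> ?B"
    then obtain d where d: "d \<in> ideal_marks Q P" "a = vclass Q P d" by blast
    obtain V V' :: "('q \<times> 'p, 's, nat) biset"
      where V: "finite_biset (Q \<times>\<times> opp_group P) S V" "finite_biset (Q \<times>\<times> opp_group P) S V'"
      "d = comp_marks Q P V - comp_marks Q P V'" using d(1) by (rule ideal_marksE)
    have "d \<in> vmarks Q P" using d(1) ideal_marks_subset by blast
    moreover have "vclass (Q \<times>\<times> opp_group P) S (mark (Q \<times>\<times> opp_group P) S V - mark (Q \<times>\<times> opp_group P) S V')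
        \<in> carrier (burnside (Q \<times>\<times> opp_group P) S)"
      unfolding carrier_burnside[OF QP' S] using V(1,2) by (intro imageI mark_diff_in_vmarks)
    ultimately show "a \<in> ?A"
      using comp[OF V(1,2)] d(2) burnside_to_left_vclass[OF QP] V(3)
      by (auto simp: carrier_burnside[OF QP])
  qed
qed

end

text \<open>A composite \<open>B \<times>\<^sub>Q V\<close>, where \<open>V\<close> keeps its remaining left \<open>P\<^sup>o\<^sup>p\<close>-action and its right
  \<open>S\<close>-action, and symmetrically \<open>V \<times>\<^sub>P U\<close>.\<close>

definition compose_left ::
  "'q monoid \<Rightarrow> 'p monoid \<Rightarrow> ('r, 'q, 'b) biset \<Rightarrow> ('q \<times> 'p, 's, 'v) biset
     \<Rightarrow> ('r \<times> 'p, 's, ('b \<times> 'v) set) biset" where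
  "compose_left Q P B V =
     \<lparr>bset = bset (biset_tensor Q B (left_to_biset Q P V)),
      lact = (\<lambda>(r, x) C. map_prod (lact B r) (lact V (\<one>\<^bsub>Q\<^esub>, x)) ` C),
      ract = (\<lambda>C s. map_prod (\<lambda>b. b) (\<lambda>v. ract V v s) ` C)\<rparr>"

definition compose_right ::
  "'q monoid \<Rightarrow> 'p monoid \<Rightarrow> ('q \<times> 'p, 's, 'v) biset \<Rightarrow> ('p, 'r, 'u) biset
     \<Rightarrow> ('q \<times> 'r, 's, ('v \<times> 'u) set) biset" where
  "compose_right Q P V U =
     \<lparr>bset = bset (biset_tensor P (left_to_biset Q P V) U),
      lact = (\<lambda>(q, r) C. map_prod (lact V (q, \<one>\<^bsub>P\<^esub>)) (\<lambda>u. ract U u r) ` C),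
      ract = (\<lambda>C s. map_prod (\<lambda>v. ract V v s) (\<lambda>u. u) ` C)\<rparr>"

section \<open>Absorption by composition on the left\<close>

context
  fixes R :: "'r monoid" and Q :: "'q monoid" and P :: "'p monoid"
    and B :: "('r, 'q, 'b) biset" and V :: "('q \<times> 'p, 's, 'v) biset"
  assumes RQP: "group R" "group Q" "group P"
    and B: "finite_biset R Q B" and V: "finite_biset (Q \<times>\<times> opp_group P) S V"
begin

interpretation S: group S by (rule S)
interpretation R: group R by (rule RQP(1))
interpretation Q: group Q by (rule RQP(2))
interpretation P: group P by (rule RQP(3))

private abbreviation (input) "W \<equiv> left_to_biset Q P V"
private abbreviation (input) "BV \<equiv> compose_left Q P B V"

private lemma W: "finite_biset Q P W"
  by (rule finite_left_to_biset[OF V RQP(2,3)])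

private lemma Vact:
  assumes "v \<in> bset V"
  shows "q \<in> carrier Q \<Longrightarrow> x \<in> carrier P \<Longrightarrow> lact V (q, x) v \<in> bset V"
    "s \<in> carrier S \<Longrightarrow> ract V v s \<in> bset V"
    "lact V (\<one>\<^bsub>Q\<^esub>, \<one>\<^bsub>P\<^esub>) v = v"
    "ract V v \<one>\<^bsub>S\<^esub> = v"
    "s \<in> carrier S \<Longrightarrow> s' \<in> carrier S \<Longrightarrow> ract V v (s \<otimes>\<^bsub>S\<^esub> s') = ract V (ract V v s) s'"
    "q \<in> carrier Q \<Longrightarrow> x \<in> carrier P \<Longrightarrow> s \<in> carrier S \<Longrightarrow>
      ract V (lact V (q, x) v) s = lact V (q, x) (ract V v s)"
  using finite_bisetD[OF V] assms by auto

private lemmas Bact = finite_bisetD[OF B]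

lemma bset_compose_left: "bset BV = bset (biset_tensor Q B W)"
  by (simp add: compose_left_def)

lemma lact_compose_left:
  assumes "b \<in> bset B" "v \<in> bset V" "r \<in> carrier R" "x \<in> carrier P"
  shows "lact BV (r, x) (tcls Q B W b v) = tcls Q B W (lact B r b) (lact V (\<one>\<^bsub>Q\<^esub>, x) v)"
  unfolding compose_left_def biset.simps prod.case
  using assms Bact Vact(1)
  by (intro image_tcls[OF B B W W RQP(2)]) (auto simp: lact_DirProd_opp[OF V RQP(2,3)])

lemma ract_compose_left:
  assumes "b \<in> bset B" "v \<in> bset V" "s \<in> carrier S"
  shows "ract BV (tcls Q B W b v) s = tcls Q B W b (ract V v s)"
  unfolding compose_left_def biset.simps prod.case
  using assms Bact Vact
  by (intro image_tcls[OF B B W W RQP(2)]) auto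

lemma finite_compose_left: "finite_biset (R \<times>\<times> opp_group P) S BV"
proof -
  have "finite (bset BV)"
    unfolding bset_compose_left
    using finite_bisetD(1)[OF finite_biset_tensor[OF B W RQP(2,1,3)]] .
  then show ?thesis
    unfolding finite_biset_def using Bact Vact
    by (auto simp: bset_compose_left lact_compose_left ract_compose_left
        lact_DirProd_opp[OF V RQP(2,3)] tcls_in_tensor elim!: tensorE)
qed

lemma tcls_compose_left_eq_iff:
  assumes "b \<in> bset B" "v \<in> bset V" "b' \<in> bset B" "v' \<in> bset V"
  shows "tcls Q B W b v = tcls Q B W b' v' \<longleftrightarrow>
    (\<exists>q\<in>carrier Q. b = ract B b' q \<and> v' = lact V (q, \<one>\<^bsub>P\<^esub>) v)"
  using assms by (subst tcls_eq_iff[OF B W RQP(2)]) auto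

text \<open>Associativity of the tensor product: both sides are quotients of the set of triples (b,
  v, t), where elements of \<open>Q\<close> move between b and v and elements of \<open>S\<close>
  between v and t. It rewrites B o (V o T) as (B o V) o T, which is why the ideal absorbs
  \<open>B\<close>.\<close>

lemma tensor_left_to_biset_iso:
  assumes T: "finite_biset S unit_group T"
  shows "biset_iso R P (biset_tensor Q B (left_to_biset Q P (biset_tensor S V T)))
           (left_to_biset R P (biset_tensor S BV T))"
proof -
  let ?VT = "left_to_biset Q P (biset_tensor S V T)"
  have VT: "finite_biset Q P ?VT"
    by (rule finite_left_to_biset[OF finite_biset_tensor[OF V T S group_DirProd_opp[OF RQP(2,3)] group_unit] RQP(2,3)])
  note BV = finite_compose_left
  have mem: "tcls S V T v t \<in> bset ?VT" "tcls Q B W b v \<in> bset BV"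
    if "b \<in> bset B" "v \<in> bset V" "t \<in> bset T" for b v t
    using that by (simp_all add: tcls_in_tensor bset_compose_left)
  define a where "a = (\<lambda>(b, v, t). tcls Q B ?VT b (tcls S V T v t))"
  define c where "c = (\<lambda>(b, v, t). tcls S BV T (tcls Q B W b v) t)"
  have lVT: "lact (biset_tensor S V T) (q, x) (tcls S V T v t) = tcls S V T (lact V (q, x) v) t"
    if "v \<in> bset V" "t \<in> bset T" "q \<in> carrier Q" "x \<in> carrier P" for q x v t
    using that by (intro lact_tensor[OF V T S]) auto
  let ?Z = "bset B \<times> bset V \<times> bset T"
  show ?thesis
  proof (rule biset_iso_via[where Z = ?Z and a = a and b = c], goal_cases)
    case 1
    show ?case by (force simp: a_def bset_tensor image_iff)
  next
    case 2
    show ?case by (force simp: c_def bset_tensor bset_compose_left image_iff)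
  next
    case (3 z z')
    obtain b v t b' v' t' where z: "z = (b, v, t)" "z' = (b', v', t')" by (cases z, cases z') auto
    with 3 have m: "b \<in> bset B" "v \<in> bset V" "t \<in> bset T" "b' \<in> bset B" "v' \<in> bset V" "t' \<in> bset T"
      by auto
    have "a z = a z' \<longleftrightarrow> (\<exists>q\<in>carrier Q. b = ract B b' q \<and>
        tcls S V T v' t' = tcls S V T (lact V (q, \<one>\<^bsub>P\<^esub>) v) t)"
      unfolding z a_def prod.case using m
      by (subst tcls_eq_iff[OF B VT RQP(2)]) (auto simp: tcls_in_tensor lVT)
    \<comment> \<open>Unfolding either nested class leaves one element \<open>q\<close> of
      \<open>Q\<close> and one \<open>s\<close> of \<open>S\<close>; the two sides differ only in
      the order of these quantifiers.\<close>
    also have "\<dots> \<longleftrightarrow> (\<exists>q\<in>carrier Q. \<exists>s\<in>carrier S. b = ract B b' q \<and>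
        lact V (q, \<one>\<^bsub>P\<^esub>) v = ract V v' s \<and> t' = lact T s t)"
    proof -
      have "tcls S V T v' t' = tcls S V T (lact V (q, \<one>\<^bsub>P\<^esub>) v) t \<longleftrightarrow>
          (\<exists>s\<in>carrier S. lact V (q, \<one>\<^bsub>P\<^esub>) v = ract V v' s \<and> t' = lact T s t)"
        if "q \<in> carrier Q" for q
        using tcls_eq_iff[OF V T S, of "lact V (q, \<one>\<^bsub>P\<^esub>) v" t v' t'] m Vact(1) that by auto
      then show ?thesis by blast
    qed
    also have "\<dots> \<longleftrightarrow> c z = c z'"
    proof -
      have "c z = c z' \<longleftrightarrow> (\<exists>s\<in>carrier S. tcls Q B W b v = tcls Q B W b' (ract V v' s) \<and> t' = lact T s t)"
        unfolding z c_def prod.case using m mem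
        by (subst tcls_eq_iff[OF BV T S]) (auto simp: ract_compose_left)
      also have "\<dots> \<longleftrightarrow> (\<exists>s\<in>carrier S. (\<exists>q\<in>carrier Q. b = ract B b' q \<and>
          ract V v' s = lact V (q, \<one>\<^bsub>P\<^esub>) v) \<and> t' = lact T s t)"
        using m Vact(2) by (intro bex_cong refl) (simp add: tcls_compose_left_eq_iff)
      finally show ?thesis by metis
    qed
    finally show ?case .
  next
    case (4 r z)
    obtain b v t where z: "z = (b, v, t)" by (cases z) auto
    with 4 show ?case using Bact mem Vact
      by (intro bexI[of _ "(lact B r b, v, t)"])
         (auto simp: a_def c_def lact_tensor[OF B VT RQP(2)] lact_tensor[OF BV T S] lact_compose_left)
  next
    case (5 x z)
    obtain b v t where z: "z = (b, v, t)" by (cases z) auto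
    with 5 show ?case using Bact mem Vact
      by (intro bexI[of _ "(b, lact V (\<one>\<^bsub>Q\<^esub>, x) v, t)"])
         (auto simp: a_def c_def ract_tensor[OF B VT RQP(2)] lVT lact_tensor[OF BV T S] lact_compose_left)
  qed
qed

end

end

section \<open>Absorption by composition on the right\<close>

context burnside_difference
begin

context
  fixes Q :: "'q monoid" and P :: "'p monoid" and R :: "'r monoid"
    and V :: "('q \<times> 'p, 's, 'v) biset" and U :: "('p, 'r, 'u) biset"
  assumes QPR: "group Q" "group P" "group R"
    and V: "finite_biset (Q \<times>\<times> opp_group P) S V" and U: "finite_biset P R U"
begin

interpretation S: group S by (rule S)
interpretation R: group R by (rule QPR(3))
interpretation Q: group Q by (rule QPR(1))
interpretation P: group P by (rule QPR(2))

private abbreviation (input) "W' \<equiv> left_to_biset Q P V"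
private abbreviation (input) "VU \<equiv> compose_right Q P V U"

private lemma W': "finite_biset Q P W'"
  by (rule finite_left_to_biset[OF V QPR(1,2)])

private lemma Vact':
  assumes "v \<in> bset V"
  shows "q \<in> carrier Q \<Longrightarrow> x \<in> carrier P \<Longrightarrow> lact V (q, x) v \<in> bset V"
    "s \<in> carrier S \<Longrightarrow> ract V v s \<in> bset V"
    "lact V (\<one>\<^bsub>Q\<^esub>, \<one>\<^bsub>P\<^esub>) v = v"
    "ract V v \<one>\<^bsub>S\<^esub> = v"
    "s \<in> carrier S \<Longrightarrow> s' \<in> carrier S \<Longrightarrow> ract V v (s \<otimes>\<^bsub>S\<^esub> s') = ract V (ract V v s) s'"
    "q \<in> carrier Q \<Longrightarrow> x \<in> carrier P \<Longrightarrow> s \<in> carrier S \<Longrightarrow>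
      ract V (lact V (q, x) v) s = lact V (q, x) (ract V v s)"
  using finite_bisetD[OF V] assms by auto

private lemmas Uact = finite_bisetD[OF U]

lemma bset_compose_right: "bset VU = bset (biset_tensor P W' U)"
  by (simp add: compose_right_def)

lemma lact_compose_right:
  assumes "v \<in> bset V" "u \<in> bset U" "q \<in> carrier Q" "r \<in> carrier R"
  shows "lact VU (q, r) (tcls P W' U v u) = tcls P W' U (lact V (q, \<one>\<^bsub>P\<^esub>) v) (ract U u r)"
  unfolding compose_right_def biset.simps prod.case
  using assms Uact Vact'(1)
  by (intro image_tcls[OF W' W' U U QPR(2)]) (auto simp: lact_DirProd_opp[OF V QPR(1,2)])

lemma ract_compose_right:
  assumes "v \<in> bset V" "u \<in> bset U" "s \<in> carrier S"
  shows "ract VU (tcls P W' U v u) s = tcls P W' U (ract V v s) u"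
  unfolding compose_right_def biset.simps prod.case
  using assms Uact Vact'
  by (intro image_tcls[OF W' W' U U QPR(2)]) auto

lemma finite_compose_right: "finite_biset (Q \<times>\<times> opp_group R) S VU"
proof -
  have "finite (bset VU)"
    unfolding bset_compose_right
    using finite_bisetD(1)[OF finite_biset_tensor[OF W' U QPR(2,1,3)]] .
  then show ?thesis
    unfolding finite_biset_def using Uact Vact'
    by (auto simp: bset_compose_right lact_compose_right ract_compose_right
        lact_DirProd_opp[OF V QPR(1,2)] tcls_in_tensor elim!: tensorE)
qed

lemma tcls_compose_right_eq_iff:
  assumes "v \<in> bset V" "u \<in> bset U" "v' \<in> bset V" "u' \<in> bset U"
  shows "tcls P W' U v u = tcls P W' U v' u' \<longleftrightarrow>
    (\<exists>x\<in>carrier P. v = lact V (\<one>\<^bsub>Q\<^esub>, x) v' \<and> u' = lact U x u)"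
  using assms by (subst tcls_eq_iff[OF W' U QPR(2)]) auto

text \<open>The mirror image of \<open>tensor_left_to_biset_iso\<close>: \<open>U\<close> is
  attached through the action of \<open>P\<close>, which is part of the left action on
  \<open>V\<close> and hence commutes with the right action of \<open>S\<close>.\<close>

lemma left_to_biset_tensor_iso:
  assumes T: "finite_biset S unit_group T"
  shows "biset_iso Q R (biset_tensor P (left_to_biset Q P (biset_tensor S V T)) U)
           (left_to_biset Q R (biset_tensor S VU T))"
proof -
  let ?VT = "left_to_biset Q P (biset_tensor S V T)"
  have VT: "finite_biset Q P ?VT"
    by (rule finite_left_to_biset[OF finite_biset_tensor[OF V T S group_DirProd_opp[OF QPR(1,2)] group_unit] QPR(1,2)])
  note VU = finite_compose_right
  have mem: "tcls S V T v t \<in> bset ?VT" "tcls P W' U v u \<in> bset VU"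
    if "u \<in> bset U" "v \<in> bset V" "t \<in> bset T" for u v t
    using that by (simp_all add: tcls_in_tensor bset_compose_right)
  define a where "a = (\<lambda>(v, u, t). tcls P ?VT U (tcls S V T v t) u)"
  define c where "c = (\<lambda>(v, u, t). tcls S VU T (tcls P W' U v u) t)"
  have lVT: "lact (biset_tensor S V T) (q, x) (tcls S V T v t) = tcls S V T (lact V (q, x) v) t"
    if "v \<in> bset V" "t \<in> bset T" "q \<in> carrier Q" "x \<in> carrier P" for q x v t
    using that by (intro lact_tensor[OF V T S]) auto
  let ?Z = "bset V \<times> bset U \<times> bset T"
  show ?thesis
  proof (rule biset_iso_via[where Z = ?Z and a = a and b = c], goal_cases)
    case 1
    show ?case by (force simp: a_def bset_tensor image_iff)
  next
    case 2
    show ?case by (force simp: c_def bset_tensor bset_compose_right image_iff)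
  next
    case (3 z z')
    obtain v u t v' u' t' where z: "z = (v, u, t)" "z' = (v', u', t')" by (cases z, cases z') auto
    with 3 have m: "u \<in> bset U" "v \<in> bset V" "t \<in> bset T" "u' \<in> bset U" "v' \<in> bset V" "t' \<in> bset T"
      by auto
    have "a z = a z' \<longleftrightarrow> (\<exists>x\<in>carrier P.
        tcls S V T v t = tcls S V T (lact V (\<one>\<^bsub>Q\<^esub>, x) v') t' \<and> u' = lact U x u)"
      unfolding z a_def prod.case using m
      by (subst tcls_eq_iff[OF VT U QPR(2)]) (auto simp: tcls_in_tensor lVT)
    also have "\<dots> \<longleftrightarrow> (\<exists>x\<in>carrier P. \<exists>s\<in>carrier S.
        v = ract V (lact V (\<one>\<^bsub>Q\<^esub>, x) v') s \<and> t' = lact T s t \<and> u' = lact U x u)"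
    proof -
      have "tcls S V T v t = tcls S V T (lact V (\<one>\<^bsub>Q\<^esub>, x) v') t' \<longleftrightarrow>
          (\<exists>s\<in>carrier S. v = ract V (lact V (\<one>\<^bsub>Q\<^esub>, x) v') s \<and> t' = lact T s t)"
        if "x \<in> carrier P" for x
        using tcls_eq_iff[OF V T S, of v t "lact V (\<one>\<^bsub>Q\<^esub>, x) v'" t'] m Vact'(1) that by auto
      then show ?thesis by blast
    qed
    also have "\<dots> \<longleftrightarrow> c z = c z'"
    proof -
      have "c z = c z' \<longleftrightarrow> (\<exists>s\<in>carrier S. tcls P W' U v u = tcls P W' U (ract V v' s) u' \<and> t' = lact T s t)"
        unfolding z c_def prod.case using m mem
        by (subst tcls_eq_iff[OF VU T S]) (auto simp: ract_compose_right)
      also have "\<dots> \<longleftrightarrow> (\<exists>s\<in>carrier S. (\<exists>x\<in>carrier P. v = lact V (\<one>\<^bsub>Q\<^esub>, x) (ract V v' s) \<and>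
          u' = lact U x u) \<and> t' = lact T s t)"
        using m Vact'(2) by (intro bex_cong refl) (simp add: tcls_compose_right_eq_iff)
      \<comment> \<open>Here the action of \<open>x\<close> is moved past that of
        \<open>s\<close>.\<close>
      also have "\<dots> \<longleftrightarrow> (\<exists>s\<in>carrier S. (\<exists>x\<in>carrier P. v = ract V (lact V (\<one>\<^bsub>Q\<^esub>, x) v') s \<and>
          u' = lact U x u) \<and> t' = lact T s t)"
        using m Vact'(6) by (intro bex_cong refl) simp
      finally show ?thesis by metis
    qed
    finally show ?case .
  next
    case (4 q z)
    obtain v u t where z: "z = (v, u, t)" by (cases z) auto
    with 4 show ?case using Uact mem Vact'
      by (intro bexI[of _ "(lact V (q, \<one>\<^bsub>P\<^esub>) v, u, t)"])
         (auto simp: a_def c_def lact_tensor[OF VT U QPR(2)] lVT lact_tensor[OF VU T S] lact_compose_right)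
  next
    case (5 r z)
    obtain v u t where z: "z = (v, u, t)" by (cases z) auto
    with 5 show ?case using Uact mem Vact'
      by (intro bexI[of _ "(v, ract U u r, t)"])
         (auto simp: a_def c_def ract_tensor[OF VT U QPR(2)] lact_tensor[OF VU T S] lact_compose_right)
  qed
qed

end

text \<open>\<open>burnside_comp_vclass\<close> takes a single difference of bisets, so the four
  terms of (V - V') o (L - M) are sorted by sign.\<close>

lemma ideal_marks_altE:
  fixes Q :: "'q monoid" and P :: "'p monoid"
  assumes "group Q" "group P" "d \<in> ideal_marks Q P"
  obtains V V' :: "('q \<times> 'p, 's, nat) biset"
  where "finite_biset (Q \<times>\<times> opp_group P) S V" "finite_biset (Q \<times>\<times> opp_group P) S V'"
    "d = mark Q P (left_to_biset Q P (biset_tensor S V L) \<uplus> left_to_biset Q P (biset_tensor S V' M))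
       - mark Q P (left_to_biset Q P (biset_tensor S V M) \<uplus> left_to_biset Q P (biset_tensor S V' L))"
proof -
  obtain V V' :: "('q \<times> 'p, 's, nat) biset"
    where V: "finite_biset (Q \<times>\<times> opp_group P) S V" "finite_biset (Q \<times>\<times> opp_group P) S V'"
    "d = comp_marks Q P V - comp_marks Q P V'"
    using ideal_marksE[OF assms] .
  note f = finite_left_tensor[OF assms(1,2)]
  show thesis
    by (rule that[OF V(1,2)])
       (simp add: V(3) comp_marks_def mark_sum[OF f[OF V(1) L] f[OF V(2) M]]
          mark_sum[OF f[OF V(1) M] f[OF V(2) L]])
qed

text \<open>By bilinearity the composite is a combination of terms B o (V o T) with T among
  \<open>L\<close> and \<open>M\<close>, and associativity turns each of them into (B o V) o
  T.\<close>

lemma comp_left_in_ideal: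
  fixes R :: "'r monoid" and Q :: "'q monoid" and P :: "'p monoid"
  assumes G: "group R" "group Q" "group P" and "b \<in> vmarks R Q" "d \<in> ideal_marks Q P"
  shows "burnside_comp R Q P (vclass R Q b) (vclass Q P d) \<in> vclass R P ` ideal_marks R P"
proof -
  obtain B B' :: "('r, 'q, nat) biset"
    where B: "finite_biset R Q B" "finite_biset R Q B'" "b = mark R Q B - mark R Q B'"
    using assms(4) by (rule vmarksE)
  obtain V V' :: "('q \<times> 'p, 's, nat) biset"
    where V: "finite_biset (Q \<times>\<times> opp_group P) S V" "finite_biset (Q \<times>\<times> opp_group P) S V'"
    and d: "d = mark Q P (left_to_biset Q P (biset_tensor S V L) \<uplus> left_to_biset Q P (biset_tensor S V' M))
       - mark Q P (left_to_biset Q P (biset_tensor S V M) \<uplus> left_to_biset Q P (biset_tensor S V' L))"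
    using ideal_marks_altE[OF G(2,3) assms(5)] .
  note f = finite_left_tensor[OF G(2,3)]
  have iso: "mark R P (biset_tensor Q C (left_to_biset Q P (biset_tensor S N T)))
      = mark R P (left_to_biset R P (biset_tensor S (compose_left Q P C N) T))"
    if "finite_biset R Q C" "finite_biset (Q \<times>\<times> opp_group P) S N" "finite_biset S unit_group T"
    for C :: "('r, 'q, nat) biset" and N :: "('q \<times> 'p, 's, nat) biset" and T :: "('s, unit, 't) biset"
    using mark_iso[OF tensor_left_to_biset_iso[OF G that(1,2,3)]
        finite_biset_tensor[OF that(1) f[OF that(2,3)] G(2,1,3)]] .
  have key: "mark R P (biset_tensor Q C (left_to_biset Q P (biset_tensor S V L) \<uplus> left_to_biset Q P (biset_tensor S V' M)))
     - mark R P (biset_tensor Q C (left_to_biset Q P (biset_tensor S V M) \<uplus> left_to_biset Q P (biset_tensor S V' L)))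
     = comp_marks R P (compose_left Q P C V) - comp_marks R P (compose_left Q P C V')"
    if "finite_biset R Q C" for C :: "('r, 'q, nat) biset"
    using that by (simp add: mark_tensor_sum_right[OF G that f[OF V(1) L] f[OF V(2) M]]
        mark_tensor_sum_right[OF G that f[OF V(1) M] f[OF V(2) L]]
        iso[OF that V(1) L] iso[OF that V(2) L] iso[OF that V(1) M] iso[OF that V(2) M] comp_marks_def)
  have "burnside_comp R Q P (vclass R Q b) (vclass Q P d) = vclass R P
      ((comp_marks R P (compose_left Q P B V) - comp_marks R P (compose_left Q P B V'))
     - (comp_marks R P (compose_left Q P B' V) - comp_marks R P (compose_left Q P B' V')))"
    unfolding B(3) d key[OF B(1), symmetric] key[OF B(2), symmetric]
    by (rule burnside_comp_vclass[OF G B(1,2) finite_biset_sum[OF f[OF V(1) L] f[OF V(2) M]]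
          finite_biset_sum[OF f[OF V(1) M] f[OF V(2) L]]])
  moreover have "\<dots> \<in> vclass R P ` ideal_marks R P"
    using finite_compose_left[OF G B(1) V(1)] finite_compose_left[OF G B(1) V(2)]
      finite_compose_left[OF G B(2) V(1)] finite_compose_left[OF G B(2) V(2)]
    by (intro imageI diff_in_ideal[OF G(1,3)] comp_marks_diff_in_ideal[OF G(1,3)])
  ultimately show ?thesis by simp
qed

lemma comp_right_in_ideal:
  fixes Q :: "'q monoid" and P :: "'p monoid" and R :: "'r monoid"
  assumes G: "group Q" "group P" "group R" and "d \<in> ideal_marks Q P" "b \<in> vmarks P R"
  shows "burnside_comp Q P R (vclass Q P d) (vclass P R b) \<in> vclass Q R ` ideal_marks Q R"
proof -
  obtain B B' :: "('p, 'r, nat) biset"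
    where B: "finite_biset P R B" "finite_biset P R B'" "b = mark P R B - mark P R B'"
    using assms(5) by (rule vmarksE)
  obtain V V' :: "('q \<times> 'p, 's, nat) biset"
    where V: "finite_biset (Q \<times>\<times> opp_group P) S V" "finite_biset (Q \<times>\<times> opp_group P) S V'"
    and d: "d = mark Q P (left_to_biset Q P (biset_tensor S V L) \<uplus> left_to_biset Q P (biset_tensor S V' M))
       - mark Q P (left_to_biset Q P (biset_tensor S V M) \<uplus> left_to_biset Q P (biset_tensor S V' L))"
    using ideal_marks_altE[OF G(1,2) assms(4)] .
  note f = finite_left_tensor[OF G(1,2)]
  have iso: "mark Q R (biset_tensor P (left_to_biset Q P (biset_tensor S N T)) C)
      = mark Q R (left_to_biset Q R (biset_tensor S (compose_right Q P N C) T))"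
    if "finite_biset P R C" "finite_biset (Q \<times>\<times> opp_group P) S N" "finite_biset S unit_group T"
    for C :: "('p, 'r, nat) biset" and N :: "('q \<times> 'p, 's, nat) biset" and T :: "('s, unit, 't) biset"
    using mark_iso[OF left_to_biset_tensor_iso[OF G that(2,1,3)]
        finite_biset_tensor[OF f[OF that(2,3)] that(1) G(2,1,3)]] .
  have key: "mark Q R (biset_tensor P (left_to_biset Q P (biset_tensor S V L) \<uplus> left_to_biset Q P (biset_tensor S V' M)) C)
     - mark Q R (biset_tensor P (left_to_biset Q P (biset_tensor S V M) \<uplus> left_to_biset Q P (biset_tensor S V' L)) C)
     = comp_marks Q R (compose_right Q P V C) - comp_marks Q R (compose_right Q P V' C)"
    if "finite_biset P R C" for C :: "('p, 'r, nat) biset"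
    using that by (simp add: mark_tensor_sum_left[OF G f[OF V(1) L] f[OF V(2) M] that]
        mark_tensor_sum_left[OF G f[OF V(1) M] f[OF V(2) L] that]
        iso[OF that V(1) L] iso[OF that V(2) L] iso[OF that V(1) M] iso[OF that V(2) M] comp_marks_def)
  have "burnside_comp Q P R (vclass Q P d) (vclass P R b) = vclass Q R
      ((comp_marks Q R (compose_right Q P V B) - comp_marks Q R (compose_right Q P V' B))
     - (comp_marks Q R (compose_right Q P V B') - comp_marks Q R (compose_right Q P V' B')))"
    unfolding B(3) d key[OF B(1), symmetric] key[OF B(2), symmetric]
      burnside_comp_vclass[OF G finite_biset_sum[OF f[OF V(1) L] f[OF V(2) M]]
          finite_biset_sum[OF f[OF V(1) M] f[OF V(2) L]] B(1,2)]
    by (rule arg_cong[where f = "vclass Q R"]) simp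
  moreover have "\<dots> \<in> vclass Q R ` ideal_marks Q R"
    using finite_compose_right[OF G V(1) B(1)] finite_compose_right[OF G V(2) B(1)]
      finite_compose_right[OF G V(1) B(2)] finite_compose_right[OF G V(2) B(2)]
    by (intro imageI diff_in_ideal[OF G(1,3)] comp_marks_diff_in_ideal[OF G(1,3)])
  ultimately show ?thesis by simp
qed

end

section \<open>Weisner's theorem\<close>

text \<open>The recursion of \<open>moebius\<close>, with its top term brought to the other
  side.\<close>

lemma moebius_sum:
  assumes "finite A" "y \<in> A" "x \<le> y"
  shows "(\<Sum>z\<in>{z \<in> A. x \<le> z \<and> z \<le> y}. moebius A x z) = (if x = y then 1 else 0)"
proof (cases "x = y")
  case True
  then have "{z \<in> A. x \<le> z \<and> z \<le> y} = {x}" using assms by auto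
  then show ?thesis using True by (simp add: moebius.simps)
next
  case False
  have "{z \<in> A. x \<le> z \<and> z \<le> y} = insert y {z \<in> A. x \<le> z \<and> z < y}"
    using assms by auto
  moreover have "moebius A x y = - (\<Sum>z\<in>{z \<in> A. x \<le> z \<and> z < y}. moebius A x z)"
    using False assms by (subst moebius.simps) auto
  ultimately show ?thesis using assms(1) False by simp
qed

text \<open>\<open>j z\<close> is the join of \<open>z\<close> and \<open>c\<close>, given by its
  universal property instead of a lattice structure. Collecting the terms by the value w of
  \<open>j\<close> leaves coefficients \<open>g w\<close>, which vanish by induction: their sum over
  all elements up to w is the sum of the Moebius values over z \<le> w if c \<le> w, and an empty
  sum otherwise.\<close>

theorem weisner:
  fixes A :: "'a::order set" and f :: "'a \<Rightarrow> int"
  assumes A: "finite A" and bot: "\<And>z. z \<in> A \<Longrightarrow> x \<le> z" and c: "c \<in> A" "c \<noteq> x"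
    and j: "\<And>z. z \<in> A \<Longrightarrow> j z \<in> A"
      "\<And>z w. z \<in> A \<Longrightarrow> w \<in> A \<Longrightarrow> j z \<le> w \<longleftrightarrow> z \<le> w \<and> c \<le> w"
  shows "(\<Sum>z\<in>A. moebius A x z * f (j z)) = 0"
proof -
  define g where "g w = (\<Sum>z\<in>{z \<in> A. j z = w}. moebius A x z)" for w
  have zero: "g w = 0" if "w \<in> A" for w
    using that
  proof (induction "card {z \<in> A. z < w}" arbitrary: w rule: less_induct)
    case less
    let ?D = "{z \<in> A. z \<le> w}"
    \<comment> \<open>By induction the terms strictly below \<open>w\<close> are 0, so
      \<open>g w\<close> may be replaced by the sum over the whole down-set.\<close>
    have "g w = (\<Sum>v\<in>?D. g v)"
    proof -
      have "g v = 0" if "v \<in> A" "v < w" for v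
      proof -
        have "{z \<in> A. z < v} \<subset> {z \<in> A. z < w}" using that by auto
        then have "card {z \<in> A. z < v} < card {z \<in> A. z < w}"
          using A by (intro psubset_card_mono) auto
        then show ?thesis using less that by blast
      qed
      moreover have "?D = insert w {z \<in> A. z < w}" using less.prems by auto
      ultimately show ?thesis using A by simp
    qed
    also have "\<dots> = (\<Sum>v\<in>?D. \<Sum>z\<in>{z \<in> {z \<in> A. j z \<le> w}. j z = v}. moebius A x z)"
      unfolding g_def by (intro sum.cong refl) auto
    also have "\<dots> = (\<Sum>z\<in>{z \<in> A. j z \<le> w}. moebius A x z)"
      using A j(1) by (intro sum.group) auto
    also have "\<dots> = 0"
    proof (cases "c \<le> w")
      case True
      then have "{z \<in> A. j z \<le> w} = {z \<in> A. x \<le> z \<and> z \<le> w}"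
        using less.prems j(2) bot by auto
      \<comment> \<open>If \<open>w\<close> were the bottom \<open>x\<close>, then
        \<open>c \<le> w\<close> would give \<open>c = x\<close>.\<close>
      moreover have "x \<noteq> w" using True c bot by fastforce
      ultimately show ?thesis using moebius_sum[OF A less.prems bot[OF less.prems]] by simp
    next
      case False
      then have "{z \<in> A. j z \<le> w} = {}" using less.prems j(2) by auto
      then show ?thesis by (simp only: sum.empty)
    qed
    finally show ?case .
  qed
  have "(\<Sum>z\<in>A. moebius A x z * f (j z)) = (\<Sum>w\<in>A. \<Sum>z\<in>{z \<in> A. j z = w}. moebius A x z * f (j z))"
    using A j(1) by (intro sum.group[symmetric]) auto
  also have "\<dots> = (\<Sum>w\<in>A. g w * f w)"
    unfolding g_def sum_distrib_right by (intro sum.cong refl) auto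
  finally show ?thesis using zero by simp
qed

section \<open>The edge idempotent\<close>

lemma sum_fun_apply: "(\<Sum>i\<in>I. F i) x = (\<Sum>i\<in>I. F i x)" for F :: "'i \<Rightarrow> 'x \<Rightarrow> 'b::comm_monoid_add"
  by (induction I rule: infinite_finite_induct) auto

lemma int_pow_burnside:
  assumes HG: "group H" "group G" and d: "d \<in> vmarks H G"
  shows "vclass H G d [^]\<^bsub>burnside H G\<^esub> (n :: int) = vclass H G (\<lambda>K. n * d K)"
proof -
  interpret B: comm_group "burnside H G" by (rule comm_group_burnside[OF HG])
  have car: "vclass H G e \<in> carrier (burnside H G)" if "e \<in> vmarks H G" for e
    using that by (auto simp: carrier_burnside[OF HG])
  have pow: "vclass H G d [^]\<^bsub>burnside H G\<^esub> k = vclass H G (\<lambda>K. int k * d K)" for k :: nat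
  proof (induction k)
    case 0
    have "(\<lambda>K. int 0 * d K) = 0" by auto
    then show ?case by (simp add: one_burnside[OF HG])
  next
    case (Suc k)
    have "(\<lambda>K. int (Suc k) * d K) = (\<lambda>K. int k * d K) + d" by (auto simp: algebra_simps)
    then show ?case
      using Suc d by (simp add: mult_burnside[OF HG] scale_in_vmarks)
  qed
  have inv: "inv\<^bsub>burnside H G\<^esub> (vclass H G e) = vclass H G (- e)" if "e \<in> vmarks H G" for e
    using that
    by (intro B.inv_equality) (simp_all add: car minus_in_vmarks mult_burnside[OF HG] one_burnside[OF HG])
  show ?thesis
  proof (cases n rule: int_cases2)
    case (nonneg k)
    then show ?thesis using pow by (simp add: int_pow_int)
  next
    case (nonpos k)
    have "- (\<lambda>K. int k * d K) = (\<lambda>K. n * d K)" using nonpos by auto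
    then show ?thesis
      using nonpos pow inv[OF scale_in_vmarks[OF d]] car[OF d] by (simp add: B.int_pow_neg int_pow_int)
  qed
qed

text \<open>Membership in \<open>vmarks\<close> is part of the induction because
  \<open>mult_burnside\<close> asks for it; on infinite index sets product and sum both default to
  the neutral element.\<close>

lemma finprod_burnside:
  assumes HG: "group H" "group G" and "\<And>i. i \<in> I \<Longrightarrow> d i \<in> vmarks H G"
  shows "finprod (burnside H G) (\<lambda>i. vclass H G (d i)) I = vclass H G (sum d I)
    \<and> sum d I \<in> vmarks H G"
proof -
  interpret B: comm_group "burnside H G" by (rule comm_group_burnside[OF HG])
  show ?thesis
    using assms(3)
  proof (induction I rule: infinite_finite_induct)
    case (infinite I)
    have "sum d I = 0" by (rule sum.infinite[OF infinite(1)])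
    then show ?case
      by (simp only: one_burnside[OF HG] zero_in_vmarks B.finprod_infinite[OF infinite(1)])
  next
    case empty
    show ?case by (simp only: one_burnside[OF HG] zero_in_vmarks B.finprod_empty sum.empty)
  next
    case (insert i I)
    have d: "d i \<in> vmarks H G" "\<And>k. k \<in> I \<Longrightarrow> d k \<in> vmarks H G" using insert.prems by auto
    have IH: "finprod (burnside H G) (\<lambda>i. vclass H G (d i)) I = vclass H G (sum d I)"
      "sum d I \<in> vmarks H G" using insert.IH d(2) by auto
    have "finprod (burnside H G) (\<lambda>i. vclass H G (d i)) (insert i I)
        = vclass H G (d i) \<otimes>\<^bsub>burnside H G\<^esub> vclass H G (sum d I)"
      using insert.hyps d IH(1) by (simp add: carrier_burnside[OF HG] Pi_def)
    also have "\<dots> = vclass H G (sum d (insert i I))"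
      unfolding mult_burnside[OF HG d(1) IH(2)] sum.insert[OF insert.hyps] ..
    finally show ?case
      unfolding sum.insert[OF insert.hyps] using add_in_vmarks[OF d(1) IH(2)] by (rule conjI)
  qed
qed

section \<open>Normal subgroups of a finite group and the element \<open>f_one\<close>\<close>

context
  fixes P :: "'a monoid"
  assumes P: "group P" and finP: "finite (carrier P)"
begin

interpretation P: group P by (rule P)

lemma finite_normal_subgroups: "finite {N. N \<lhd> P}"
proof (rule finite_subset)
  show "{N. N \<lhd> P} \<subseteq> Pow (carrier P)"
    using normal_imp_subgroup subgroup.subset by blast
qed (use finP in simp)

lemma rcoset_eq_iff:
  assumes "subgroup N P" "c \<in> carrier P" "d \<in> carrier P"
  shows "N #>\<^bsub>P\<^esub> c = N #>\<^bsub>P\<^esub> d \<longleftrightarrow> (\<exists>n\<in>N. c = n \<otimes>\<^bsub>P\<^esub> d)"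
proof -
  have "N #>\<^bsub>P\<^esub> c = N #>\<^bsub>P\<^esub> d \<longleftrightarrow> c \<in> N #>\<^bsub>P\<^esub> d"
    using assms by (metis P.repr_independence P.rcos_self)
  then show ?thesis by (auto simp: r_coset_def)
qed

lemma finite_quotient_biset:
  assumes "N \<lhd> P"
  shows "finite_biset P P (quotient_biset P N)"
    and "\<And>c q. c \<in> carrier P \<Longrightarrow> q \<in> carrier P \<Longrightarrow>
           lact (quotient_biset P N) q (N #>\<^bsub>P\<^esub> c) = N #>\<^bsub>P\<^esub> (q \<otimes>\<^bsub>P\<^esub> c)"
    and "\<And>c q. c \<in> carrier P \<Longrightarrow> q \<in> carrier P \<Longrightarrow>
           ract (quotient_biset P N) (N #>\<^bsub>P\<^esub> c) q = N #>\<^bsub>P\<^esub> (c \<otimes>\<^bsub>P\<^esub> q)"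
proof -
  interpret N: normal N P by fact
  have sub: "N \<subseteq> carrier P" by (rule N.subset)
  show l: "lact (quotient_biset P N) q (N #>\<^bsub>P\<^esub> c) = N #>\<^bsub>P\<^esub> (q \<otimes>\<^bsub>P\<^esub> c)"
    if "c \<in> carrier P" "q \<in> carrier P" for c q
    unfolding quotient_biset_def biset.simps
    using that sub N.coset_eq P.lcos_m_assoc
    by (metis P.coset_assoc P.coset_mult_assoc P.m_closed)
  show r: "ract (quotient_biset P N) (N #>\<^bsub>P\<^esub> c) q = N #>\<^bsub>P\<^esub> (c \<otimes>\<^bsub>P\<^esub> q)"
    if "c \<in> carrier P" "q \<in> carrier P" for c q
    unfolding quotient_biset_def biset.simps
    using that sub by (simp add: P.coset_mult_assoc)
  have b: "bset (quotient_biset P N) = (\<lambda>c. N #>\<^bsub>P\<^esub> c) ` carrier P"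
    unfolding quotient_biset_def RCOSETS_def by auto
  show "finite_biset P P (quotient_biset P N)"
    unfolding finite_biset_def b using finP by (auto simp: l r P.m_assoc)
qed

lemma bset_quotient_biset: "bset (quotient_biset P N) = (\<lambda>c. N #>\<^bsub>P\<^esub> c) ` carrier P"
  unfolding quotient_biset_def RCOSETS_def by auto

text \<open>The Burnside group is written multiplicatively, so the product of integer powers in
  \<open>f_one\<close> becomes a linear combination of marks.\<close>

lemma f_one_eq_vclass:
  "f_one P = vclass P P (\<Sum>N\<in>{N. N \<lhd> P}. (\<lambda>K. moebius {N. N \<lhd> P} {\<one>\<^bsub>P\<^esub>} N * mark P P (quotient_biset P N) K))"
proof -
  interpret B: comm_group "burnside P P" by (rule comm_group_burnside[OF P P])
  have cl: "biset_class P P (quotient_biset P N) = vclass P P (mark P P (quotient_biset P N))"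
    if "N \<lhd> P" for N
    unfolding biset_class_def
    using biset_diff_eq_vclass[OF finite_quotient_biset(1)[OF that] finite_biset_empty P P]
    by (simp add: mark_empty)
  have vm: "mark P P (quotient_biset P N) \<in> vmarks P P" if "N \<lhd> P" for N
    using mark_in_vmarks[OF finite_quotient_biset(1)[OF that]] .
  have "f_one P = (\<Otimes>\<^bsub>burnside P P\<^esub>N\<in>{N. N \<lhd> P}.
      vclass P P (\<lambda>K. moebius {N. N \<lhd> P} {\<one>\<^bsub>P\<^esub>} N * mark P P (quotient_biset P N) K))"
    unfolding f_one_def
  proof (rule B.finprod_cong', goal_cases)
    case 2
    show ?case using vm by (auto simp: carrier_burnside[OF P P] scale_in_vmarks)
  next
    case (3 N)
    then show ?case by (simp add: cl int_pow_burnside[OF P P vm])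
  qed simp
  also have "\<dots> = vclass P P (\<Sum>N\<in>{N. N \<lhd> P}. (\<lambda>K. moebius {N. N \<lhd> P} {\<one>\<^bsub>P\<^esub>} N * mark P P (quotient_biset P N) K))"
    using finprod_burnside[OF P P, of "{N. N \<lhd> P}"
        "\<lambda>N K. moebius {N. N \<lhd> P} {\<one>\<^bsub>P\<^esub>} N * mark P P (quotient_biset P N) K"] vm
    by (simp add: scale_in_vmarks)
  finally show ?thesis .
qed

lemma central_normal:
  assumes "subgroup F P" "F \<subseteq> group_center P"
  shows "F \<lhd> P"
proof -
  have "x \<otimes>\<^bsub>P\<^esub> h \<otimes>\<^bsub>P\<^esub> inv\<^bsub>P\<^esub> x \<in> F" if "x \<in> carrier P" "h \<in> F" for x h
  proof -
    have "x \<otimes>\<^bsub>P\<^esub> h = h \<otimes>\<^bsub>P\<^esub> x" "h \<in> carrier P"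
      using that assms(2) by (auto simp: group_center_def)
    then show ?thesis using that by (simp add: P.m_assoc)
  qed
  then show ?thesis using assms(1) by (simp add: P.normal_inv_iff)
qed

lemma mult_central_normal:
  assumes "N \<lhd> P" "subgroup F P" "F \<subseteq> group_center P"
  shows "N <#>\<^bsub>P\<^esub> F \<lhd> P"
  using P.normal_subgroup_set_mult_closed[OF assms(1) central_normal[OF assms(2,3)]]
  by simp

lemma weisner_normal_subgroups:
  fixes f :: "'a set \<Rightarrow> int"
  assumes F: "subgroup F P" "F \<subseteq> group_center P" "F \<noteq> {\<one>\<^bsub>P\<^esub>}"
  shows "(\<Sum>N\<in>{N. N \<lhd> P}. moebius {N. N \<lhd> P} {\<one>\<^bsub>P\<^esub>} N * f (N <#>\<^bsub>P\<^esub> F)) = 0"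
proof (rule weisner[OF finite_normal_subgroups])
  show "{\<one>\<^bsub>P\<^esub>} \<subseteq> N" if "N \<in> {N. N \<lhd> P}" for N
    using that normal_imp_subgroup subgroup.one_closed by fastforce
  show "F \<in> {N. N \<lhd> P}" using central_normal F by simp
  show "N <#>\<^bsub>P\<^esub> F \<in> {N. N \<lhd> P}" if "N \<in> {N. N \<lhd> P}" for N
    using that mult_central_normal F by simp
  show "N <#>\<^bsub>P\<^esub> F \<subseteq> N' \<longleftrightarrow> N \<subseteq> N' \<and> F \<subseteq> N'" if "N \<in> {N. N \<lhd> P}" "N' \<in> {N. N \<lhd> P}" for N N'
  proof -
    have s: "subgroup N P" "subgroup N' P" using that normal_imp_subgroup by auto
    have "n \<in> N <#>\<^bsub>P\<^esub> F" if "n \<in> N" for n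
      using that subgroup.one_closed[OF F(1)] subgroup.mem_carrier[OF s(1)]
      unfolding set_mult_def by force
    moreover have "h \<in> N <#>\<^bsub>P\<^esub> F" if "h \<in> F" for h
      using that subgroup.one_closed[OF s(1)] subgroup.mem_carrier[OF F(1)]
      unfolding set_mult_def by force
    moreover have "N <#>\<^bsub>P\<^esub> F \<subseteq> N'" if "N \<subseteq> N'" "F \<subseteq> N'"
      using that subgroup.m_closed[OF s(2)] unfolding set_mult_def by auto
    ultimately show ?thesis by blast
  qed
qed (use F in auto)

end

lemma finite_biset_orbit:
  assumes "finite_biset H G U" "group H" "group G" "u \<in> bset U"
  shows "finite_biset H G (U\<lparr>bset := orbit_of H G U u\<rparr>)"
proof (rule finite_biset_restrict[OF assms(1)])
  note st = orbit_of_stable[OF assms]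
  show "orbit_of H G U u \<subseteq> bset U" by (rule st(1))
  show "lact U h w \<in> orbit_of H G U u" if "h \<in> carrier H" "w \<in> orbit_of H G U u" for h w
    using that st(1) st(3)[of h w] by blast
  show "ract U w g \<in> orbit_of H G U u" if "g \<in> carrier G" "w \<in> orbit_of H G U u" for g w
    using that st(1) st(4)[of g w] by blast
qed

lemma left_to_biset_iso:
  assumes "biset_iso (Q \<times>\<times> opp_group P) G T T'" "group Q" "group P"
  shows "biset_iso Q P (left_to_biset Q P T) (left_to_biset Q P T')"
proof -
  interpret Q: group Q by fact
  interpret P: group P by fact
  obtain f where f: "bij_betw f (bset T) (bset T')"
    "\<And>z t. z \<in> carrier (Q \<times>\<times> opp_group P) \<Longrightarrow> t \<in> bset T \<Longrightarrow> f (lact T z t) = lact T' z (f t)"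
    using assms(1) unfolding biset_iso_def by blast
  then show ?thesis
    unfolding biset_iso_def by (intro exI[of _ f]) auto
qed

text \<open>The homomorphism \<open>\<sigma>\<close> turns \<open>S\<close>-sets into \<open>A\<close>-sets, and the homomorphism \<open>\<beta>\<close> into the center
  makes \<open>A\<close> act on cosets of normal subgroups of \<open>P\<close>.\<close>

locale central_action = A: group A + P: group P + S: group S
  for A :: "'g monoid" and P :: "'a monoid" and S :: "'s monoid" +
  fixes \<sigma> :: "'g \<Rightarrow> 's" and \<beta> :: "'g \<Rightarrow> 'a"
  assumes \<sigma>: "\<sigma> \<in> hom A S" and \<beta>: "\<beta> \<in> hom A P"
    and \<beta>_central: "\<And>g. g \<in> carrier A \<Longrightarrow> \<beta> g \<in> group_center P"
    and finP: "finite (carrier P)" and finS: "finite (carrier S)"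
begin

text \<open>The quotient P/N with \<open>P\<close> acting on both sides, written as one left action
  of the product with the opposite group, and with \<open>A\<close> on the right through
  \<open>\<beta>\<close>. Centrality of the values of \<open>\<beta>\<close> makes the two actions
  commute.\<close>

definition cosets_biset :: "'a set \<Rightarrow> ('a \<times> 'a, 'g, 'a set) biset" where
  "cosets_biset N = \<lparr>bset = rcosets\<^bsub>P\<^esub> N,
     lact = (\<lambda>(q, x) C. lact (quotient_biset P N) q (ract (quotient_biset P N) C x)),
     ract = (\<lambda>C g. ract (quotient_biset P N) C (\<beta> g))\<rparr>"

definition restrict_biset :: "('s, unit, 'u) biset \<Rightarrow> ('g, unit, 'u) biset" where
  "restrict_biset Y = \<lparr>bset = bset Y, lact = (\<lambda>g. lact Y (\<sigma> g)), ract = ract Y\<rparr>"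

text \<open>The tensor product over \<open>S\<close> with this biset is restriction of
  \<open>S\<close>-sets along \<open>\<sigma>\<close>.\<close>

definition regular_biset :: "('g, 's, 's) biset" where
  "regular_biset = \<lparr>bset = carrier S, lact = (\<lambda>g s. \<sigma> g \<otimes>\<^bsub>S\<^esub> s), ract = (\<lambda>s s'. s \<otimes>\<^bsub>S\<^esub> s')\<rparr>"

text \<open>Cosets of \<open>N\<close> see an element of \<open>A\<close> only through
  \<open>\<beta>\<close>, so it is the image of the stabilizer, not the stabilizer itself, that
  enlarges \<open>N\<close>.\<close>

definition fix_image :: "('g, unit, 'u) biset \<Rightarrow> 'u \<Rightarrow> 'a set" where
  "fix_image Y y = \<beta> ` {g \<in> carrier A. lact Y g y = y}"

lemma \<sigma>_hom:
  "g \<in> carrier A \<Longrightarrow> \<sigma> g \<in> carrier S" "\<sigma> \<one>\<^bsub>A\<^esub> = \<one>\<^bsub>S\<^esub>"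
  "g \<in> carrier A \<Longrightarrow> h \<in> carrier A \<Longrightarrow> \<sigma> (g \<otimes>\<^bsub>A\<^esub> h) = \<sigma> g \<otimes>\<^bsub>S\<^esub> \<sigma> h"
proof -
  interpret h: group_hom A S \<sigma> by unfold_locales (rule \<sigma>)
  show "g \<in> carrier A \<Longrightarrow> \<sigma> g \<in> carrier S" "\<sigma> \<one>\<^bsub>A\<^esub> = \<one>\<^bsub>S\<^esub>"
    "g \<in> carrier A \<Longrightarrow> h \<in> carrier A \<Longrightarrow> \<sigma> (g \<otimes>\<^bsub>A\<^esub> h) = \<sigma> g \<otimes>\<^bsub>S\<^esub> \<sigma> h" by auto
qed

lemma \<beta>_hom:
  "g \<in> carrier A \<Longrightarrow> \<beta> g \<in> carrier P" "\<beta> \<one>\<^bsub>A\<^esub> = \<one>\<^bsub>P\<^esub>"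
  "g \<in> carrier A \<Longrightarrow> h \<in> carrier A \<Longrightarrow> \<beta> (g \<otimes>\<^bsub>A\<^esub> h) = \<beta> g \<otimes>\<^bsub>P\<^esub> \<beta> h"
  "g \<in> carrier A \<Longrightarrow> \<beta> (inv\<^bsub>A\<^esub> g) = inv\<^bsub>P\<^esub> (\<beta> g)"
proof -
  interpret h: group_hom A P \<beta> by unfold_locales (rule \<beta>)
  show "g \<in> carrier A \<Longrightarrow> \<beta> g \<in> carrier P" "\<beta> \<one>\<^bsub>A\<^esub> = \<one>\<^bsub>P\<^esub>"
    "g \<in> carrier A \<Longrightarrow> h \<in> carrier A \<Longrightarrow> \<beta> (g \<otimes>\<^bsub>A\<^esub> h) = \<beta> g \<otimes>\<^bsub>P\<^esub> \<beta> h"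
    "g \<in> carrier A \<Longrightarrow> \<beta> (inv\<^bsub>A\<^esub> g) = inv\<^bsub>P\<^esub> (\<beta> g)" by auto
qed

lemma \<beta>_comm: "g \<in> carrier A \<Longrightarrow> x \<in> carrier P \<Longrightarrow> \<beta> g \<otimes>\<^bsub>P\<^esub> x = x \<otimes>\<^bsub>P\<^esub> \<beta> g"
  using \<beta>_central by (auto simp: group_center_def)

lemma finite_restrict_biset:
  assumes "finite_biset S unit_group Y"
  shows "finite_biset A unit_group (restrict_biset Y)"
  using finite_bisetD[OF assms] unfolding finite_biset_def
  by (auto simp: restrict_biset_def \<sigma>_hom)

lemma finite_regular_biset: "finite_biset A S regular_biset"
  unfolding finite_biset_def using finS by (auto simp: regular_biset_def \<sigma>_hom S.m_assoc)

lemma bset_cosets_biset: "bset (cosets_biset N) = (\<lambda>c. N #>\<^bsub>P\<^esub> c) ` carrier P"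
  unfolding cosets_biset_def RCOSETS_def by auto

lemma lact_cosets_biset:
  assumes "N \<lhd> P" "c \<in> carrier P" "q \<in> carrier P" "x \<in> carrier P"
  shows "lact (cosets_biset N) (q, x) (N #>\<^bsub>P\<^esub> c) = N #>\<^bsub>P\<^esub> (q \<otimes>\<^bsub>P\<^esub> c \<otimes>\<^bsub>P\<^esub> x)"
  using assms finite_quotient_biset(2,3)[OF P.is_group finP assms(1)]
  by (simp add: cosets_biset_def P.m_assoc)

lemma ract_cosets_biset:
  assumes "N \<lhd> P" "c \<in> carrier P" "g \<in> carrier A"
  shows "ract (cosets_biset N) (N #>\<^bsub>P\<^esub> c) g = N #>\<^bsub>P\<^esub> (c \<otimes>\<^bsub>P\<^esub> \<beta> g)"
  using assms finite_quotient_biset(3)[OF P.is_group finP assms(1)]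
  by (simp add: cosets_biset_def \<beta>_hom)

lemma finite_cosets_biset:
  assumes "N \<lhd> P"
  shows "finite_biset (P \<times>\<times> opp_group P) A (cosets_biset N)"
proof -
  have "N #>\<^bsub>P\<^esub> (q \<otimes>\<^bsub>P\<^esub> (c \<otimes>\<^bsub>P\<^esub> (x \<otimes>\<^bsub>P\<^esub> \<beta> g))) = N #>\<^bsub>P\<^esub> (q \<otimes>\<^bsub>P\<^esub> (c \<otimes>\<^bsub>P\<^esub> (\<beta> g \<otimes>\<^bsub>P\<^esub> x)))"
    if "x \<in> carrier P" "g \<in> carrier A" for q c x g
    using that by (simp add: \<beta>_comm)
  then show ?thesis
    unfolding finite_biset_def bset_cosets_biset
    using finP by (auto simp: lact_cosets_biset[OF assms] ract_cosets_biset[OF assms] \<beta>_hom P.m_assoc)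
qed

lemma subgroup_fix_image:
  assumes "finite_biset A unit_group Y" "y \<in> bset Y"
  shows "subgroup (fix_image Y y) P" "fix_image Y y \<subseteq> group_center P"
proof -
  note Y = finite_bisetD[OF assms(1)]
  show "fix_image Y y \<subseteq> group_center P" using \<beta>_central by (auto simp: fix_image_def)
  show "subgroup (fix_image Y y) P"
  proof (rule P.subgroupI)
    show "fix_image Y y \<subseteq> carrier P" by (auto simp: fix_image_def \<beta>_hom)
    show "fix_image Y y \<noteq> {}" using Y(3) assms(2) A.one_closed by (auto simp: fix_image_def)
  next
    fix a assume "a \<in> fix_image Y y"
    then obtain g where g: "g \<in> carrier A" "lact Y g y = y" "a = \<beta> g" by (auto simp: fix_image_def)
    have "lact Y (inv\<^bsub>A\<^esub> g) y = y"
      using finite_biset_lact_inv(1)[OF assms(1) A.is_group g(1) assms(2)] g(2) by simp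
    then show "inv\<^bsub>P\<^esub> a \<in> fix_image Y y"
      using g by (auto simp: fix_image_def \<beta>_hom intro!: image_eqI[of _ _ "inv\<^bsub>A\<^esub> g"])
  next
    fix a b assume "a \<in> fix_image Y y" "b \<in> fix_image Y y"
    then obtain g h where g: "g \<in> carrier A" "lact Y g y = y" "a = \<beta> g"
      and h: "h \<in> carrier A" "lact Y h y = y" "b = \<beta> h" by (auto simp: fix_image_def)
    then show "a \<otimes>\<^bsub>P\<^esub> b \<in> fix_image Y y"
      using Y(4) assms(2) by (auto simp: fix_image_def \<beta>_hom intro!: image_eqI[of _ _ "g \<otimes>\<^bsub>A\<^esub> h"])
  qed
qed

lemma lact_unit_orbit:
  assumes "finite_biset A unit_group Y" "y \<in> bset Y"
  shows "orbit_of A unit_group Y y = (\<lambda>g. lact Y g y) ` carrier A"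
proof -
  have "ract Y u () = u" if "u \<in> bset Y" for u
    using finite_bisetD(6)[OF assms(1) that] by (simp add: singleton_group_def)
  then show ?thesis
    using finite_bisetD(2)[OF assms(1)] assms(2)
    by (force simp: orbit_of_def singleton_group_def image_iff)
qed

text \<open>Every class has a representative with second entry \<open>y\<close>, and two cosets of
  \<open>N\<close> give the same class exactly when they differ by the image of an element fixing
  \<open>y\<close>. In short, P/N tensored with A/H is P/(N \<beta>(H)).\<close>

lemma cosets_tensor_orbit_iso:
  assumes N: "N \<lhd> P" and Y: "finite_biset A unit_group Y" and y: "y \<in> bset Y"
  shows "biset_iso P P
    (left_to_biset P P (biset_tensor A (cosets_biset N) (Y\<lparr>bset := orbit_of A unit_group Y y\<rparr>)))
    (quotient_biset P (N <#>\<^bsub>P\<^esub> fix_image Y y))"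
proof -
  let ?F = "fix_image Y y" and ?E = "Y\<lparr>bset := orbit_of A unit_group Y y\<rparr>"
  note st = orbit_of_stable[OF Y A.is_group group_unit y]
  note F = subgroup_fix_image[OF Y y]
  note orb = lact_unit_orbit[OF Y y]
  have E: "finite_biset A unit_group ?E"
    by (rule finite_biset_orbit[OF Y A.is_group group_unit y])
  have NF: "N <#>\<^bsub>P\<^esub> ?F \<lhd> P" using mult_central_normal[OF P.is_group finP N F] .
  note C = finite_cosets_biset[OF N]
  have sN: "subgroup N P" and sNF: "subgroup (N <#>\<^bsub>P\<^esub> ?F) P"
    using N NF normal_imp_subgroup by auto
  have lactT: "lact (biset_tensor A (cosets_biset N) ?E) (q, x) (tcls A (cosets_biset N) ?E (N #>\<^bsub>P\<^esub> c) y)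
      = tcls A (cosets_biset N) ?E (N #>\<^bsub>P\<^esub> (q \<otimes>\<^bsub>P\<^esub> c \<otimes>\<^bsub>P\<^esub> x)) y"
    if "c \<in> carrier P" "q \<in> carrier P" "x \<in> carrier P" for c q x
    using that st(2)
    by (subst lact_tensor[OF C E A.is_group]) (auto simp: bset_cosets_biset lact_cosets_biset[OF N])
  show ?thesis
  proof (rule biset_iso_via[where Z = "carrier P"
        and a = "\<lambda>c. tcls A (cosets_biset N) ?E (N #>\<^bsub>P\<^esub> c) y"
        and b = "\<lambda>c. (N <#>\<^bsub>P\<^esub> ?F) #>\<^bsub>P\<^esub> c"], goal_cases)
    case 1
    \<comment> \<open>An element of the orbit is moved back to \<open>y\<close> at the cost of a
      factor \<open>\<beta> g\<close> in the coset.\<close>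
    have "tcls A (cosets_biset N) ?E (N #>\<^bsub>P\<^esub> c) (lact Y g y)
        = tcls A (cosets_biset N) ?E (N #>\<^bsub>P\<^esub> (c \<otimes>\<^bsub>P\<^esub> \<beta> g)) y"
      if "c \<in> carrier P" "g \<in> carrier A" for c g
      using tcls_slide[OF C E A.is_group, of "N #>\<^bsub>P\<^esub> c" y g] that st(2)
      by (simp add: bset_cosets_biset ract_cosets_biset[OF N])
    then have "tcls A (cosets_biset N) ?E (N #>\<^bsub>P\<^esub> c) (lact Y g y)
        \<in> (\<lambda>c. tcls A (cosets_biset N) ?E (N #>\<^bsub>P\<^esub> c) y) ` carrier P"
      if "c \<in> carrier P" "g \<in> carrier A" for c g
      using that by (auto simp: \<beta>_hom)
    moreover have "tcls A (cosets_biset N) ?E (N #>\<^bsub>P\<^esub> c) y \<in> bset (biset_tensor A (cosets_biset N) ?E)"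
      if "c \<in> carrier P" for c
      using that st(2) by (intro tcls_in_tensor) (auto simp: bset_cosets_biset)
    ultimately show ?case
      by (auto simp: bset_tensor bset_cosets_biset orb)
  next
    case 2
    show ?case by (simp add: bset_quotient_biset[OF P.is_group finP])
  next
    case (3 c d)
    have "tcls A (cosets_biset N) ?E (N #>\<^bsub>P\<^esub> c) y = tcls A (cosets_biset N) ?E (N #>\<^bsub>P\<^esub> d) y
        \<longleftrightarrow> (\<exists>g\<in>carrier A. N #>\<^bsub>P\<^esub> c = N #>\<^bsub>P\<^esub> (d \<otimes>\<^bsub>P\<^esub> \<beta> g) \<and> y = lact Y g y)"
      using 3 st(2) by (subst tcls_eq_iff[OF C E A.is_group]) (auto simp: bset_cosets_biset ract_cosets_biset[OF N])
    also have "\<dots> \<longleftrightarrow> (\<exists>f\<in>?F. N #>\<^bsub>P\<^esub> c = N #>\<^bsub>P\<^esub> (d \<otimes>\<^bsub>P\<^esub> f))"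
      by (force simp: fix_image_def)
    also have "\<dots> \<longleftrightarrow> (\<exists>f\<in>?F. \<exists>n\<in>N. c = n \<otimes>\<^bsub>P\<^esub> (d \<otimes>\<^bsub>P\<^esub> f))"
      using 3 subgroup.mem_carrier[OF F(1)] rcoset_eq_iff[OF P.is_group finP sN 3(1)]
      by (intro bex_cong refl) auto
    \<comment> \<open>Centrality moves the factor from the right of \<open>d\<close> to its left,
      where it joins \<open>N\<close>.\<close>
    also have "\<dots> \<longleftrightarrow> (\<exists>f\<in>?F. \<exists>n\<in>N. c = n \<otimes>\<^bsub>P\<^esub> f \<otimes>\<^bsub>P\<^esub> d)"
    proof (intro bex_cong refl)
      fix f n assume "f \<in> ?F" "n \<in> N"
      then have "f \<in> group_center P" "n \<in> carrier P" "f \<in> carrier P"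
        using F subgroup.mem_carrier[OF F(1)] subgroup.mem_carrier[OF sN] by auto
      then have "n \<otimes>\<^bsub>P\<^esub> (d \<otimes>\<^bsub>P\<^esub> f) = n \<otimes>\<^bsub>P\<^esub> f \<otimes>\<^bsub>P\<^esub> d"
        using 3(2) by (simp add: group_center_def P.m_assoc)
      then show "c = n \<otimes>\<^bsub>P\<^esub> (d \<otimes>\<^bsub>P\<^esub> f) \<longleftrightarrow> c = n \<otimes>\<^bsub>P\<^esub> f \<otimes>\<^bsub>P\<^esub> d" by simp
    qed
    also have "\<dots> \<longleftrightarrow> (\<exists>m\<in>N <#>\<^bsub>P\<^esub> ?F. c = m \<otimes>\<^bsub>P\<^esub> d)"
      unfolding set_mult_def by blast
    also have "\<dots> \<longleftrightarrow> (N <#>\<^bsub>P\<^esub> ?F) #>\<^bsub>P\<^esub> c = (N <#>\<^bsub>P\<^esub> ?F) #>\<^bsub>P\<^esub> d"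
      using rcoset_eq_iff[OF P.is_group finP sNF 3] by simp
    finally show ?case .
  next
    case (4 q c)
    then show ?case
      using lactT[of c q "\<one>\<^bsub>P\<^esub>"] finite_quotient_biset(2)[OF P.is_group finP NF]
      by (intro bexI[of _ "q \<otimes>\<^bsub>P\<^esub> c"]) auto
  next
    case (5 x c)
    then show ?case
      using lactT[of c "\<one>\<^bsub>P\<^esub>" x] finite_quotient_biset(3)[OF P.is_group finP NF]
      by (intro bexI[of _ "c \<otimes>\<^bsub>P\<^esub> x"]) auto
  qed
qed

definition orbit_rep :: "'u set \<Rightarrow> 'u" where
  "orbit_rep E = (SOME y. y \<in> E)"

lemma orbit_eq:
  assumes Y: "finite_biset A unit_group Y" and "y \<in> bset Y" "z \<in> orbit_of A unit_group Y y"
  shows "orbit_of A unit_group Y z = orbit_of A unit_group Y y"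
proof -
  have sub: "orbit_of A unit_group Y z \<subseteq> orbit_of A unit_group Y y"
    if "y \<in> bset Y" "z \<in> orbit_of A unit_group Y y" for y z
  proof -
    have z: "z \<in> bset Y" using that orbit_of_stable(1)[OF Y A.is_group group_unit] by blast
    show ?thesis
      using that z orbit_of_stable(3)[OF Y A.is_group group_unit that(1) _ z]
      by (auto simp: lact_unit_orbit[OF Y z])
  qed
  have z: "z \<in> bset Y" using assms orbit_of_stable(1)[OF Y A.is_group group_unit] by blast
  obtain g where g: "g \<in> carrier A" "z = lact Y g y"
    using assms(3) by (auto simp: lact_unit_orbit[OF Y assms(2)])
  have "y = lact Y (inv\<^bsub>A\<^esub> g) z"
    using g finite_biset_lact_inv(1)[OF Y A.is_group g(1) assms(2)] by simp
  then have "y \<in> orbit_of A unit_group Y z"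
    unfolding lact_unit_orbit[OF Y z] using g(1) A.inv_closed by blast
  then show ?thesis using sub[OF assms(2,3)] sub[OF z] by blast
qed

lemma orbit_rep:
  assumes Y: "finite_biset A unit_group Y" and "E \<in> orbit_of A unit_group Y ` bset Y"
  shows "orbit_rep E \<in> bset Y" "orbit_rep E \<in> E" "orbit_of A unit_group Y (orbit_rep E) = E"
proof -
  obtain y where y: "y \<in> bset Y" "E = orbit_of A unit_group Y y" using assms(2) by blast
  note st = orbit_of_stable[OF Y A.is_group group_unit y(1)]
  show rep: "orbit_rep E \<in> E" unfolding orbit_rep_def using st(2) y(2) by (metis someI)
  then show "orbit_rep E \<in> bset Y" using y st by blast
  show "orbit_of A unit_group Y (orbit_rep E) = E" using orbit_eq[OF Y y(1)] rep y(2) by simp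
qed

text \<open>Sliding elements of \<open>A\<close> across keeps the second entry in its orbit, so the
  tensor product falls apart into one piece for each orbit of \<open>Y\<close>.\<close>

lemma mark_cosets_tensor:
  assumes N: "N \<lhd> P" and Y: "finite_biset A unit_group Y"
  shows "mark P P (left_to_biset P P (biset_tensor A (cosets_biset N) Y))
    = (\<Sum>E\<in>orbit_of A unit_group Y ` bset Y.
         mark P P (quotient_biset P (N <#>\<^bsub>P\<^esub> fix_image Y (orbit_rep E))))"
proof -
  let ?orbs = "orbit_of A unit_group Y ` bset Y" and ?C = "cosets_biset N"
  let ?T = "left_to_biset P P (biset_tensor A ?C Y)"
  define D where "D E = bset (biset_tensor A ?C (Y\<lparr>bset := E\<rparr>))" for E
  note C = finite_cosets_biset[OF N] and Yd = finite_bisetD[OF Y]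
  have fO: "finite_biset A unit_group (Y\<lparr>bset := E\<rparr>)" and subO: "E \<subseteq> bset Y" if "E \<in> ?orbs" for E
  proof -
    from that obtain y where y: "y \<in> bset Y" "E = orbit_of A unit_group Y y" by blast
    note st = orbit_of_stable[OF Y A.is_group group_unit y(1)]
    show "E \<subseteq> bset Y" using st(1) y(2) by simp
    show "finite_biset A unit_group (Y\<lparr>bset := E\<rparr>)"
      unfolding y(2) by (rule finite_biset_orbit[OF Y A.is_group group_unit y(1)])
  qed
  \<comment> \<open>The tensor relation restricts the second entry only at the source pair, so for
    \<open>y \<in> E\<close> the two classes are the same set, not merely in bijection.\<close>
  have tcls_O: "tcls A ?C (Y\<lparr>bset := E\<rparr>) c y = tcls A ?C Y c y" if "E \<in> ?orbs" "y \<in> E" for E c y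
  proof -
    have "y \<in> bset Y" using that subO by blast
    then show ?thesis using that(2) unfolding tcls_def tensor_rel_def by auto
  qed
  have Dtcls: "D E = (\<lambda>(c, y). tcls A ?C Y c y) ` (bset ?C \<times> E)" if "E \<in> ?orbs" for E
    unfolding D_def bset_tensor using tcls_O[OF that] by (intro image_cong) auto
  have finT: "finite_biset (P \<times>\<times> opp_group P) unit_group (biset_tensor A ?C Y')"
    if "finite_biset A unit_group Y'" for Y' :: "('g, unit, 'b) biset"
    by (rule finite_biset_tensor[OF C that A.is_group group_DirProd_opp[OF P.is_group P.is_group] group_unit])
  have "mark P P ?T = (\<Sum>E\<in>?orbs. mark P P (?T\<lparr>bset := D E\<rparr>))"
  proof (rule mark_disjoint_union)
    show "finite ?orbs" using Yd(1) by simp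
    show "finite (D E)" if "E \<in> ?orbs" for E
      unfolding D_def using finite_bisetD(1)[OF finT[OF fO[OF that]]] .
    show "D E \<inter> D E' = {}" if E: "E \<in> ?orbs" "E' \<in> ?orbs" "E \<noteq> E'" for E E'
    proof (rule ccontr)
      assume "D E \<inter> D E' \<noteq> {}"
      then obtain c y c' y' where m: "c \<in> bset ?C" "y \<in> E" "c' \<in> bset ?C" "y' \<in> E'"
        "tcls A ?C Y c y = tcls A ?C Y c' y'"
        unfolding Dtcls[OF E(1)] Dtcls[OF E(2)] by auto
      then have yy: "y \<in> bset Y" "y' \<in> bset Y" using subO E by auto
      then obtain g where "g \<in> carrier A" "y' = lact Y g y"
        using m tcls_eq_iff[OF C Y A.is_group m(1) yy(1) m(3) yy(2)] by blast
      then have "y' \<in> orbit_of A unit_group Y y" using lact_unit_orbit[OF Y yy(1)] by simp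
      then have "orbit_of A unit_group Y y' = orbit_of A unit_group Y y"
        by (rule orbit_eq[OF Y yy(1)])
      moreover have "orbit_of A unit_group Y y = E" "orbit_of A unit_group Y y' = E'"
        using E m(2,4) orbit_eq[OF Y] by auto
      ultimately show False using E(3) by simp
    qed
    have "bset Y = (\<Union>E\<in>?orbs. E)"
      using subO orbit_of_stable(2)[OF Y A.is_group group_unit] by blast
    then have "bset ?C \<times> bset Y = (\<Union>E\<in>?orbs. bset ?C \<times> E)" by blast
    then have "bset ?T = (\<lambda>(c, y). tcls A ?C Y c y) ` (\<Union>E\<in>?orbs. bset ?C \<times> E)"
      by (simp only: bset_tensor left_to_biset_sel)
    also have "\<dots> = (\<Union>E\<in>?orbs. D E)"
      unfolding image_UN using Dtcls by auto
    finally show "bset ?T = (\<Union>E\<in>?orbs. D E)" .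
  qed
  also have "\<dots> = (\<Sum>E\<in>?orbs. mark P P (quotient_biset P (N <#>\<^bsub>P\<^esub> fix_image Y (orbit_rep E))))"
  proof (rule sum.cong[OF refl])
    fix E assume E: "E \<in> ?orbs"
    have "?T\<lparr>bset := D E\<rparr> = left_to_biset P P (biset_tensor A ?C (Y\<lparr>bset := E\<rparr>))"
      by (simp add: left_to_biset_def D_def biset_tensor_def)
    then show "mark P P (?T\<lparr>bset := D E\<rparr>)
        = mark P P (quotient_biset P (N <#>\<^bsub>P\<^esub> fix_image Y (orbit_rep E)))"
      using mark_iso[OF cosets_tensor_orbit_iso[OF N Y orbit_rep(1)[OF Y E]]]
        finite_left_to_biset[OF finT[OF fO[OF E]] P.is_group P.is_group] orbit_rep(3)[OF Y E] by simp
  qed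
  finally show ?thesis .
qed

text \<open>Every class has a representative whose middle entry is 1, since an element of
  \<open>S\<close> can be moved over to \<open>Y\<close>. What remains to be divided out is the
  action of \<open>A\<close>, which reaches \<open>Y\<close> through
  \<open>\<sigma>\<close>.\<close>

lemma regular_tensor_iso:
  assumes N: "N \<lhd> P" and Y: "finite_biset S unit_group Y"
  shows "biset_iso (P \<times>\<times> opp_group P) unit_group
    (biset_tensor S (biset_tensor A (cosets_biset N) regular_biset) Y)
    (biset_tensor A (cosets_biset N) (restrict_biset Y))"
proof -
  let ?C = "cosets_biset N" and ?R = "regular_biset" and ?Y = "restrict_biset Y"
  let ?CR = "biset_tensor A ?C ?R"
  note PP = group_DirProd_opp[OF P.is_group P.is_group]
  note C = finite_cosets_biset[OF N] and R = finite_regular_biset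
  note Y' = finite_restrict_biset[OF Y] and CR = finite_biset_tensor[OF C R A.is_group PP S.is_group]
  note Cd = finite_bisetD[OF C] and Yd = finite_bisetD[OF Y]
  have R_sel: "bset ?R = carrier S" "lact ?R g s = \<sigma> g \<otimes>\<^bsub>S\<^esub> s" "ract ?R s s' = s \<otimes>\<^bsub>S\<^esub> s'" for g s s'
    by (simp_all add: regular_biset_def)
  have Y_sel: "bset ?Y = bset Y" "lact ?Y g y = lact Y (\<sigma> g) y" "ract ?Y y u = ract Y y u" for g y u
    by (simp_all add: restrict_biset_def)
  have memCR: "tcls A ?C ?R c s \<in> bset ?CR" if "c \<in> bset ?C" "s \<in> carrier S" for c s
    using that by (simp add: tcls_in_tensor R_sel)
  have slide: "tcls S ?CR Y (tcls A ?C ?R c s) y = tcls S ?CR Y (tcls A ?C ?R c \<one>\<^bsub>S\<^esub>) (lact Y s y)"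
    if "c \<in> bset ?C" "s \<in> carrier S" "y \<in> bset Y" for c s y
    using tcls_slide[OF CR Y S.is_group memCR[OF that(1) S.one_closed] that(3,2)] that
      ract_tensor[OF C R A.is_group, of c "\<one>\<^bsub>S\<^esub>" s] by (simp add: R_sel)
  show ?thesis
  proof (rule biset_iso_via[where Z = "bset ?C \<times> bset Y"
        and a = "\<lambda>(c, y). tcls S ?CR Y (tcls A ?C ?R c \<one>\<^bsub>S\<^esub>) y"
        and b = "\<lambda>(c, y). tcls A ?C ?Y c y"], goal_cases)
    case 1
    have "x \<in> (\<lambda>(c, y). tcls S ?CR Y (tcls A ?C ?R c \<one>\<^bsub>S\<^esub>) y) ` (bset ?C \<times> bset Y)"
      if "x \<in> bset (biset_tensor S ?CR Y)" for x
    proof -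
      obtain D y where D: "D \<in> bset ?CR" "y \<in> bset Y" "x = tcls S ?CR Y D y"
        using \<open>x \<in> _\<close> by (rule tensorE)
      obtain c s where c: "c \<in> bset ?C" "s \<in> carrier S" "D = tcls A ?C ?R c s"
        using D(1) by (rule tensorE) (simp add: R_sel)
      show ?thesis
        unfolding D(3) c(3) slide[OF c(1,2) D(2)] using c(1,2) D(2) Yd(2)
        by (intro image_eqI[of _ _ "(c, lact Y s y)"]) simp_all
    qed
    moreover have "tcls S ?CR Y (tcls A ?C ?R c \<one>\<^bsub>S\<^esub>) y \<in> bset (biset_tensor S ?CR Y)"
      if "c \<in> bset ?C" "y \<in> bset Y" for c y
      using that by (intro tcls_in_tensor memCR) auto
    ultimately show ?case by auto
  next
    case 2 show ?case by (simp add: bset_tensor Y_sel)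
  next
    case (3 z z')
    obtain c y d w where z: "z = (c, y)" "z' = (d, w)" by (cases z, cases z')
    with 3 have m: "c \<in> bset ?C" "y \<in> bset Y" "d \<in> bset ?C" "w \<in> bset Y" by auto
    have "tcls S ?CR Y (tcls A ?C ?R c \<one>\<^bsub>S\<^esub>) y = tcls S ?CR Y (tcls A ?C ?R d \<one>\<^bsub>S\<^esub>) w
      \<longleftrightarrow> (\<exists>s\<in>carrier S. tcls A ?C ?R c \<one>\<^bsub>S\<^esub> = ract ?CR (tcls A ?C ?R d \<one>\<^bsub>S\<^esub>) s \<and> w = lact Y s y)"
      using m by (intro tcls_eq_iff[OF CR Y S.is_group] memCR) auto
    also have "\<dots> \<longleftrightarrow> (\<exists>s\<in>carrier S. tcls A ?C ?R c \<one>\<^bsub>S\<^esub> = tcls A ?C ?R d s \<and> w = lact Y s y)"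
      using m ract_tensor[OF C R A.is_group, of d "\<one>\<^bsub>S\<^esub>"]
      by (intro bex_cong refl) (simp add: R_sel)
    also have "\<dots> \<longleftrightarrow> (\<exists>s\<in>carrier S. (\<exists>g\<in>carrier A. c = ract ?C d g \<and> s = \<sigma> g) \<and> w = lact Y s y)"
    proof (intro bex_cong refl)
      fix s assume s: "s \<in> carrier S"
      have "tcls A ?C ?R c \<one>\<^bsub>S\<^esub> = tcls A ?C ?R d s \<longleftrightarrow>
          (\<exists>g\<in>carrier A. c = ract ?C d g \<and> s = lact ?R g \<one>\<^bsub>S\<^esub>)"
        using m s by (intro tcls_eq_iff[OF C R A.is_group]) (auto simp: R_sel)
      then show "(tcls A ?C ?R c \<one>\<^bsub>S\<^esub> = tcls A ?C ?R d s \<and> w = lact Y s y) \<longleftrightarrow>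
          ((\<exists>g\<in>carrier A. c = ract ?C d g \<and> s = \<sigma> g) \<and> w = lact Y s y)"
        by (simp add: R_sel \<sigma>_hom cong: bex_cong)
    qed
    also have "\<dots> \<longleftrightarrow> (\<exists>g\<in>carrier A. c = ract ?C d g \<and> w = lact ?Y g y)"
      using \<sigma>_hom(1) by (auto simp: Y_sel)
    also have "\<dots> \<longleftrightarrow> tcls A ?C ?Y c y = tcls A ?C ?Y d w"
      using m by (intro tcls_eq_iff[OF C Y' A.is_group, symmetric]) (auto simp: Y_sel)
    finally show ?case by (simp add: z)
  next
    case (4 h z)
    obtain c y where z: "z = (c, y)" by (cases z)
    with 4 have m: "c \<in> bset ?C" "y \<in> bset Y" by auto
    have "lact ?C h c \<in> bset ?C" using Cd(2) 4(1) m(1) by blast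
    moreover have "lact (biset_tensor S ?CR Y) h (tcls S ?CR Y (tcls A ?C ?R c \<one>\<^bsub>S\<^esub>) y)
        = tcls S ?CR Y (tcls A ?C ?R (lact ?C h c) \<one>\<^bsub>S\<^esub>) y"
      using lact_tensor[OF CR Y S.is_group memCR[OF m(1) S.one_closed] m(2) 4(1)]
        lact_tensor[OF C R A.is_group m(1) _ 4(1), of "\<one>\<^bsub>S\<^esub>"] by (simp add: R_sel)
    moreover have "lact (biset_tensor A ?C ?Y) h (tcls A ?C ?Y c y) = tcls A ?C ?Y (lact ?C h c) y"
      using m by (intro lact_tensor[OF C Y' A.is_group m(1) _ 4(1)]) (simp add: Y_sel)
    ultimately show ?case
      using m by (intro bexI[of _ "(lact ?C h c, y)"]) (auto simp: z)
  next
    case (5 u z)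
    obtain c y where z: "z = (c, y)" by (cases z)
    with 5 have m: "c \<in> bset ?C" "y \<in> bset Y" by auto
    have "ract Y y u \<in> bset Y" using Yd(5) 5(1) m(2) by blast
    moreover have "ract (biset_tensor S ?CR Y) (tcls S ?CR Y (tcls A ?C ?R c \<one>\<^bsub>S\<^esub>) y) u
        = tcls S ?CR Y (tcls A ?C ?R c \<one>\<^bsub>S\<^esub>) (ract Y y u)"
      using ract_tensor[OF CR Y S.is_group memCR[OF m(1) S.one_closed] m(2) 5(1)] .
    moreover have "ract (biset_tensor A ?C ?Y) (tcls A ?C ?Y c y) u = tcls A ?C ?Y c (ract Y y u)"
      using m ract_tensor[OF C Y' A.is_group m(1) _ 5(1), of y] by (simp add: Y_sel)
    ultimately show ?case
      using m by (intro bexI[of _ "(c, ract Y y u)"]) (auto simp: z)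
  qed
qed

section \<open>Free orbits and the weighted sum over normal subgroups\<close>

lemma comp_marks_cosets:
  assumes N: "N \<lhd> P" and Y: "finite_biset S unit_group Y"
  shows "mark P P (left_to_biset P P (biset_tensor S (biset_tensor A (cosets_biset N) regular_biset) Y))
    = (\<Sum>E\<in>orbit_of A unit_group (restrict_biset Y) ` bset Y.
         mark P P (quotient_biset P (N <#>\<^bsub>P\<^esub> fix_image (restrict_biset Y) (orbit_rep E))))"
proof -
  note PP = group_DirProd_opp[OF P.is_group P.is_group]
  note C = finite_biset_tensor[OF finite_cosets_biset[OF N] finite_regular_biset A.is_group PP S.is_group]
  have "bset (restrict_biset Y) = bset Y" by (simp add: restrict_biset_def)
  then show ?thesis
    using mark_iso[OF left_to_biset_iso[OF regular_tensor_iso[OF N Y] P.is_group P.is_group]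
        finite_left_to_biset[OF finite_biset_tensor[OF C Y S.is_group PP group_unit] P.is_group P.is_group]]
      mark_cosets_tensor[OF N finite_restrict_biset[OF Y]] by simp
qed

abbreviation mu :: "'a set \<Rightarrow> int" where
  "mu N \<equiv> moebius {N. N \<lhd> P} {\<one>\<^bsub>P\<^esub>} N"

text \<open>Freeness is meant modulo the kernel of \<open>\<beta>\<close>, whose elements act
  trivially on cosets and may fix points. Conjugate stabilizers have the same image in the center,
  so the choice of the representative is immaterial.\<close>

definition free_orbits :: "('s, unit, 'u) biset \<Rightarrow> 'u set set" where
  "free_orbits Y = {E \<in> orbit_of A unit_group (restrict_biset Y) ` bset Y.
     fix_image (restrict_biset Y) (orbit_rep E) = {\<one>\<^bsub>P\<^esub>}}"

text \<open>By Weisner's theorem only the orbits on which \<open>A\<close> acts through \<open>\<beta>\<close> freely contribute.\<close>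

lemma weighted_comp_marks:
  assumes Y: "finite_biset S unit_group Y"
  shows "(\<Sum>N\<in>{N. N \<lhd> P}. mu N *
      mark P P (left_to_biset P P (biset_tensor S (biset_tensor A (cosets_biset N) regular_biset) Y)) K)
    = int (card (free_orbits Y)) * (\<Sum>N\<in>{N. N \<lhd> P}. mu N * mark P P (quotient_biset P N) K)"
proof -
  let ?Y = "restrict_biset Y"
  let ?orbs = "orbit_of A unit_group ?Y ` bset Y"
  let ?q = "\<lambda>N. mark P P (quotient_biset P N) K"
  note Y' = finite_restrict_biset[OF Y]
  have bset: "bset ?Y = bset Y" by (simp add: restrict_biset_def)
  have fin: "finite ?orbs" using finite_bisetD(1)[OF Y] by simp
  have "(\<Sum>N\<in>{N. N \<lhd> P}. mu N *
      mark P P (left_to_biset P P (biset_tensor S (biset_tensor A (cosets_biset N) regular_biset) Y)) K)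
    = (\<Sum>N\<in>{N. N \<lhd> P}. \<Sum>E\<in>?orbs. mu N * ?q (N <#>\<^bsub>P\<^esub> fix_image ?Y (orbit_rep E)))"
    by (intro sum.cong refl) (simp add: comp_marks_cosets[OF _ Y] sum_fun_apply sum_distrib_left)
  \<comment> \<open>For a fixed orbit the inner sum has the shape of Weisner's theorem, with
    \<open>F\<close> the image of the stabilizer.\<close>
  also have "\<dots> = (\<Sum>E\<in>?orbs. \<Sum>N\<in>{N. N \<lhd> P}. mu N * ?q (N <#>\<^bsub>P\<^esub> fix_image ?Y (orbit_rep E)))"
    by (rule sum.swap)
  also have "\<dots> = (\<Sum>E\<in>?orbs. if E \<in> free_orbits Y then (\<Sum>N\<in>{N. N \<lhd> P}. mu N * ?q N) else 0)"
  proof (rule sum.cong[OF refl])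
    fix E assume E: "E \<in> ?orbs"
    note F = subgroup_fix_image[OF Y' orbit_rep(1)[OF Y' E[folded bset]]]
    show "(\<Sum>N\<in>{N. N \<lhd> P}. mu N * ?q (N <#>\<^bsub>P\<^esub> fix_image ?Y (orbit_rep E)))
        = (if E \<in> free_orbits Y then (\<Sum>N\<in>{N. N \<lhd> P}. mu N * ?q N) else 0)"
    proof (cases "E \<in> free_orbits Y")
      case True
      have "N <#>\<^bsub>P\<^esub> {\<one>\<^bsub>P\<^esub>} = N" if "N \<lhd> P" for N
        using subgroup.mem_carrier[OF normal_imp_subgroup[OF that]] by (force simp: set_mult_def)
      then have "(\<Sum>N\<in>{N. N \<lhd> P}. mu N * ?q (N <#>\<^bsub>P\<^esub> {\<one>\<^bsub>P\<^esub>})) = (\<Sum>N\<in>{N. N \<lhd> P}. mu N * ?q N)"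
        by (intro sum.cong refl) (simp only: mem_Collect_eq)
      then show ?thesis using True by (simp add: free_orbits_def)
    next
      case False
      then have "fix_image ?Y (orbit_rep E) \<noteq> {\<one>\<^bsub>P\<^esub>}" using E by (auto simp: free_orbits_def)
      from weisner_normal_subgroups[OF P.is_group finP F this, of ?q] False show ?thesis by simp
    qed
  qed
  also have "\<dots> = (\<Sum>E\<in>free_orbits Y. \<Sum>N\<in>{N. N \<lhd> P}. mu N * ?q N)"
    using fin by (intro sum.mono_neutral_cong_right) (auto simp: free_orbits_def)
  finally show ?thesis by simp
qed

lemma free_orbits_empty:
  assumes Y: "finite_biset S unit_group Y"
    and "\<And>y. y \<in> bset Y \<Longrightarrow> \<exists>g\<in>carrier A. lact Y (\<sigma> g) y = y \<and> \<beta> g \<noteq> \<one>\<^bsub>P\<^esub>"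
  shows "free_orbits Y = {}"
proof (rule ccontr)
  assume "free_orbits Y \<noteq> {}"
  then obtain E where E: "E \<in> orbit_of A unit_group (restrict_biset Y) ` bset (restrict_biset Y)"
    and F: "fix_image (restrict_biset Y) (orbit_rep E) = {\<one>\<^bsub>P\<^esub>}"
    unfolding free_orbits_def restrict_biset_def by auto
  have "orbit_rep E \<in> bset Y"
    using orbit_rep(1)[OF finite_restrict_biset[OF Y] E] by (simp add: restrict_biset_def)
  then obtain g where "g \<in> carrier A" "lact Y (\<sigma> g) (orbit_rep E) = orbit_rep E" "\<beta> g \<noteq> \<one>\<^bsub>P\<^esub>"
    using assms(2) by blast
  then have "\<beta> g \<in> fix_image (restrict_biset Y) (orbit_rep E)"
    by (auto simp: fix_image_def restrict_biset_def)
  then show False using F \<open>\<beta> g \<noteq> \<one>\<^bsub>P\<^esub>\<close> by simp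
qed

lemma free_orbits_single:
  assumes Y: "finite_biset S unit_group Y" and y0: "y0 \<in> bset Y"
    and free: "\<And>g. g \<in> carrier A \<Longrightarrow> lact Y (\<sigma> g) y0 = y0 \<Longrightarrow> \<beta> g = \<one>\<^bsub>P\<^esub>"
    and other: "\<And>y. y \<in> bset Y \<Longrightarrow> (\<exists>g\<in>carrier A. y = lact Y (\<sigma> g) y0) \<or>
        (\<exists>g\<in>carrier A. lact Y (\<sigma> g) y = y \<and> \<beta> g \<noteq> \<one>\<^bsub>P\<^esub>)"
  shows "card (free_orbits Y) = 1"
proof -
  let ?Y = "restrict_biset Y"
  let ?E = "orbit_of A unit_group ?Y y0"
  note Y' = finite_restrict_biset[OF Y]
  have sel: "bset ?Y = bset Y" "lact ?Y g y = lact Y (\<sigma> g) y" for g y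
    by (simp_all add: restrict_biset_def)
  have y0': "y0 \<in> bset ?Y" using y0 by (simp add: sel)
  have E: "?E \<in> orbit_of A unit_group ?Y ` bset ?Y" using y0' by blast
  have "fix_image ?Y (orbit_rep ?E) = {\<one>\<^bsub>P\<^esub>}"
  proof -
    have "\<beta> g = \<one>\<^bsub>P\<^esub>" if g: "g \<in> carrier A" "lact ?Y g (orbit_rep ?E) = orbit_rep ?E" for g
    proof -
      obtain h where h: "h \<in> carrier A" "orbit_rep ?E = lact ?Y h y0"
        using orbit_rep(2)[OF Y' E] lact_unit_orbit[OF Y' y0'] by auto
      \<comment> \<open>Conjugation by \<open>h\<close> carries an element fixing the representative
        to one fixing \<open>y0\<close>; its image under \<open>\<beta>\<close> is unchanged because
        that image is central.\<close>
      let ?k = "inv\<^bsub>A\<^esub> h \<otimes>\<^bsub>A\<^esub> (g \<otimes>\<^bsub>A\<^esub> h)"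
      have "lact ?Y ?k y0 = lact ?Y (inv\<^bsub>A\<^esub> h) (lact ?Y g (lact ?Y h y0))"
        using finite_bisetD(2,4)[OF Y'] y0' g h by simp
      also have "\<dots> = y0"
        using g h finite_biset_lact_inv(1)[OF Y' A.is_group h(1) y0'] by simp
      finally have "\<beta> ?k = \<one>\<^bsub>P\<^esub>" using free g h by (simp add: sel)
      moreover have "\<beta> ?k = \<beta> g"
        using g h by (simp add: \<beta>_hom \<beta>_comm[of g] P.m_assoc[symmetric])
      ultimately show ?thesis by simp
    qed
    moreover have "\<one>\<^bsub>P\<^esub> \<in> fix_image ?Y (orbit_rep ?E)"
      using subgroup.one_closed[OF subgroup_fix_image(1)[OF Y' orbit_rep(1)[OF Y' E]]] .
    ultimately show ?thesis by (auto simp: fix_image_def)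
  qed
  moreover have "E' = ?E" if E': "E' \<in> free_orbits Y" for E'
  proof -
    have E'': "E' \<in> orbit_of A unit_group ?Y ` bset ?Y" "fix_image ?Y (orbit_rep E') = {\<one>\<^bsub>P\<^esub>}"
      using E' by (auto simp: free_orbits_def sel)
    note rep = orbit_rep[OF Y' E''(1)]
    have "\<not> (\<exists>g\<in>carrier A. lact Y (\<sigma> g) (orbit_rep E') = orbit_rep E' \<and> \<beta> g \<noteq> \<one>\<^bsub>P\<^esub>)"
      using E''(2) by (auto simp: fix_image_def sel)
    then obtain g where "g \<in> carrier A" "orbit_rep E' = lact ?Y g y0"
      using other[of "orbit_rep E'"] rep(1) by (auto simp: sel)
    then have "orbit_rep E' \<in> ?E" unfolding lact_unit_orbit[OF Y' y0'] by blast
    then show ?thesis using orbit_eq[OF Y' y0'] rep(3) by metis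
  qed
  moreover from calculation(1) have "?E \<in> free_orbits Y"
    using E unfolding free_orbits_def sel by blast
  ultimately have "free_orbits Y = {?E}" by blast
  then show ?thesis by simp
qed

end

text \<open>The counts 0 and 1 are those of the lines and the points of the projective plane; their
  difference is the coefficient -1 in front of \<open>f_one\<close>.\<close>

locale central_action_difference = central_action A P S \<sigma> \<beta> + burnside_difference S L M
  for A :: "'g monoid" and P :: "'a monoid" and S :: "'s monoid" and \<sigma> \<beta>
    and L :: "('s, unit, 'l) biset" and M :: "('s, unit, 'm) biset" +
  assumes L_orbits: "free_orbits L = {}" and M_orbits: "card (free_orbits M) = 1"
begin

text \<open>The witness is explicit: minus the sum over N of \<open>mu N\<close> times the tensor
  product of P/N and \<open>S\<close> over \<open>A\<close>, composed with \<open>L - M\<close>. The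
  weighted sum vanishes on \<open>L\<close> and equals \<open>f_one\<close> on
  \<open>M\<close>.\<close>

lemma f_one_in_ideal: "f_one P \<in> vclass P P ` ideal_marks P P"
proof -
  note PP = group_DirProd_opp[OF P.is_group P.is_group]
  let ?V = "\<lambda>N. biset_tensor A (cosets_biset N) regular_biset"
  let ?d = "\<Sum>N\<in>{N. N \<lhd> P}. (\<lambda>K. mu N * comp_marks P P (?V N) K)"
  have "comp_marks P P (?V N) \<in> ideal_marks P P" if N: "N \<lhd> P" for N
  proof -
    \<comment> \<open>Elements of the ideal come as differences; the empty biset serves as
      subtrahend.\<close>
    have "comp_marks P P (?V N) - comp_marks P P (empty_biset :: ('a \<times> 'a, 's, nat) biset) \<in> ideal_marks P P"
      by (rule comp_marks_diff_in_ideal[OF P.is_group P.is_group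
            finite_biset_tensor[OF finite_cosets_biset[OF N] finite_regular_biset A.is_group PP S.is_group]
            finite_biset_empty])
    moreover have "comp_marks P P (empty_biset :: ('a \<times> 'a, 's, nat) biset) = 0"
      by (auto simp: comp_marks_def mark_def fixpts_def bset_tensor empty_biset_def fun_eq_iff)
    ultimately show ?thesis by simp
  qed
  then have d: "?d \<in> ideal_marks P P"
    by (intro sum_in_ideal[OF P.is_group P.is_group] scale_in_ideal[OF P.is_group P.is_group]) auto
  have "(\<Sum>N\<in>{N. N \<lhd> P}. (\<lambda>K. mu N * mark P P (quotient_biset P N) K)) = - ?d"
  proof
    fix K
    have "?d K = (\<Sum>N\<in>{N. N \<lhd> P}. mu N * mark P P (left_to_biset P P (biset_tensor S (?V N) L)) K)
        - (\<Sum>N\<in>{N. N \<lhd> P}. mu N * mark P P (left_to_biset P P (biset_tensor S (?V N) M)) K)"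
      by (simp add: sum_fun_apply comp_marks_def right_diff_distrib sum_subtractf)
    then show "(\<Sum>N\<in>{N. N \<lhd> P}. (\<lambda>K. mu N * mark P P (quotient_biset P N) K)) K = (- ?d) K"
      unfolding weighted_comp_marks[OF L] weighted_comp_marks[OF M] L_orbits M_orbits
      by (simp add: sum_fun_apply)
  qed
  then show ?thesis
    unfolding f_one_eq_vclass[OF P.is_group finP]
    using minus_in_ideal[OF P.is_group P.is_group d] by simp
qed

end

section \<open>The projective plane\<close>

context cring
begin

text \<open>With sums written out in three terms, matrix identities become ring identities between
  entries, accessible to rewriting.\<close>

lemma finsum3:
  assumes "f 0 \<in> carrier R" "f 1 \<in> carrier R" "f 2 \<in> carrier R"
  shows "(\<Oplus>k\<in>{..<3::nat}. f k) = f 0 \<oplus> f 1 \<oplus> f 2"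
proof -
  have "{..<3::nat} = {2, 1, 0}" by auto
  then show ?thesis using assms by (simp add: a_ac)
qed

lemma less3: "i < (3::nat) \<longleftrightarrow> i = 0 \<or> i = 1 \<or> i = 2"
  by auto

abbreviation "M3 \<equiv> mat_monoid 3 R"
abbreviation "V3 \<equiv> vec_space 3 R"

lemma mat_closed: "A \<in> carrier M3 \<Longrightarrow> i < 3 \<Longrightarrow> j < 3 \<Longrightarrow> A (i, j) \<in> carrier R"
  by (auto simp: mat_monoid_def)

lemma vec_closed: "v \<in> V3 \<Longrightarrow> i < 3 \<Longrightarrow> v i \<in> carrier R"
  by (auto simp: vec_space_def)

lemma mat_eqI:
  assumes "A \<in> carrier M3" "B \<in> carrier M3" "\<And>i j. i < 3 \<Longrightarrow> j < 3 \<Longrightarrow> A (i, j) = B (i, j)"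
  shows "A = B"
proof (rule PiE_ext[of _ "{..<3} \<times> {..<3}" "\<lambda>_. carrier R"])
  show "A x = B x" if "x \<in> {..<3} \<times> {..<3}" for x using that assms(3) by auto
qed (use assms in \<open>simp_all add: mat_monoid_def\<close>)

lemma vec_eqI:
  assumes "v \<in> V3" "w \<in> V3" "\<And>i. i < 3 \<Longrightarrow> v i = w i"
  shows "v = w"
  by (rule PiE_ext[of _ "{..<3}" "\<lambda>_. carrier R"]) (use assms in \<open>simp_all add: vec_space_def\<close>)

lemma mult_apply:
  assumes "A \<in> carrier M3" "B \<in> carrier M3" "i < 3" "j < 3"
  shows "(A \<otimes>\<^bsub>M3\<^esub> B) (i, j) = A (i, 0) \<otimes> B (0, j) \<oplus> A (i, 1) \<otimes> B (1, j) \<oplus> A (i, 2) \<otimes> B (2, j)"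
proof -
  have "(A \<otimes>\<^bsub>M3\<^esub> B) (i, j) = (\<Oplus>k\<in>{..<3}. A (i, k) \<otimes> B (k, j))"
    using assms(3,4) by (simp add: mat_monoid_def)
  also have "\<dots> = A (i, 0) \<otimes> B (0, j) \<oplus> A (i, 1) \<otimes> B (1, j) \<oplus> A (i, 2) \<otimes> B (2, j)"
    using assms by (intro finsum3) (simp_all add: mat_closed)
  finally show ?thesis .
qed

lemma mult_closed:
  assumes "A \<in> carrier M3" "B \<in> carrier M3"
  shows "A \<otimes>\<^bsub>M3\<^esub> B \<in> carrier M3"
proof -
  have "(\<Oplus>k\<in>{..<3}. A (i, k) \<otimes> B (k, j)) \<in> carrier R" if "i < 3" "j < 3" for i j
    using that assms by (intro finsum_closed) (auto simp: mat_closed)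
  then show ?thesis by (auto simp: mat_monoid_def)
qed

lemma scalar_apply: "i < 3 \<Longrightarrow> j < 3 \<Longrightarrow> scalar_mat 3 R c (i, j) = (if i = j then c else \<zero>)"
  by (simp add: scalar_mat_def)

lemma scalar_closed: "c \<in> carrier R \<Longrightarrow> scalar_mat 3 R c \<in> carrier M3"
  by (auto simp: scalar_mat_def mat_monoid_def)

lemma scalar_mult:
  assumes "c \<in> carrier R" "A \<in> carrier M3"
  shows "scalar_mat 3 R c \<otimes>\<^bsub>M3\<^esub> A = A \<otimes>\<^bsub>M3\<^esub> scalar_mat 3 R c"
  using assms
  by (intro mat_eqI) (auto simp: mult_closed scalar_closed mult_apply scalar_apply less3 mat_closed m_comm)

lemma scalar_scalar:
  assumes "c \<in> carrier R" "d \<in> carrier R"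
  shows "scalar_mat 3 R c \<otimes>\<^bsub>M3\<^esub> scalar_mat 3 R d = scalar_mat 3 R (c \<otimes> d)"
  using assms
  by (intro mat_eqI) (auto simp: mult_closed scalar_closed mult_apply scalar_apply less3)

lemma one_M3: "\<one>\<^bsub>M3\<^esub> = scalar_mat 3 R \<one>"
  by (simp add: mat_monoid_def)

lemma monoid_M3: "monoid M3"
proof (rule monoidI)
  fix A B C assume ABC: "A \<in> carrier M3" "B \<in> carrier M3" "C \<in> carrier M3"
  show "A \<otimes>\<^bsub>M3\<^esub> B \<otimes>\<^bsub>M3\<^esub> C = A \<otimes>\<^bsub>M3\<^esub> (B \<otimes>\<^bsub>M3\<^esub> C)"
  proof (rule mat_eqI)
    fix i j :: nat assume ij: "i < 3" "j < 3"
    note cl = mat_closed[OF ABC(1) ij(1)] mat_closed[OF ABC(2)] mat_closed[OF ABC(3) _ ij(2)]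
    show "(A \<otimes>\<^bsub>M3\<^esub> B \<otimes>\<^bsub>M3\<^esub> C) (i, j) = (A \<otimes>\<^bsub>M3\<^esub> (B \<otimes>\<^bsub>M3\<^esub> C)) (i, j)"
      using ABC ij
      by (simp add: mult_apply mult_closed cl l_distr r_distr m_assoc a_ac)
  qed (use ABC in \<open>simp_all add: mult_closed\<close>)
next
  fix A assume A: "A \<in> carrier M3"
  show "\<one>\<^bsub>M3\<^esub> \<otimes>\<^bsub>M3\<^esub> A = A" "A \<otimes>\<^bsub>M3\<^esub> \<one>\<^bsub>M3\<^esub> = A"
    unfolding one_M3 using A
    by (auto intro!: mat_eqI simp: mult_closed scalar_closed mult_apply scalar_apply less3 mat_closed)
qed (simp_all add: mult_closed one_M3 scalar_closed)

lemma smult_apply: "i < 3 \<Longrightarrow> vec_smult 3 R c v i = c \<otimes> v i"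
  by (simp add: vec_smult_def)

lemma add_apply: "i < 3 \<Longrightarrow> vec_add 3 R v w i = v i \<oplus> w i"
  by (simp add: vec_add_def)

lemma zero_apply: "i < 3 \<Longrightarrow> vec_zero 3 R i = \<zero>"
  by (simp add: vec_zero_def)

lemma vec_ops_closed:
  "c \<in> carrier R \<Longrightarrow> v \<in> V3 \<Longrightarrow> vec_smult 3 R c v \<in> V3"
  "v \<in> V3 \<Longrightarrow> w \<in> V3 \<Longrightarrow> vec_add 3 R v w \<in> V3"
  "vec_zero 3 R \<in> V3"
  by (auto simp: vec_space_def vec_smult_def vec_add_def vec_zero_def)

lemma mat_vec_apply:
  assumes "A \<in> carrier M3" "v \<in> V3" "i < 3"
  shows "mat_vec 3 R A v i = A (i, 0) \<otimes> v 0 \<oplus> A (i, 1) \<otimes> v 1 \<oplus> A (i, 2) \<otimes> v 2"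
proof -
  have "mat_vec 3 R A v i = (\<Oplus>k\<in>{..<3}. A (i, k) \<otimes> v k)"
    using assms(3) by (simp add: mat_vec_def)
  also have "\<dots> = A (i, 0) \<otimes> v 0 \<oplus> A (i, 1) \<otimes> v 1 \<oplus> A (i, 2) \<otimes> v 2"
    using assms by (intro finsum3) (simp_all add: mat_closed vec_closed)
  finally show ?thesis .
qed

lemma mat_vec_closed:
  assumes "A \<in> carrier M3" "v \<in> V3"
  shows "mat_vec 3 R A v \<in> V3"
proof -
  have "(\<Oplus>k\<in>{..<3}. A (i, k) \<otimes> v k) \<in> carrier R" if "i < 3" for i
    using that assms by (intro finsum_closed) (auto simp: mat_closed vec_closed)
  then show ?thesis by (auto simp: mat_vec_def vec_space_def)
qed

lemma mat_vec_mult: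
  assumes "A \<in> carrier M3" "B \<in> carrier M3" "v \<in> V3"
  shows "mat_vec 3 R (A \<otimes>\<^bsub>M3\<^esub> B) v = mat_vec 3 R A (mat_vec 3 R B v)"
proof (rule vec_eqI)
  fix i :: nat assume i: "i < 3"
  note cl = mat_closed[OF assms(1) i] mat_closed[OF assms(2)] vec_closed[OF assms(3)]
  show "mat_vec 3 R (A \<otimes>\<^bsub>M3\<^esub> B) v i = mat_vec 3 R A (mat_vec 3 R B v) i"
    using assms i
    by (simp add: mult_apply mult_closed mat_vec_apply mat_vec_closed cl l_distr r_distr m_assoc a_ac)
qed (use assms in \<open>simp_all add: mult_closed mat_vec_closed\<close>)

lemma mat_vec_scalar:
  assumes "c \<in> carrier R" "v \<in> V3"
  shows "mat_vec 3 R (scalar_mat 3 R c) v = vec_smult 3 R c v"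
  using assms
  by (intro vec_eqI)
     (auto simp: vec_ops_closed mat_vec_closed scalar_closed mat_vec_apply scalar_apply smult_apply less3 vec_closed)

lemma vec_smult_one: "v \<in> V3 \<Longrightarrow> vec_smult 3 R \<one> v = v"
  by (intro vec_eqI) (auto simp: vec_ops_closed smult_apply vec_closed)

lemma vec_smult_smult:
  "c \<in> carrier R \<Longrightarrow> d \<in> carrier R \<Longrightarrow> v \<in> V3 \<Longrightarrow>
    vec_smult 3 R c (vec_smult 3 R d v) = vec_smult 3 R (c \<otimes> d) v"
  by (intro vec_eqI) (auto simp: vec_ops_closed smult_apply vec_closed m_assoc)

lemma mat_vec_smult:
  assumes "A \<in> carrier M3" "c \<in> carrier R" "v \<in> V3"
  shows "mat_vec 3 R A (vec_smult 3 R c v) = vec_smult 3 R c (mat_vec 3 R A v)"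
  using mat_vec_mult[OF assms(1) scalar_closed[OF assms(2)] assms(3)]
    mat_vec_mult[OF scalar_closed[OF assms(2)] assms(1,3)] assms
  by (simp add: mat_vec_scalar mat_vec_closed scalar_mult)

lemma mat_vec_add:
  assumes "A \<in> carrier M3" "v \<in> V3" "w \<in> V3"
  shows "mat_vec 3 R A (vec_add 3 R v w) = vec_add 3 R (mat_vec 3 R A v) (mat_vec 3 R A w)"
proof (rule vec_eqI)
  fix i :: nat assume i: "i < 3"
  note cl = mat_closed[OF assms(1) i] vec_closed[OF assms(2)] vec_closed[OF assms(3)]
  show "mat_vec 3 R A (vec_add 3 R v w) i = vec_add 3 R (mat_vec 3 R A v) (mat_vec 3 R A w) i"
    using assms i
    by (simp add: mat_vec_apply vec_ops_closed mat_vec_closed add_apply cl r_distr a_ac)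
qed (use assms in \<open>simp_all add: vec_ops_closed mat_vec_closed\<close>)

lemma mat_vec_zero:
  assumes "A \<in> carrier M3"
  shows "mat_vec 3 R A (vec_zero 3 R) = vec_zero 3 R"
  using assms
  by (intro vec_eqI) (auto simp: vec_ops_closed mat_vec_closed mat_vec_apply zero_apply mat_closed)

section \<open>The groups GL and PGL\<close>

abbreviation "GL3 \<equiv> GL 3 R"
abbreviation "scalars \<equiv> scalar_mat 3 R ` Units R"
abbreviation "PGL3 \<equiv> PGL 3 R"

lemma GL_simps: "carrier GL3 = Units M3" "A \<otimes>\<^bsub>GL3\<^esub> B = A \<otimes>\<^bsub>M3\<^esub> B" "\<one>\<^bsub>GL3\<^esub> = \<one>\<^bsub>M3\<^esub>"
  by (simp_all add: GL_def units_of_def)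

lemma group_GL: "group GL3"
  unfolding GL_def by (rule monoid.units_group[OF monoid_M3])

lemma scalar_Units: "c \<in> Units R \<Longrightarrow> scalar_mat 3 R c \<in> Units M3"
  unfolding Units_def[of M3]
  by (auto simp: scalar_closed scalar_scalar one_M3 Units_closed intro!: bexI[of _ "scalar_mat 3 R (inv c)"])

lemma Units_M3_closed: "A \<in> Units M3 \<Longrightarrow> A \<in> carrier M3"
  by (simp add: Units_def)

lemma scalars_normal: "scalars \<lhd> GL3"
proof -
  interpret GL: group GL3 by (rule group_GL)
  have inv: "inv\<^bsub>GL3\<^esub> (scalar_mat 3 R c) = scalar_mat 3 R (inv c)" if "c \<in> Units R" for c
    using that
    by (intro GL.inv_equality) (auto simp: GL_simps scalar_Units scalar_scalar one_M3 Units_closed)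
  have "subgroup scalars GL3"
    using inv
    by (intro GL.subgroupI) (auto simp: GL_simps scalar_Units scalar_scalar Units_closed)
  moreover have "A \<otimes>\<^bsub>GL3\<^esub> s \<otimes>\<^bsub>GL3\<^esub> inv\<^bsub>GL3\<^esub> A = s" if "A \<in> carrier GL3" "s \<in> scalars" for A s
  proof -
    have s: "s \<in> carrier GL3" using that scalar_Units by (auto simp: GL_simps)
    have "A \<otimes>\<^bsub>GL3\<^esub> s = s \<otimes>\<^bsub>GL3\<^esub> A"
      using that by (auto simp: GL_simps scalar_mult Units_closed Units_M3_closed)
    then show ?thesis using that s by (simp add: GL.m_assoc)
  qed
  ultimately show ?thesis by (simp add: GL.normal_inv_iff)
qed

lemma group_PGL: "group PGL3"
  unfolding PGL_def by (rule normal.factorgroup_is_group[OF scalars_normal])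

definition pcls :: "(nat \<times> nat \<Rightarrow> 'a) \<Rightarrow> (nat \<times> nat \<Rightarrow> 'a) set" where
  "pcls A = scalars #>\<^bsub>GL3\<^esub> A"

lemma pcls: "carrier PGL3 = pcls ` Units M3"
  by (auto simp: PGL_def FactGroup_def RCOSETS_def pcls_def GL_simps)

lemma pcls_mult: "A \<in> Units M3 \<Longrightarrow> B \<in> Units M3 \<Longrightarrow> pcls A \<otimes>\<^bsub>PGL3\<^esub> pcls B = pcls (A \<otimes>\<^bsub>M3\<^esub> B)"
  using normal.rcos_sum[OF scalars_normal, of A B]
  by (simp add: PGL_def FactGroup_def pcls_def GL_simps)

lemma pcls_one: "pcls \<one>\<^bsub>M3\<^esub> = \<one>\<^bsub>PGL3\<^esub>"
proof -
  interpret GL: group GL3 by (rule group_GL)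
  have "scalars \<subseteq> carrier GL3" using normal_imp_subgroup[OF scalars_normal] subgroup.subset by blast
  then show ?thesis using GL.coset_mult_one by (simp add: PGL_def FactGroup_def pcls_def GL_simps)
qed

lemma pcls_mem: "B \<in> pcls A \<longleftrightarrow> (\<exists>c\<in>Units R. B = scalar_mat 3 R c \<otimes>\<^bsub>M3\<^esub> A)"
  by (auto simp: pcls_def r_coset_def GL_simps)

section \<open>The action on points and lines\<close>

lemma M3_Units_inv:
  assumes "A \<in> Units M3"
  obtains B where "B \<in> Units M3" "B \<otimes>\<^bsub>M3\<^esub> A = \<one>\<^bsub>M3\<^esub>" "A \<otimes>\<^bsub>M3\<^esub> B = \<one>\<^bsub>M3\<^esub>"
  using assms monoid.Units_inv_Units[OF monoid_M3] monoid.Units_l_inv[OF monoid_M3]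
    monoid.Units_r_inv[OF monoid_M3] by blast

text \<open>What points and lines have in common: on such sets the matrices of one class in PGL,
  which differ by unit scalars, act alike.\<close>

definition scalar_closed_set :: "(nat \<Rightarrow> 'a) set \<Rightarrow> bool" where
  "scalar_closed_set W \<longleftrightarrow> W \<subseteq> V3 \<and> (\<forall>c\<in>carrier R. \<forall>w\<in>W. vec_smult 3 R c w \<in> W)"

lemma pcls_act:
  assumes A: "A \<in> Units M3" and W: "scalar_closed_set W"
  shows "{mat_vec 3 R B w | B w. B \<in> pcls A \<and> w \<in> W} = mat_vec 3 R A ` W"
proof (intro subset_antisym subsetI)
  fix x assume "x \<in> {mat_vec 3 R B w | B w. B \<in> pcls A \<and> w \<in> W}"
  then obtain c w where cw: "c \<in> Units R" "w \<in> W" "x = mat_vec 3 R (scalar_mat 3 R c \<otimes>\<^bsub>M3\<^esub> A) w"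
    by (auto simp: pcls_mem)
  have w: "w \<in> V3" using cw W by (auto simp: scalar_closed_set_def)
  have "x = mat_vec 3 R A (vec_smult 3 R c w)"
    using cw w A by (simp add: mat_vec_mult mat_vec_scalar mat_vec_closed mat_vec_smult
        scalar_closed Units_closed Units_M3_closed)
  moreover have "vec_smult 3 R c w \<in> W" using cw W by (auto simp: scalar_closed_set_def)
  ultimately show "x \<in> mat_vec 3 R A ` W" by blast
next
  fix x assume "x \<in> mat_vec 3 R A ` W"
  then obtain w where w: "w \<in> W" "x = mat_vec 3 R A w" by blast
  have "A \<in> pcls A"
    unfolding pcls_mem using A monoid.l_one[OF monoid_M3]
    by (intro bexI[of _ \<one>]) (auto simp: one_M3[symmetric] Units_M3_closed)
  then show "x \<in> {mat_vec 3 R B w | B w. B \<in> pcls A \<and> w \<in> W}" using w by blast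
qed

lemma finite_proj_biset:
  assumes fin: "finite Y" and Y: "\<And>W. W \<in> Y \<Longrightarrow> scalar_closed_set W"
    and inv: "\<And>A W. A \<in> Units M3 \<Longrightarrow> W \<in> Y \<Longrightarrow> mat_vec 3 R A ` W \<in> Y"
  shows "finite_biset PGL3 unit_group (proj_biset R Y)"
proof -
  have l: "lact (proj_biset R Y) (pcls A) W = mat_vec 3 R A ` W" if "A \<in> Units M3" "W \<in> Y" for A W
    using pcls_act[OF that(1) Y[OF that(2)]] by (simp add: proj_biset_def)
  have o: "mat_vec 3 R \<one>\<^bsub>M3\<^esub> ` W = W" if "W \<in> Y" for W
  proof -
    have "mat_vec 3 R \<one>\<^bsub>M3\<^esub> w = w" if "w \<in> W" for w
      using that Y[OF \<open>W \<in> Y\<close>] by (auto simp: scalar_closed_set_def one_M3 mat_vec_scalar vec_smult_one)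
    then show ?thesis by simp
  qed
  have m: "mat_vec 3 R (A \<otimes>\<^bsub>M3\<^esub> B) ` W = mat_vec 3 R A ` mat_vec 3 R B ` W"
    if "A \<in> Units M3" "B \<in> Units M3" "W \<in> Y" for A B W
  proof -
    have "W \<subseteq> V3" using Y that by (simp add: scalar_closed_set_def)
    then show ?thesis
      unfolding image_image using that by (intro image_cong) (auto simp: mat_vec_mult Units_M3_closed)
  qed
  have sel: "bset (proj_biset R Y) = Y" "ract (proj_biset R Y) W u = W" for W u
    by (simp_all add: proj_biset_def)
  have U: "\<one>\<^bsub>M3\<^esub> \<in> Units M3" "A \<in> Units M3 \<Longrightarrow> B \<in> Units M3 \<Longrightarrow> A \<otimes>\<^bsub>M3\<^esub> B \<in> Units M3" for A B
    using monoid.Units_one_closed[OF monoid_M3] monoid.Units_m_closed[OF monoid_M3] by auto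
  show ?thesis
    unfolding finite_biset_def sel pcls pcls_one[symmetric]
    using fin inv by (auto simp: l o m U pcls_mult)
qed

lemma points_scalar_closed: "W \<in> proj_points R \<Longrightarrow> scalar_closed_set W"
  by (force simp: proj_points_def scalar_closed_set_def vec_ops_closed vec_smult_smult)

lemma vec_smult_lincomb:
  assumes "c \<in> carrier R" "a \<in> carrier R" "b \<in> carrier R" "v \<in> V3" "w \<in> V3"
  shows "vec_smult 3 R c (vec_add 3 R (vec_smult 3 R a v) (vec_smult 3 R b w))
    = vec_add 3 R (vec_smult 3 R (c \<otimes> a) v) (vec_smult 3 R (c \<otimes> b) w)"
  using assms
  by (intro vec_eqI) (simp_all add: vec_ops_closed smult_apply add_apply vec_closed r_distr m_assoc)

lemma lines_scalar_closed: "W \<in> proj_lines R \<Longrightarrow> scalar_closed_set W"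
  unfolding proj_lines_def scalar_closed_set_def
  by (auto simp: vec_ops_closed vec_smult_lincomb) (metis m_closed)

lemma points_image:
  assumes A: "A \<in> Units M3" and W: "W \<in> proj_points R"
  shows "mat_vec 3 R A ` W \<in> proj_points R"
proof -
  obtain v where v: "v \<in> V3" "v \<noteq> vec_zero 3 R" "W = {vec_smult 3 R c v | c. c \<in> carrier R}"
    using W by (auto simp: proj_points_def)
  note A' = Units_M3_closed[OF A]
  obtain B where B: "B \<in> Units M3" "B \<otimes>\<^bsub>M3\<^esub> A = \<one>\<^bsub>M3\<^esub>" using M3_Units_inv[OF A] .
  have "mat_vec 3 R B (mat_vec 3 R A v) = v"
    using mat_vec_mult[OF Units_M3_closed[OF B(1)] A' v(1)] B(2) v(1)
    by (simp add: one_M3 mat_vec_scalar vec_smult_one)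
  then have "mat_vec 3 R A v \<noteq> vec_zero 3 R"
    using v(2) mat_vec_zero[OF Units_M3_closed[OF B(1)]] by metis
  moreover have "mat_vec 3 R A ` W = {vec_smult 3 R c (mat_vec 3 R A v) | c. c \<in> carrier R}"
    unfolding v(3) using v(1) A' by (force simp: mat_vec_smult image_iff)
  ultimately show ?thesis using v(1) A' mat_vec_closed unfolding proj_points_def by blast
qed

lemma lines_image:
  assumes A: "A \<in> Units M3" and W: "W \<in> proj_lines R"
  shows "mat_vec 3 R A ` W \<in> proj_lines R"
proof -
  let ?lc = "\<lambda>v w a b. vec_add 3 R (vec_smult 3 R a v) (vec_smult 3 R b w)"
  obtain v w where vw: "v \<in> V3" "w \<in> V3" "W = {?lc v w a b | a b. a \<in> carrier R \<and> b \<in> carrier R}"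
    "\<And>a b. a \<in> carrier R \<Longrightarrow> b \<in> carrier R \<Longrightarrow> ?lc v w a b = vec_zero 3 R \<Longrightarrow> a = \<zero> \<and> b = \<zero>"
    using W unfolding proj_lines_def by blast
  note A' = Units_M3_closed[OF A]
  obtain B where B: "B \<in> Units M3" "B \<otimes>\<^bsub>M3\<^esub> A = \<one>\<^bsub>M3\<^esub>" using M3_Units_inv[OF A] .
  have BA: "mat_vec 3 R B (mat_vec 3 R A x) = x" if "x \<in> V3" for x
    using mat_vec_mult[OF Units_M3_closed[OF B(1)] A' that] B(2) that
    by (simp add: one_M3 mat_vec_scalar vec_smult_one)
  let ?v = "mat_vec 3 R A v" and ?w = "mat_vec 3 R A w"
  have lc: "mat_vec 3 R A (?lc v w a b) = ?lc ?v ?w a b" if "a \<in> carrier R" "b \<in> carrier R" for a b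
    using that vw(1,2) A' by (simp add: mat_vec_add mat_vec_smult vec_ops_closed)
  \<comment> \<open>The inverse matrix carries a linear relation between the images back to one
    between \<open>v\<close> and \<open>w\<close>.\<close>
  have ind: "a = \<zero> \<and> b = \<zero>" if "a \<in> carrier R" "b \<in> carrier R" "?lc ?v ?w a b = vec_zero 3 R" for a b
  proof -
    have "?lc v w a b \<in> V3" using that vw(1,2) by (simp add: vec_ops_closed)
    then have "?lc v w a b = vec_zero 3 R"
      using BA lc[OF that(1,2)] that(3) mat_vec_zero[OF Units_M3_closed[OF B(1)]] by metis
    then show ?thesis using vw(4) that by blast
  qed
  have "mat_vec 3 R A ` W = {?lc ?v ?w a b | a b. a \<in> carrier R \<and> b \<in> carrier R}"
  proof -
    have span: "{f a b | a b. a \<in> carrier R \<and> b \<in> carrier R} = (\<lambda>(a, b). f a b) ` (carrier R \<times> carrier R)"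
      for f :: "'a \<Rightarrow> 'a \<Rightarrow> nat \<Rightarrow> 'a" by auto
    show ?thesis
      unfolding vw(3) span image_image using lc by (intro image_cong) auto
  qed
  moreover have "?v \<in> V3" "?w \<in> V3" using vw(1,2) A' mat_vec_closed by auto
  ultimately show ?thesis using ind unfolding proj_lines_def by blast
qed

lemma finite_V3:
  assumes "finite (carrier R)"
  shows "finite V3" "finite (carrier M3)"
  using assms by (auto simp: vec_space_def mat_monoid_def intro!: finite_PiE)

lemma finite_biset_plane:
  assumes "finite (carrier R)"
  shows "finite_biset PGL3 unit_group (proj_biset R (proj_points R))"
    "finite_biset PGL3 unit_group (proj_biset R (proj_lines R))"
proof -
  have "proj_points R \<subseteq> Pow V3" "proj_lines R \<subseteq> Pow V3"
    using points_scalar_closed lines_scalar_closed by (auto simp: scalar_closed_set_def)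
  then have "finite (proj_points R)" "finite (proj_lines R)"
    using finite_V3(1)[OF assms] by (auto intro: finite_subset)
  then show "finite_biset PGL3 unit_group (proj_biset R (proj_points R))"
    "finite_biset PGL3 unit_group (proj_biset R (proj_lines R))"
    by (simp_all add: finite_proj_biset points_scalar_closed lines_scalar_closed points_image lines_image)
qed

text \<open>The matrix of the affine translation by (a, b), where the affine plane consists of the
  points with third coordinate 1.\<close>

definition translation :: "'a \<Rightarrow> 'a \<Rightarrow> nat \<times> nat \<Rightarrow> 'a" where
  "translation a b = (\<lambda>(i, j)\<in>{..<3} \<times> {..<3}. if i = j then \<one> else
     if (i, j) = (0, 2) then a else if (i, j) = (1, 2) then b else \<zero>)"

lemma translation_apply:
  "i < 3 \<Longrightarrow> j < 3 \<Longrightarrow> translation a b (i, j) = (if i = j then \<one> else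
     if (i, j) = (0, 2) then a else if (i, j) = (1, 2) then b else \<zero>)"
  by (simp add: translation_def)

lemma translation_closed: "a \<in> carrier R \<Longrightarrow> b \<in> carrier R \<Longrightarrow> translation a b \<in> carrier M3"
  by (auto simp: translation_def mat_monoid_def)

lemma translation_mult:
  assumes "a \<in> carrier R" "b \<in> carrier R" "c \<in> carrier R" "d \<in> carrier R"
  shows "translation a b \<otimes>\<^bsub>M3\<^esub> translation c d = translation (a \<oplus> c) (b \<oplus> d)"
proof (rule mat_eqI)
  fix i j :: nat assume ij: "i < 3" "j < 3"
  then show "(translation a b \<otimes>\<^bsub>M3\<^esub> translation c d) (i, j) = translation (a \<oplus> c) (b \<oplus> d) (i, j)"
    using assms by (auto simp: mult_apply translation_closed translation_apply less3 a_comm)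
qed (use assms in \<open>simp_all add: mult_closed translation_closed\<close>)

lemma translation_zero: "translation \<zero> \<zero> = \<one>\<^bsub>M3\<^esub>"
  unfolding one_M3
  by (rule mat_eqI) (auto simp: translation_closed scalar_closed translation_apply scalar_apply)

lemma translation_Units:
  assumes "a \<in> carrier R" "b \<in> carrier R"
  shows "translation a b \<in> Units M3"
  unfolding Units_def[of M3] using assms
  by (auto simp: translation_closed translation_mult translation_zero[symmetric] l_neg r_neg
      intro!: bexI[of _ "translation (\<ominus> a) (\<ominus> b)"])

lemma translation_vec:
  assumes "a \<in> carrier R" "b \<in> carrier R" "v \<in> V3"
  shows "mat_vec 3 R (translation a b) v 0 = v 0 \<oplus> a \<otimes> v 2"
    "mat_vec 3 R (translation a b) v 1 = v 1 \<oplus> b \<otimes> v 2"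
    "mat_vec 3 R (translation a b) v 2 = v 2"
  using assms by (simp_all add: mat_vec_apply translation_closed translation_apply vec_closed)

lemma lact_plane:
  assumes "A \<in> Units M3" "scalar_closed_set W"
  shows "lact (proj_biset R Y) (pcls A) W = mat_vec 3 R A ` W"
  using pcls_act[OF assms] by (simp add: proj_biset_def)

text \<open>A vector \<open>u\<close> at infinity, that is with third coordinate 0, defines the
  translation x \<mapsto> x + x_2 u. Hence a subspace containing \<open>u\<close> is mapped into
  itself.\<close>

lemma translation_fixes_mem:
  assumes "u \<in> V3" "u 2 = \<zero>" "x \<in> V3"
  shows "mat_vec 3 R (translation (u 0) (u 1)) x = vec_add 3 R x (vec_smult 3 R (x 2) u)"
proof (rule vec_eqI)
  have t: "translation (u 0) (u 1) \<in> carrier M3" using assms by (simp add: translation_closed vec_closed)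
  show "mat_vec 3 R (translation (u 0) (u 1)) x \<in> V3" using t assms(3) by (rule mat_vec_closed)
  show "vec_add 3 R x (vec_smult 3 R (x 2) u) \<in> V3" using assms by (simp add: vec_ops_closed vec_closed)
  have cl: "u 0 \<in> carrier R" "u 1 \<in> carrier R" "x 0 \<in> carrier R" "x 1 \<in> carrier R" "x 2 \<in> carrier R"
    using assms by (simp_all add: vec_closed)
  show "mat_vec 3 R (translation (u 0) (u 1)) x i = vec_add 3 R x (vec_smult 3 R (x 2) u) i" if "i < 3" for i
    using that cl assms(2) translation_vec[OF cl(1,2) assms(3)]
    by (auto simp: less3 add_apply smult_apply m_comm)
qed

text \<open>Every line meets the line at infinity, and is fixed by the translations in the direction of the
  intersection point.\<close>

lemma line_fixed_by_translation:
  assumes fin: "finite (carrier R)" and nontriv: "\<one> \<noteq> \<zero>" and W: "W \<in> proj_lines R"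
  obtains a b where "a \<in> carrier R" "b \<in> carrier R" "\<not> (a = \<zero> \<and> b = \<zero>)"
    "mat_vec 3 R (translation a b) ` W = W"
proof -
  let ?lc = "\<lambda>v w a b. vec_add 3 R (vec_smult 3 R a v) (vec_smult 3 R b w)"
  obtain v w where vw: "v \<in> V3" "w \<in> V3" "W = {?lc v w a b | a b. a \<in> carrier R \<and> b \<in> carrier R}"
    "\<And>a b. a \<in> carrier R \<Longrightarrow> b \<in> carrier R \<Longrightarrow> ?lc v w a b = vec_zero 3 R \<Longrightarrow> a = \<zero> \<and> b = \<zero>"
    using W unfolding proj_lines_def by blast
  have c2: "v 2 \<in> carrier R" "w 2 \<in> carrier R" using vw(1,2) by (simp_all add: vec_closed)
  \<comment> \<open>Coefficients of a nonzero vector of the line with third coordinate 0: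
    \<open>v\<close> itself if it is one, and otherwise w_2 v - v_2 w, whose second coefficient is
    nonzero.\<close>
  define \<alpha> \<beta> where "\<alpha> = (if v 2 = \<zero> then \<one> else w 2)" and "\<beta> = (if v 2 = \<zero> then \<zero> else \<ominus> v 2)"
  have ab: "\<alpha> \<in> carrier R" "\<beta> \<in> carrier R" using c2 by (auto simp: \<alpha>_def \<beta>_def)
  define u where "u = ?lc v w \<alpha> \<beta>"
  have uV: "u \<in> V3" unfolding u_def using ab vw by (simp add: vec_ops_closed)
  have "w 2 \<otimes> v 2 \<oplus> \<ominus> v 2 \<otimes> w 2 = \<zero>"
    using c2 m_comm[of "w 2" "v 2"] by (simp add: l_minus r_neg)
  then have u2: "u 2 = \<zero>"
    unfolding u_def \<alpha>_def \<beta>_def using c2 by (simp add: add_apply smult_apply)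
  have nz: "u \<noteq> vec_zero 3 R"
  proof
    assume "u = vec_zero 3 R"
    then have "\<alpha> = \<zero> \<and> \<beta> = \<zero>" using vw(4)[OF ab] by (simp add: u_def)
    then show False using nontriv c2 by (auto simp: \<alpha>_def \<beta>_def split: if_splits)
  qed
  have uW: "u \<in> W" unfolding vw(3) u_def using ab by blast
  have WV: "W \<subseteq> V3" using lines_scalar_closed[OF W] by (simp add: scalar_closed_set_def)
  have add: "vec_add 3 R x (vec_smult 3 R c y) \<in> W" if "x \<in> W" "y \<in> W" "c \<in> carrier R" for x y c
  proof -
    obtain a b a' b' where x: "x = ?lc v w a b" "a \<in> carrier R" "b \<in> carrier R"
      and y: "y = ?lc v w a' b'" "a' \<in> carrier R" "b' \<in> carrier R"
      using \<open>x \<in> W\<close> \<open>y \<in> W\<close> unfolding vw(3) by blast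
    have "vec_add 3 R x (vec_smult 3 R c y) = ?lc v w (a \<oplus> c \<otimes> a') (b \<oplus> c \<otimes> b')"
      unfolding x(1) y(1)
    proof (rule vec_eqI)
      fix i :: nat assume i: "i < 3"
      show "vec_add 3 R (?lc v w a b) (vec_smult 3 R c (?lc v w a' b')) i
          = ?lc v w (a \<oplus> c \<otimes> a') (b \<oplus> c \<otimes> b') i"
        using i x(2,3) y(2,3) that(3) vec_closed[OF vw(1) i] vec_closed[OF vw(2) i]
        by (simp add: add_apply smult_apply l_distr r_distr m_assoc a_ac)
    qed (use x(2,3) y(2,3) that(3) vw(1,2) in \<open>simp_all add: vec_ops_closed\<close>)
    then show ?thesis unfolding vw(3) using x(2,3) y(2,3) that(3) by blast
  qed
  let ?T = "translation (u 0) (u 1)"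
  have cl: "u 0 \<in> carrier R" "u 1 \<in> carrier R" using uV by (simp_all add: vec_closed)
  have sub: "mat_vec 3 R ?T ` W \<subseteq> W"
  proof
    fix y assume "y \<in> mat_vec 3 R ?T ` W"
    then obtain x where x: "x \<in> W" "y = mat_vec 3 R ?T x" by blast
    have xV: "x \<in> V3" using x(1) WV by blast
    show "y \<in> W"
      unfolding x(2) translation_fixes_mem[OF uV u2 xV] using xV by (intro add x(1) uW vec_closed) simp_all
  qed
  obtain B where B: "B \<in> Units M3" "B \<otimes>\<^bsub>M3\<^esub> ?T = \<one>\<^bsub>M3\<^esub>"
    using M3_Units_inv[OF translation_Units[OF cl]] .
  have "mat_vec 3 R B (mat_vec 3 R ?T x) = x" if "x \<in> W" for x
    using mat_vec_mult[OF Units_M3_closed[OF B(1)] translation_closed[OF cl], of x] B(2) that WV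
    by (auto simp: one_M3 mat_vec_scalar vec_smult_one subset_iff)
  \<comment> \<open>So far there is only an inclusion; as \<open>W\<close> is finite and the
    translation injective, it is an equality.\<close>
  then have "inj_on (mat_vec 3 R ?T) W" by (metis inj_onI)
  moreover have "finite W" using WV finite_V3(1)[OF fin] by (rule finite_subset)
  ultimately have "mat_vec 3 R ?T ` W = W" using sub by (metis endo_inj_surj)
  moreover have "\<not> (u 0 = \<zero> \<and> u 1 = \<zero>)"
  proof
    assume "u 0 = \<zero> \<and> u 1 = \<zero>"
    then have "u = vec_zero 3 R"
      using uV u2 by (intro vec_eqI) (auto simp: vec_ops_closed less3 zero_apply)
    then show False using nz by simp
  qed
  ultimately show thesis using that cl by blast
qed

definition origin_vec :: "nat \<Rightarrow> 'a" where
  "origin_vec = (\<lambda>i\<in>{..<3}. if i = 2 then \<one> else \<zero>)"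

text \<open>The point (0 : 0 : 1), whose orbit under the translations is the affine plane.\<close>

definition origin :: "(nat \<Rightarrow> 'a) set" where
  "origin = {vec_smult 3 R c origin_vec | c. c \<in> carrier R}"

lemma origin_vec: "origin_vec \<in> V3" "origin_vec 0 = \<zero>" "origin_vec 1 = \<zero>" "origin_vec 2 = \<one>"
  by (auto simp: origin_vec_def vec_space_def)

lemma origin_point:
  assumes "\<one> \<noteq> \<zero>"
  shows "origin \<in> proj_points R"
proof -
  have "origin_vec \<noteq> vec_zero 3 R" using origin_vec(4) zero_apply[of 2] assms by auto
  then show ?thesis unfolding proj_points_def origin_def using origin_vec(1) by blast
qed

lemma translation_fixes_origin:
  assumes "a \<in> carrier R" "b \<in> carrier R" "mat_vec 3 R (translation a b) ` origin = origin"
  shows "a = \<zero> \<and> b = \<zero>"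
proof -
  have "origin_vec \<in> origin"
    unfolding origin_def using vec_smult_one[OF origin_vec(1)] one_closed by force
  then have "mat_vec 3 R (translation a b) origin_vec \<in> origin" using assms(3) by blast
  then obtain c where c: "c \<in> carrier R"
    "mat_vec 3 R (translation a b) origin_vec = vec_smult 3 R c origin_vec"
    unfolding origin_def by blast
  have "mat_vec 3 R (translation a b) origin_vec i = vec_smult 3 R c origin_vec i" for i
    using c(2) by simp
  \<comment> \<open>In the first two coordinates the left sides are \<open>a\<close> and
    \<open>b\<close>, while the right sides are 0.\<close>
  from this[of 0] this[of 1] show ?thesis
    using translation_vec[OF assms(1,2) origin_vec(1)] assms(1,2) c(1) origin_vec
    by (simp add: smult_apply)
qed

end

text \<open>A point at infinity, with v_2 = 0, is fixed by every translation. For any other point,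
  division by v_2 exhibits it as a translate of the origin; this is where a field is used.\<close>

lemma (in field) point_cases:
  assumes W: "W \<in> proj_points R"
  obtains "\<And>a b. a \<in> carrier R \<Longrightarrow> b \<in> carrier R \<Longrightarrow> mat_vec 3 R (translation a b) ` W = W"
  | a b where "a \<in> carrier R" "b \<in> carrier R" "W = mat_vec 3 R (translation a b) ` origin"
proof -
  obtain v where v: "v \<in> V3" "v \<noteq> vec_zero 3 R" "W = {vec_smult 3 R c v | c. c \<in> carrier R}"
    using W by (auto simp: proj_points_def)
  have v2: "v 2 \<in> carrier R" "v 0 \<in> carrier R" "v 1 \<in> carrier R" using v(1) by (simp_all add: vec_closed)
  show thesis
  proof (cases "v 2 = \<zero>")
    case True
    have "mat_vec 3 R (translation a b) x = x"
      if ab: "a \<in> carrier R" "b \<in> carrier R" and x: "x \<in> W" for a b x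
    proof -
      obtain c where c: "c \<in> carrier R" "x = vec_smult 3 R c v" using x v(3) by blast
      have xV: "x \<in> V3" using c v(1) by (simp add: vec_ops_closed)
      have x2: "x 2 = \<zero>" using c True by (simp add: smult_apply)
      show ?thesis
        using xV ab x2 translation_vec[OF ab xV]
        by (intro vec_eqI) (auto simp: less3 mat_vec_closed translation_closed vec_closed)
    qed
    then show thesis using that(1) by force
  next
    case False
    then have unit: "v 2 \<in> Units R" using v2 field_Units by auto
    let ?c = "inv (v 2)"
    have c: "?c \<in> carrier R" "?c \<otimes> v 2 = \<one>" "v 2 \<otimes> ?c = \<one>" using unit by simp_all
    let ?a = "?c \<otimes> v 0" and ?b = "?c \<otimes> v 1"
    have ab: "?a \<in> carrier R" "?b \<in> carrier R" using c v2 by auto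
    have T: "mat_vec 3 R (translation ?a ?b) origin_vec = vec_smult 3 R ?c v"
      using translation_vec[OF ab origin_vec(1)] ab c v2 v(1) origin_vec
      by (intro vec_eqI) (auto simp: less3 mat_vec_closed translation_closed vec_ops_closed smult_apply)
    have img: "mat_vec 3 R (translation ?a ?b) (vec_smult 3 R d origin_vec) = vec_smult 3 R (d \<otimes> ?c) v"
      if "d \<in> carrier R" for d
      unfolding mat_vec_smult[OF translation_closed[OF ab] that origin_vec(1)] T
      using that c v(1) by (simp add: vec_smult_smult)
    have "mat_vec 3 R (translation ?a ?b) ` origin = W"
    proof (intro subset_antisym subsetI)
      fix x assume "x \<in> mat_vec 3 R (translation ?a ?b) ` origin"
      then show "x \<in> W" unfolding origin_def v(3) using img c by auto
    next
      fix x assume "x \<in> W"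
      then obtain d where d: "d \<in> carrier R" "x = vec_smult 3 R d v" using v(3) by blast
      have "d \<otimes> v 2 \<otimes> ?c = d" using d c v2 by (simp add: m_assoc)
      then have "x = mat_vec 3 R (translation ?a ?b) (vec_smult 3 R (d \<otimes> v 2) origin_vec)"
        using img[of "d \<otimes> v 2"] d v2 by simp
      then show "x \<in> mat_vec 3 R (translation ?a ?b) ` origin"
        unfolding origin_def using d v2 by blast
    qed
    then show thesis using that(2)[OF ab] by simp
  qed
qed

section \<open>Translations in a Sylow subgroup\<close>

text \<open>Orbits of \<open>f\<close> have one or \<open>p\<close> elements.\<close>

lemma prime_dvd_card_nonfixed:
  assumes "prime p" and fin: "finite \<Omega>" and maps: "\<And>x. x \<in> \<Omega> \<Longrightarrow> f x \<in> \<Omega>"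
    and period: "\<And>x. x \<in> \<Omega> \<Longrightarrow> (f ^^ p) x = x"
  shows "p dvd card {x \<in> \<Omega>. f x \<noteq> x}"
proof -
  have p0: "p > 0" using \<open>prime p\<close> prime_gt_0_nat by simp
  define orb where "orb x = (\<lambda>k. (f ^^ k) x) ` {..<p}" for x
  have in\<Omega>: "(f ^^ k) x \<in> \<Omega>" if "x \<in> \<Omega>" for k x
    using that maps by (induction k) auto
  have mult: "(f ^^ (m * k)) x = x" if "x \<in> \<Omega>" "(f ^^ m) x = x" for m k x
    using that by (induction k) (simp_all add: funpow_add)
  have mod: "(f ^^ k) x = (f ^^ (k mod p)) x" if "x \<in> \<Omega>" for k x
  proof -
    have "(f ^^ k) x = (f ^^ (k mod p + p * (k div p))) x" by simp
    also have "\<dots> = (f ^^ (k mod p)) x"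
      unfolding funpow_add o_apply using mult[OF that period[OF that]] by simp
    finally show ?thesis .
  qed
  \<comment> \<open>As \<open>k\<close> is invertible modulo \<open>p\<close>, the map
    \<open>f\<close> acts on \<open>x\<close> as a power of its k-th iterate.\<close>
  have fixed: "f x = x" if x: "x \<in> \<Omega>" and k: "0 < k" "k < p" and "(f ^^ k) x = x" for x k
  proof -
    have "\<not> p dvd k" using k by (auto dest: dvd_imp_le)
    then have "coprime k p" using prime_imp_coprime[OF \<open>prime p\<close>] by (simp add: coprime_commute)
    then obtain s where "[k * s = 1] (mod p)" using cong_solve_coprime_nat[of k p] by auto
    then have s: "(k * s) mod p = 1 mod p" by (simp add: cong_def)
    have "x = (f ^^ (k * s)) x" using mult[OF x that(4)] by simp
    also have "\<dots> = (f ^^ 1) x" using mod[OF x, of "k * s"] mod[OF x, of 1] s by simp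
    finally show ?thesis by simp
  qed
  \<comment> \<open>Iterating p - i more times completes the period, so the i-th iterate is
    injective.\<close>
  have cancel: "x = y" if "x \<in> \<Omega>" "y \<in> \<Omega>" "(f ^^ i) x = (f ^^ i) y" "i \<le> p" for x y i
  proof -
    have "(f ^^ (p - i)) ((f ^^ i) x) = (f ^^ (p - i)) ((f ^^ i) y)" using that by simp
    then have "(f ^^ (p - i + i)) x = (f ^^ (p - i + i)) y" by (simp add: funpow_add)
    then show ?thesis using that period by simp
  qed
  have inj: "inj_on (\<lambda>k. (f ^^ k) x) {..<p}" if x: "x \<in> \<Omega>" "f x \<noteq> x" for x
  proof (rule linorder_inj_onI)
    fix i j assume ij: "i < j" "i \<in> {..<p}" "j \<in> {..<p}"
    show "(f ^^ i) x \<noteq> (f ^^ j) x"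
    proof
      assume "(f ^^ i) x = (f ^^ j) x"
      then have "(f ^^ i) x = (f ^^ i) ((f ^^ (j - i)) x)"
        using ij by (simp add: funpow_add[symmetric] flip: o_apply[of "f ^^ i"])
      then have "x = (f ^^ (j - i)) x"
        using cancel[OF x(1) in\<Omega>[OF x(1)]] ij by simp
      then show False using fixed[OF x(1), of "j - i"] ij x(2) by (simp add: less_imp_diff_less)
    qed
  qed auto
  have card: "card (orb x) = p" if "x \<in> \<Omega>" "f x \<noteq> x" for x
    unfolding orb_def using card_image[OF inj[OF that]] by simp
  have sub: "orb y \<subseteq> orb x" if xy: "x \<in> \<Omega>" "y \<in> orb x" for x y
  proof
    fix z assume "z \<in> orb y"
    then obtain k l where "z = (f ^^ k) y" "y = (f ^^ l) x" using xy(2) by (auto simp: orb_def)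
    then have "z = (f ^^ ((k + l) mod p)) x" using mod[OF xy(1), of "k + l"] by (simp add: funpow_add)
    then show "z \<in> orb x" using p0 by (auto simp: orb_def)
  qed
  have sym: "x \<in> orb y" if xy: "x \<in> \<Omega>" "y \<in> orb x" for x y
  proof -
    obtain l where l: "l < p" "y = (f ^^ l) x" using xy(2) by (auto simp: orb_def)
    then have "(f ^^ (p - l)) y = (f ^^ (p - l + l)) x" by (metis funpow_add o_apply)
    then have "x = (f ^^ ((p - l) mod p)) y"
      using l xy(1) period mod[of y "p - l"] in\<Omega> by simp
    then show ?thesis using p0 by (auto simp: orb_def)
  qed
  have nonfixed: "f y \<noteq> y" if "x \<in> \<Omega>" "f x \<noteq> x" "y \<in> orb x" for x y
  proof
    assume "f y = y"
    have "(f ^^ k) y = y" for k using \<open>f y = y\<close> by (induction k) auto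
    then have "orb y \<subseteq> {y}" by (auto simp: orb_def)
    then have "x = y" using sym[OF that(1,3)] by blast
    then show False using that(2) \<open>f y = y\<close> by simp
  qed
  let ?N = "{x \<in> \<Omega>. f x \<noteq> x}"
  have self: "x \<in> orb x" for x using p0 by (force simp: orb_def)
  have orb\<Omega>: "orb x \<subseteq> \<Omega>" if "x \<in> \<Omega>" for x using that in\<Omega> by (auto simp: orb_def)
  have U: "\<Union>(orb ` ?N) = ?N"
    using self orb\<Omega> nonfixed by blast
  have "p dvd card (\<Union>(orb ` ?N))"
  proof (rule dvd_partition)
    show "finite (\<Union>(orb ` ?N))" unfolding U using fin by simp
    show "\<forall>c\<in>orb ` ?N. p dvd card c" using card by auto
    show "\<forall>c1\<in>orb ` ?N. \<forall>c2\<in>orb ` ?N. c1 \<noteq> c2 \<longrightarrow> c1 \<inter> c2 = {}"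
    proof (intro ballI impI)
      fix c1 c2 assume "c1 \<in> orb ` ?N" "c2 \<in> orb ` ?N" "c1 \<noteq> c2"
      then obtain x y where xy: "x \<in> \<Omega>" "y \<in> \<Omega>" "c1 = orb x" "c2 = orb y" by auto
      show "c1 \<inter> c2 = {}"
      proof (rule ccontr)
        assume "c1 \<inter> c2 \<noteq> {}"
        then obtain z where z: "z \<in> orb x" "z \<in> orb y" using xy by auto
        have z\<Omega>: "z \<in> \<Omega>" using z orb\<Omega> xy by blast
        have "orb x = orb z" "orb y = orb z"
          using sub[OF xy(1) z(1)] sub[OF xy(2) z(2)] sub[OF z\<Omega> sym[OF xy(1) z(1)]]
            sub[OF z\<Omega> sym[OF xy(2) z(2)]] by auto
        then show False using \<open>c1 \<noteq> c2\<close> xy by simp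
      qed
    qed
  qed
  then show ?thesis unfolding U .
qed

text \<open>Stated so that it can be iterated: the fixed points of one map serve as the set on which
  a second, commuting map acts.\<close>

lemma fixed_point_mod_prime:
  assumes "prime p" and fin: "finite \<Omega>" and maps: "\<And>x. x \<in> \<Omega> \<Longrightarrow> f x \<in> \<Omega>"
    and period: "\<And>x. x \<in> \<Omega> \<Longrightarrow> (f ^^ p) x = x" and "\<not> p dvd card \<Omega>"
  shows "\<not> p dvd card {x \<in> \<Omega>. f x = x}"
proof -
  have "\<Omega> = {x \<in> \<Omega>. f x = x} \<union> {x \<in> \<Omega>. f x \<noteq> x}" by auto
  then have "card \<Omega> = card {x \<in> \<Omega>. f x = x} + card {x \<in> \<Omega>. f x \<noteq> x}"
    using fin by (metis (no_types, lifting) card_Un_disjoint disjoint_iff finite_Un mem_Collect_eq)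
  then show ?thesis
    using assms(5) prime_dvd_card_nonfixed[OF assms(1-4)] by (simp add: dvd_add_left_iff)
qed

text \<open>Right multiplication permutes the cosets of \<open>X\<close>, whose number is prime to
  \<open>p\<close>. The number of those fixed by \<open>a\<close> is then prime to \<open>p\<close>
  as well, and \<open>b\<close> fixes one of them. A coset X g fixed by both elements puts their
  conjugates by \<open>g\<close> into \<open>X\<close>.\<close>

lemma sylow_contains_conjugate:
  assumes G: "group G" and fin: "finite (carrier G)" and p: "prime p"
    and X: "sylow_subgroup p G X" and ab: "a \<in> carrier G" "b \<in> carrier G"
    and comm: "a \<otimes>\<^bsub>G\<^esub> b = b \<otimes>\<^bsub>G\<^esub> a"
    and pow: "a [^]\<^bsub>G\<^esub> p = \<one>\<^bsub>G\<^esub>" "b [^]\<^bsub>G\<^esub> p = \<one>\<^bsub>G\<^esub>"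
  obtains g where "g \<in> carrier G" "g \<otimes>\<^bsub>G\<^esub> a \<otimes>\<^bsub>G\<^esub> inv\<^bsub>G\<^esub> g \<in> X" "g \<otimes>\<^bsub>G\<^esub> b \<otimes>\<^bsub>G\<^esub> inv\<^bsub>G\<^esub> g \<in> X"
proof -
  interpret G: group G by (rule G)
  have sub: "subgroup X G" and card: "card X = p ^ multiplicity p (order G)"
    using X by (auto simp: sylow_subgroup_def)
  interpret X: subgroup X G by (rule sub)
  let ?\<Omega> = "rcosets\<^bsub>G\<^esub> X"
  have fin\<Omega>: "finite ?\<Omega>" using G.rcosets_part_G[OF sub] fin finite_UnionD by metis
  have ndvd: "\<not> p dvd card ?\<Omega>"
  proof
    assume "p dvd card ?\<Omega>"
    \<comment> \<open>Otherwise the order of \<open>G\<close> would be divisible by one more power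
      of \<open>p\<close> than its multiplicity allows.\<close>
    then have "p ^ Suc (multiplicity p (order G)) dvd order G"
      using G.lagrange[OF sub] card by (metis mult_dvd_mono dvd_refl power_Suc)
    moreover have "order G \<noteq> 0" using G.order_gt_0_iff_finite fin by simp
    moreover have "\<not> is_unit p" using p not_prime_unit by blast
    ultimately show False using multiplicity_geI[of "order G" p] by fastforce
  qed
  have closed: "C #>\<^bsub>G\<^esub> c \<in> ?\<Omega>" if "C \<in> ?\<Omega>" "c \<in> carrier G" for C c
    using that X.subset by (auto simp: RCOSETS_def G.coset_mult_assoc)
  have C_sub: "C \<subseteq> carrier G" if "C \<in> ?\<Omega>" for C using X.rcosets_carrier[OF G that] .
  have iter: "((\<lambda>C. C #>\<^bsub>G\<^esub> c) ^^ k) C = C #>\<^bsub>G\<^esub> (c [^]\<^bsub>G\<^esub> k)" if "C \<in> ?\<Omega>" "c \<in> carrier G" for C c and k :: nat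
    using that C_sub
    by (induction k) (simp_all add: G.coset_mult_assoc)
  have period: "((\<lambda>C. C #>\<^bsub>G\<^esub> c) ^^ p) C = C" if "C \<in> ?\<Omega>" "c \<in> carrier G" "c [^]\<^bsub>G\<^esub> p = \<one>\<^bsub>G\<^esub>" for C c
    using iter[OF that(1,2)] that C_sub by simp
  let ?\<Omega>1 = "{C \<in> ?\<Omega>. C #>\<^bsub>G\<^esub> a = C}"
  have ndvd1: "\<not> p dvd card ?\<Omega>1"
    using closed period ab pow by (intro fixed_point_mod_prime[OF p fin\<Omega> _ _ ndvd]) auto
  \<comment> \<open>The set of cosets fixed by \<open>a\<close> is stable under \<open>b\<close>
    because the two elements commute.\<close>
  have closed1: "C #>\<^bsub>G\<^esub> b \<in> ?\<Omega>1" if "C \<in> ?\<Omega>1" for C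
  proof -
    have "C \<subseteq> carrier G" using that C_sub by blast
    then have "C #>\<^bsub>G\<^esub> b #>\<^bsub>G\<^esub> a = C #>\<^bsub>G\<^esub> a #>\<^bsub>G\<^esub> b"
      using G.coset_mult_assoc[OF _ ab] G.coset_mult_assoc[OF _ ab(2,1)] comm by simp
    then show ?thesis using that closed ab by simp
  qed
  have "\<not> p dvd card {C \<in> ?\<Omega>1. C #>\<^bsub>G\<^esub> b = C}"
    using period ab pow fin\<Omega> by (intro fixed_point_mod_prime[OF p _ closed1 _ ndvd1]) simp_all
  then have "{C \<in> ?\<Omega>1. C #>\<^bsub>G\<^esub> b = C} \<noteq> {}" by (metis card.empty dvd_0_right)
  then obtain g where g: "g \<in> carrier G" "X #>\<^bsub>G\<^esub> g #>\<^bsub>G\<^esub> a = X #>\<^bsub>G\<^esub> g" "X #>\<^bsub>G\<^esub> g #>\<^bsub>G\<^esub> b = X #>\<^bsub>G\<^esub> g"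
    by (auto simp: RCOSETS_def)
  have "g \<otimes>\<^bsub>G\<^esub> c \<otimes>\<^bsub>G\<^esub> inv\<^bsub>G\<^esub> g \<in> X" if c: "c \<in> carrier G" "X #>\<^bsub>G\<^esub> g #>\<^bsub>G\<^esub> c = X #>\<^bsub>G\<^esub> g" for c
  proof -
    have "g \<otimes>\<^bsub>G\<^esub> c \<in> X #>\<^bsub>G\<^esub> g"
      using c g(1) G.rcos_self[OF _ sub, of "g \<otimes>\<^bsub>G\<^esub> c"] X.subset by (simp add: G.coset_mult_assoc)
    then obtain x where "x \<in> X" "g \<otimes>\<^bsub>G\<^esub> c = x \<otimes>\<^bsub>G\<^esub> g" by (auto simp: r_coset_def)
    moreover from this have "x \<in> carrier G" by simp
    ultimately show ?thesis using g(1) by (simp add: G.m_assoc)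
  qed
  then show thesis using that g ab by blast
qed

section \<open>Abelian p-groups that are not cyclic\<close>

context comm_group
begin

text \<open>Each nonempty fibre of the p-th power map embeds into the p-torsion by division by one
  of its members, so one more power of \<open>p\<close> multiplies the count by at most
  \<open>p\<close>.\<close>

lemma card_torsion:
  assumes fin: "finite (carrier G)" and le: "card {x \<in> carrier G. x [^] p = \<one>} \<le> p"
  shows "card {x \<in> carrier G. x [^] (p ^ k :: nat) = \<one>} \<le> p ^ k"
proof (induction k)
  case 0
  have "{x \<in> carrier G. x [^] (p ^ 0 :: nat) = \<one>} = {\<one>}" by auto
  then show ?case by simp
next
  case (Suc k)
  let ?K = "\<lambda>n. {x \<in> carrier G. x [^] (n :: nat) = \<one>}"
  let ?F = "\<lambda>y. {x \<in> carrier G. x [^] p = y}"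
  have fib: "card (?F y) \<le> p" for y
  proof (cases "?F y = {}")
    case False
    then obtain z where z: "z \<in> carrier G" "z [^] p = y" by blast
    have "(\<lambda>x. x \<otimes> inv z) ` ?F y \<subseteq> ?K p"
      using z by (auto simp: nat_pow_distrib nat_pow_inv)
    moreover have "inj_on (\<lambda>x. x \<otimes> inv z) (?F y)"
      using z by (intro inj_onI) simp
    ultimately have "card (?F y) \<le> card (?K p)"
      using fin by (intro card_inj_on_le) auto
    then show ?thesis using le by simp
  qed (simp only: card.empty)
  have "?K (p ^ Suc k) \<subseteq> (\<Union>y\<in>?K (p ^ k). ?F y)"
    by (auto simp: nat_pow_pow)
  then have "card (?K (p ^ Suc k)) \<le> card (\<Union>y\<in>?K (p ^ k). ?F y)"
    using fin by (intro card_mono) auto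
  also have "\<dots> \<le> (\<Sum>y\<in>?K (p ^ k). card (?F y))"
    using fin by (intro card_UN_le) auto
  also have "\<dots> \<le> (\<Sum>y\<in>?K (p ^ k). p)" by (rule sum_mono) (rule fib)
  also have "\<dots> \<le> p ^ Suc k" using Suc by simp
  finally show ?case .
qed

text \<open>Without an element of full order, all elements are killed by p^(n-1), and the torsion
  bound makes the group too small.\<close>

lemma cyclic_if_few_torsion:
  assumes ord: "order G = p ^ n" and p: "prime p" and le: "card {x \<in> carrier G. x [^] p = \<one>} \<le> p"
  shows "cyclic_group G"
proof -
  have p1: "p > 1" using p prime_gt_1_nat by simp
  have fin: "finite (carrier G)" using ord p1 order_gt_0_iff_finite by simp
  have "\<exists>z\<in>carrier G. ord z = order G"
  proof (rule ccontr)
    assume neg: "\<not> (\<exists>z\<in>carrier G. ord z = order G)"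
    \<comment> \<open>For n = 0 the identity itself has full order; this guards the exponent n - 1
      below.\<close>
    have n: "n \<noteq> 0"
    proof
      assume "n = 0"
      then have "carrier G = {\<one>}" using ord order_one_triv_iff by simp
      then show False using neg \<open>n = 0\<close> ord by simp
    qed
    have "x [^] (p ^ (n - 1)) = \<one>" if x: "x \<in> carrier G" for x
    proof -
      have "ord x dvd p ^ n" using ord_dvd_group_order[OF x] ord by simp
      then obtain k where k: "k \<le> n" "ord x = p ^ k" using divides_primepow_nat[OF p] by blast
      then have "k \<noteq> n" using neg x ord by auto
      then have "ord x dvd p ^ (n - 1)" using k by (simp add: le_imp_power_dvd)
      then show ?thesis using pow_eq_id[OF x] by simp
    qed
    then have "carrier G = {x \<in> carrier G. x [^] (p ^ (n - 1)) = \<one>}" by auto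
    then have "card (carrier G) \<le> p ^ (n - 1)" using card_torsion[OF fin le] by metis
    moreover have "p ^ (n - 1) < p ^ n" using p1 n by simp
    ultimately show False using ord by (simp add: order_def)
  qed
  then obtain z where z: "z \<in> carrier G" "ord z = order G" by blast
  have "generate G {z} = carrier G"
    using z generate_pow_card[OF z(1)] generate_incl[of "{z}"] fin
    by (intro card_subset_eq) (auto simp: order_def)
  then show ?thesis
    using z(1) generate_pow[OF z(1)] unfolding cyclic_group by (auto simp: full_SetCompr_eq)
qed

text \<open>More than \<open>p\<close> elements of p-torsion leave room for \<open>b\<close> outside
  the powers of \<open>a\<close>. Integer exponents are used since the conclusion then describes the
  kernel of a homomorphism from Z x Z.\<close>

lemma noncyclic_p_group:
  assumes ord: "order G = p ^ n" and p: "prime p" and nc: "\<not> cyclic_group G"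
  obtains a b where "a \<in> carrier G" "b \<in> carrier G"
    "\<And>i j :: int. a [^] i \<otimes> b [^] j = \<one> \<longleftrightarrow> int p dvd i \<and> int p dvd j"
proof -
  have p1: "p > 1" using p prime_gt_1_nat by simp
  have fin: "finite (carrier G)" using ord p1 order_gt_0_iff_finite by simp
  let ?K = "{x \<in> carrier G. x [^] p = \<one>}"
  have K: "card ?K > p" using cyclic_if_few_torsion[OF ord p] nc by force
  have ordp: "ord x = p" if "x \<in> ?K" "x \<noteq> \<one>" for x
  proof -
    have "ord x dvd p" using that pow_eq_id[of x p] by simp
    moreover have "ord x \<noteq> 1" using that ord_eq_1 by simp
    ultimately show ?thesis using p unfolding prime_nat_iff by blast
  qed
  have "\<not> ?K \<subseteq> {\<one>}"
  proof
    assume "?K \<subseteq> {\<one>}"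
    then have "card ?K \<le> card {\<one>}" by (intro card_mono) auto
    then show False using K p1 by simp
  qed
  then obtain a where a: "a \<in> ?K" "a \<noteq> \<one>" by blast
  have "card (generate G {a}) = p" using generate_pow_card[of a] ordp a by simp
  moreover have "finite (generate G {a})"
    using fin generate_incl[of "{a}"] a by (auto intro: finite_subset)
  ultimately have "\<not> ?K \<subseteq> generate G {a}" using K by (metis card_mono not_less)
  then obtain b where b: "b \<in> ?K" "b \<notin> generate G {a}" by blast
  have gen: "generate G {a} = {a [^] k | k. k \<in> (UNIV :: int set)}" using generate_pow a by blast
  have b1: "b \<noteq> \<one>" using b(2) generate.one by metis
  have car: "a \<in> carrier G" "b \<in> carrier G" using a b by auto
  have pa: "a [^] i = \<one> \<longleftrightarrow> int p dvd i" for i :: int using int_pow_eq_id[OF car(1)] ordp[OF a] by simp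
  have pb: "b [^] i = \<one> \<longleftrightarrow> int p dvd i" for i :: int using int_pow_eq_id[OF car(2)] ordp[OF b(1) b1] by simp
  show thesis
  proof (rule that[OF car])
    fix i j :: int
    show "a [^] i \<otimes> b [^] j = \<one> \<longleftrightarrow> int p dvd i \<and> int p dvd j"
    proof
      assume eq: "a [^] i \<otimes> b [^] j = \<one>"
      have "int p dvd j"
      proof (rule ccontr)
        assume "\<not> int p dvd j"
        then have "coprime j (int p)"
          using p prime_imp_coprime[of "int p" j] by (simp add: coprime_commute)
        \<comment> \<open>By Bezout, \<open>b\<close> is a power of \<open>b [^] j\<close>, hence of
          \<open>a\<close>, against its choice.\<close>
        then obtain s t where st: "s * j + t * int p = 1" using bezout_int[of j "int p"] by auto
        have bj: "b [^] j = a [^] (- i)"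
          using eq car by (metis int_pow_closed int_pow_neg inv_unique' l_inv inv_equality m_comm)
        have "b = b [^] (j * s + int p * t)" using st car by (simp add: mult.commute)
        also have "\<dots> = (b [^] j) [^] s \<otimes> (b [^] int p) [^] t"
          using car by (simp add: int_pow_mult[OF car(2), symmetric] int_pow_pow)
        also have "\<dots> = a [^] (- i * s)"
          using pb[of "int p"] car bj by (simp add: int_pow_pow)
        finally have "b \<in> generate G {a}" unfolding gen by blast
        then show False using b(2) by simp
      qed
      moreover from this have "int p dvd i" using eq pa[of i] pb[of j] car by simp
      ultimately show "int p dvd i \<and> int p dvd j" by simp
    next
      assume "int p dvd i \<and> int p dvd j"
      then have "a [^] i = \<one>" "b [^] j = \<one>" using pa pb by auto
      then show "a [^] i \<otimes> b [^] j = \<one>" by simp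
    qed
  qed
qed

end

lemma center_abelian_subgroup:
  assumes "group P"
  shows "subgroup (group_center P) P" "comm_group (P\<lparr>carrier := group_center P\<rparr>)"
proof -
  interpret P: group P by fact
  show sub: "subgroup (group_center P) P"
  proof (rule P.subgroupI)
    show "group_center P \<subseteq> carrier P" "group_center P \<noteq> {}"
      using P.one_closed by (auto simp: group_center_def)
  next
    fix z assume z: "z \<in> group_center P"
    have "inv\<^bsub>P\<^esub> z \<otimes>\<^bsub>P\<^esub> x = x \<otimes>\<^bsub>P\<^esub> inv\<^bsub>P\<^esub> z" if x: "x \<in> carrier P" for x
    proof -
      have "z \<in> carrier P" "z \<otimes>\<^bsub>P\<^esub> x = x \<otimes>\<^bsub>P\<^esub> z" using z x by (auto simp: group_center_def)
      then have "x = z \<otimes>\<^bsub>P\<^esub> (x \<otimes>\<^bsub>P\<^esub> inv\<^bsub>P\<^esub> z)"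
        using x by (metis P.inv_closed P.m_assoc P.r_inv P.r_one)
      then have "inv\<^bsub>P\<^esub> z \<otimes>\<^bsub>P\<^esub> x = inv\<^bsub>P\<^esub> z \<otimes>\<^bsub>P\<^esub> (z \<otimes>\<^bsub>P\<^esub> (x \<otimes>\<^bsub>P\<^esub> inv\<^bsub>P\<^esub> z))" by simp
      then show ?thesis using x \<open>z \<in> carrier P\<close> by (simp flip: P.m_assoc)
    qed
    then show "inv\<^bsub>P\<^esub> z \<in> group_center P" using z by (auto simp: group_center_def)
  next
    fix y z assume "y \<in> group_center P" "z \<in> group_center P"
    then have yz: "y \<in> carrier P" "z \<in> carrier P"
      and comm: "\<And>x. x \<in> carrier P \<Longrightarrow> y \<otimes>\<^bsub>P\<^esub> x = x \<otimes>\<^bsub>P\<^esub> y" "\<And>x. x \<in> carrier P \<Longrightarrow> z \<otimes>\<^bsub>P\<^esub> x = x \<otimes>\<^bsub>P\<^esub> z"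
      by (simp_all add: group_center_def)
    have "y \<otimes>\<^bsub>P\<^esub> z \<otimes>\<^bsub>P\<^esub> x = x \<otimes>\<^bsub>P\<^esub> (y \<otimes>\<^bsub>P\<^esub> z)" if x: "x \<in> carrier P" for x
    proof -
      have "y \<otimes>\<^bsub>P\<^esub> z \<otimes>\<^bsub>P\<^esub> x = y \<otimes>\<^bsub>P\<^esub> (x \<otimes>\<^bsub>P\<^esub> z)" unfolding P.m_assoc[OF yz x] comm(2)[OF x] ..
      also have "\<dots> = x \<otimes>\<^bsub>P\<^esub> y \<otimes>\<^bsub>P\<^esub> z" unfolding P.m_assoc[OF yz(1) x yz(2), symmetric] comm(1)[OF x] ..
      finally show ?thesis unfolding P.m_assoc[OF x yz] .
    qed
    then show "y \<otimes>\<^bsub>P\<^esub> z \<in> group_center P"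
      using yz by (simp add: group_center_def)
  qed
  interpret Z: group "P\<lparr>carrier := group_center P\<rparr>"
    using subgroup.subgroup_is_group[OF sub P.is_group] .
  show "comm_group (P\<lparr>carrier := group_center P\<rparr>)"
  proof (rule Z.group_comm_groupI)
    fix x y assume "x \<in> carrier (P\<lparr>carrier := group_center P\<rparr>)" "y \<in> carrier (P\<lparr>carrier := group_center P\<rparr>)"
    then have "x \<in> group_center P" "y \<in> carrier P" using subgroup.mem_carrier[OF sub] by simp_all
    then show "x \<otimes>\<^bsub>P\<lparr>carrier := group_center P\<rparr>\<^esub> y = y \<otimes>\<^bsub>P\<lparr>carrier := group_center P\<rparr>\<^esub> x"
      by (simp add: group_center_def)
  qed
qed

lemma noncyclic_center:
  fixes P :: "'a monoid"
  assumes P: "p_group p P" and p: "prime p" and nc: "\<not> cyclic_group (P\<lparr>carrier := group_center P\<rparr>)"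
  obtains a b where "a \<in> group_center P" "b \<in> group_center P"
    "\<And>i j :: int. a [^]\<^bsub>P\<^esub> i \<otimes>\<^bsub>P\<^esub> b [^]\<^bsub>P\<^esub> j = \<one>\<^bsub>P\<^esub> \<longleftrightarrow> int p dvd i \<and> int p dvd j"
proof -
  interpret P: group P using P by (simp add: p_group_def)
  let ?Z = "P\<lparr>carrier := group_center P\<rparr>"
  note sub = center_abelian_subgroup(1)[OF P.is_group]
  interpret Z: comm_group ?Z by (rule center_abelian_subgroup(2)[OF P.is_group])
  obtain n where n: "order P = p ^ n" using P by (auto simp: p_group_def)
  have "card (group_center P) dvd p ^ n" using P.lagrange[OF sub] n by (metis dvd_triv_right)
  then obtain m where "order ?Z = p ^ m" using divides_primepow_nat[OF p] by (auto simp: order_def)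
  then obtain a b where ab: "a \<in> carrier ?Z" "b \<in> carrier ?Z"
    "\<And>i j :: int. a [^]\<^bsub>?Z\<^esub> i \<otimes>\<^bsub>?Z\<^esub> b [^]\<^bsub>?Z\<^esub> j = \<one>\<^bsub>?Z\<^esub> \<longleftrightarrow> int p dvd i \<and> int p dvd j"
    using Z.noncyclic_p_group[OF _ p nc] by blast
  then show thesis
    using that[of a b] P.int_pow_consistent[OF sub] by simp
qed

section \<open>The edge is a zero object\<close>

lemma finite_biset_subgroup:
  assumes "finite_biset G K U" "X \<subseteq> carrier G"
  shows "finite_biset (G\<lparr>carrier := X\<rparr>) K U"
  using assms unfolding finite_biset_def by (auto simp: subset_iff)

locale roquette_setting =
  fixes p :: nat and X :: "pgl_elem set"
  assumes p: "prime p" and sylow: "sylow_subgroup p (PGL 3 (prime_field p)) X"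
begin

sublocale F: residues_prime p "prime_field p"
  by unfold_locales (rule p)

abbreviation "R \<equiv> prime_field p"
abbreviation "G \<equiv> PGL 3 R"
abbreviation "S \<equiv> sylow_group p X"
abbreviation "points \<equiv> proj_biset R (proj_points R)"
abbreviation "lines \<equiv> proj_biset R (proj_lines R)"

lemma group_G: "group G" by (rule F.group_PGL)

sublocale G: group G by (rule group_G)

lemma subgroup_X: "subgroup X G"
  using sylow by (simp add: sylow_subgroup_def)

lemma group_S: "group S"
  unfolding sylow_group_def using subgroup.subgroup_is_group[OF subgroup_X group_G] .

lemma finite_G: "finite (carrier G)"
proof -
  have "finite (Units F.M3)"
    using F.finite_V3(2)[OF F.finite] by (rule finite_subset[rotated]) (auto simp: Units_def)
  then show ?thesis by (simp add: F.pcls)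
qed

lemma finite_plane: "finite_biset G unit_group points" "finite_biset G unit_group lines"
  using F.finite_biset_plane[OF F.finite] by auto

lemma finite_plane_S: "finite_biset S unit_group points" "finite_biset S unit_group lines"
  unfolding sylow_group_def
  using finite_plane finite_biset_subgroup subgroup.subset[OF subgroup_X] by blast+

sublocale D: burnside_difference S lines points
  by (rule burnside_difference.intro[OF group_S finite_plane_S(2,1)])

lemma B_delta2_eq:
  assumes "group Q" "group P"
  shows "B_delta2 p X Q P = vclass Q P ` D.ideal_marks Q P"
  unfolding D.multiples_of_generator[OF assms, symmetric] B_delta2_def B_delta_def delta_def ..

text \<open>The arguments are integers, reduced into the carrier of the prime field, so that
  translations and center receive homomorphisms from the same group Z x Z.\<close>

definition trans_cls :: "int \<times> int \<Rightarrow> pgl_elem" where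
  "trans_cls z = F.pcls (F.translation (fst z mod int p) (snd z mod int p))"

abbreviation "A \<equiv> integer_group \<times>\<times> integer_group"

lemma trans_cls_closed: "trans_cls z \<in> carrier G"
  by (simp add: trans_cls_def F.pcls F.translation_Units)

lemma trans_cls_mult: "trans_cls (i, j) \<otimes>\<^bsub>G\<^esub> trans_cls (k, l) = trans_cls (i + k, j + l)"
  by (simp add: trans_cls_def F.pcls_mult F.translation_Units F.translation_mult F.add_cong)

lemma trans_cls_one:
  assumes "int p dvd i" "int p dvd j"
  shows "trans_cls (i, j) = \<one>\<^bsub>G\<^esub>"
  using assms F.translation_zero F.pcls_one
  by (simp add: trans_cls_def F.zero_cong dvd_eq_mod_eq_0)

lemma trans_cls_pow: "trans_cls (i, j) [^]\<^bsub>G\<^esub> (k :: nat) = trans_cls (int k * i, int k * j)"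
proof (induction k)
  case 0
  show ?case using trans_cls_one[of 0 0] by simp
next
  case (Suc k)
  then show ?case by (simp add: trans_cls_mult algebra_simps)
qed

text \<open>The Sylow argument supplies the two generators; as conjugation by \<open>g\<close> is
  multiplicative, the rest follows by induction on each coordinate.\<close>

lemma conjugate_translations:
  obtains g where "g \<in> carrier G" "\<And>z. g \<otimes>\<^bsub>G\<^esub> trans_cls z \<otimes>\<^bsub>G\<^esub> inv\<^bsub>G\<^esub> g \<in> X"
proof -
  interpret X: subgroup X G by (rule subgroup_X)
  obtain g where g: "g \<in> carrier G" "g \<otimes>\<^bsub>G\<^esub> trans_cls (1, 0) \<otimes>\<^bsub>G\<^esub> inv\<^bsub>G\<^esub> g \<in> X"
    "g \<otimes>\<^bsub>G\<^esub> trans_cls (0, 1) \<otimes>\<^bsub>G\<^esub> inv\<^bsub>G\<^esub> g \<in> X"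
    by (rule sylow_contains_conjugate[OF group_G finite_G p sylow
          trans_cls_closed[of "(1, 0)"] trans_cls_closed[of "(0, 1)"]])
       (auto simp: trans_cls_mult trans_cls_pow trans_cls_one)
  let ?c = "\<lambda>i j. g \<otimes>\<^bsub>G\<^esub> trans_cls (i, j) \<otimes>\<^bsub>G\<^esub> inv\<^bsub>G\<^esub> g"
  have mult: "?c i j \<otimes>\<^bsub>G\<^esub> ?c k l = ?c (i + k) (j + l)" for i j k l
  proof -
    have "?c i j \<otimes>\<^bsub>G\<^esub> ?c k l = g \<otimes>\<^bsub>G\<^esub> (trans_cls (i, j) \<otimes>\<^bsub>G\<^esub> trans_cls (k, l)) \<otimes>\<^bsub>G\<^esub> inv\<^bsub>G\<^esub> g"
      using g(1) trans_cls_closed by (simp add: G.m_assoc G.inv_solve_left' flip: G.m_assoc[of "inv\<^bsub>G\<^esub> g" g])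
    then show ?thesis by (simp add: trans_cls_mult)
  qed
  have zero: "?c 0 0 = \<one>\<^bsub>G\<^esub>" using g(1) by (simp add: trans_cls_one)
  have inv: "?c (- i) (- j) = inv\<^bsub>G\<^esub> (?c i j)" for i j
    using g(1) trans_cls_closed mult[of "- i" "- j" i j] zero by (intro G.inv_equality[symmetric]) auto
  have left: "?c i 0 \<in> X" for i
  proof (induction i rule: int_induct[where k = 0])
    case base show ?case using zero by simp
  next
    case (step1 i)
    show ?case using mult[of i 0 1 0] X.m_closed[OF step1(2) g(2)] by simp
  next
    case (step2 i)
    have "?c (- 1) 0 \<in> X" using inv[of 1 0] g(2) X.m_inv_closed by simp
    from X.m_closed[OF step2(2) this] show ?case using mult[of i 0 "- 1" 0] by simp
  qed
  have right: "?c 0 j \<in> X" for j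
  proof (induction j rule: int_induct[where k = 0])
    case base show ?case using zero by simp
  next
    case (step1 i)
    show ?case using mult[of 0 i 0 1] X.m_closed[OF step1(2) g(3)] by simp
  next
    case (step2 i)
    have "?c 0 (- 1) \<in> X" using inv[of 0 1] g(3) X.m_inv_closed by simp
    from X.m_closed[OF step2(2) this] show ?case using mult[of 0 i 0 "- 1"] by simp
  qed
  have "?c i j \<in> X" for i j
    using mult[of i 0 0 j] X.m_closed[OF left[of i] right[of j]] by simp
  then show thesis using that[OF g(1)] by auto
qed

text \<open>\<open>\<sigma>\<close> and \<open>\<beta>\<close> both kill exactly the pairs divisible
  by \<open>p\<close>, so an element of the plane fixed by a nontrivial translation has a nontrivial
  image of its stabilizer in the center. The plane is moved by \<open>g\<close> throughout, as it is
  the conjugates of the translations that lie in \<open>X\<close>.\<close>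

lemma f_one_in_B_delta2:
  fixes P :: "'a monoid"
  assumes P: "p_group p P" and nc: "\<not> cyclic_group (P\<lparr>carrier := group_center P\<rparr>)"
  shows "f_one P \<in> B_delta2 p X P P"
proof -
  interpret P: group P using P by (simp add: p_group_def)
  interpret A: group A by (intro DirProd_group) simp_all
  have finP: "finite (carrier P)"
    using P p P.order_gt_0_iff_finite prime_gt_0_nat by (auto simp: p_group_def)
  obtain a b where ab: "a \<in> group_center P" "b \<in> group_center P"
    "\<And>i j :: int. a [^]\<^bsub>P\<^esub> i \<otimes>\<^bsub>P\<^esub> b [^]\<^bsub>P\<^esub> j = \<one>\<^bsub>P\<^esub> \<longleftrightarrow> int p dvd i \<and> int p dvd j"
    using noncyclic_center[OF P p nc] by blast
  have car: "a \<in> carrier P" "b \<in> carrier P"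
    using ab(1,2) by (auto simp: group_center_def)
  note subZ = center_abelian_subgroup(1)[OF P.is_group]
  have powZ: "x [^]\<^bsub>P\<^esub> i \<in> group_center P" if "x \<in> group_center P" for x and i :: int
    using P.subgroup_int_pow_closed[OF subZ that] .
  define \<beta> where "\<beta> = (\<lambda>(i :: int, j :: int). a [^]\<^bsub>P\<^esub> i \<otimes>\<^bsub>P\<^esub> b [^]\<^bsub>P\<^esub> j)"
  have \<beta>_center: "\<beta> z \<in> group_center P" for z
    unfolding \<beta>_def using powZ ab(1,2) subgroup.m_closed[OF subZ] by (cases z) simp
  have \<beta>_hom: "\<beta> \<in> hom A P"
  proof (rule homI)
    show "\<beta> z \<in> carrier P" for z using car by (cases z) (simp add: \<beta>_def)
    show "\<beta> (z \<otimes>\<^bsub>A\<^esub> w) = \<beta> z \<otimes>\<^bsub>P\<^esub> \<beta> w" for z w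
    proof -
      obtain i j k l where zw: "z = (i, j)" "w = (k, l)" by (cases z, cases w)
      have "b [^]\<^bsub>P\<^esub> j \<otimes>\<^bsub>P\<^esub> a [^]\<^bsub>P\<^esub> k = a [^]\<^bsub>P\<^esub> k \<otimes>\<^bsub>P\<^esub> b [^]\<^bsub>P\<^esub> j"
        using powZ[OF ab(2), of j] car by (simp add: group_center_def)
      then have "a [^]\<^bsub>P\<^esub> i \<otimes>\<^bsub>P\<^esub> (b [^]\<^bsub>P\<^esub> j \<otimes>\<^bsub>P\<^esub> a [^]\<^bsub>P\<^esub> k) \<otimes>\<^bsub>P\<^esub> b [^]\<^bsub>P\<^esub> l
          = a [^]\<^bsub>P\<^esub> i \<otimes>\<^bsub>P\<^esub> (a [^]\<^bsub>P\<^esub> k \<otimes>\<^bsub>P\<^esub> b [^]\<^bsub>P\<^esub> j) \<otimes>\<^bsub>P\<^esub> b [^]\<^bsub>P\<^esub> l" by simp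
      then show ?thesis
        using car by (simp add: zw \<beta>_def P.int_pow_mult P.m_assoc)
    qed
  qed
  have \<beta>_one: "\<beta> (i, j) = \<one>\<^bsub>P\<^esub> \<longleftrightarrow> int p dvd i \<and> int p dvd j" for i j
    using ab(3) by (simp add: \<beta>_def)
  obtain g where g: "g \<in> carrier G" "\<And>z. g \<otimes>\<^bsub>G\<^esub> trans_cls z \<otimes>\<^bsub>G\<^esub> inv\<^bsub>G\<^esub> g \<in> X"
    using conjugate_translations by blast
  define \<sigma> where "\<sigma> z = g \<otimes>\<^bsub>G\<^esub> trans_cls z \<otimes>\<^bsub>G\<^esub> inv\<^bsub>G\<^esub> g" for z
  have S_sel: "carrier S = X" "x \<otimes>\<^bsub>S\<^esub> y = x \<otimes>\<^bsub>G\<^esub> y" for x y by (simp_all add: sylow_group_def)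
  have \<sigma>_hom: "\<sigma> \<in> hom A S"
  proof (rule homI)
    show "\<sigma> z \<in> carrier S" for z using g(2) by (simp add: \<sigma>_def S_sel)
    show "\<sigma> (z \<otimes>\<^bsub>A\<^esub> w) = \<sigma> z \<otimes>\<^bsub>S\<^esub> \<sigma> w" for z w
    proof -
      have "z \<otimes>\<^bsub>A\<^esub> w = (fst z + fst w, snd z + snd w)" by (cases z, cases w) simp
      then have "trans_cls (z \<otimes>\<^bsub>A\<^esub> w) = trans_cls z \<otimes>\<^bsub>G\<^esub> trans_cls w"
        using trans_cls_mult[of "fst z" "snd z" "fst w" "snd w"] by simp
      then show ?thesis
        using g(1) trans_cls_closed
        by (simp add: \<sigma>_def S_sel G.m_assoc flip: G.m_assoc[of "inv\<^bsub>G\<^esub> g" g])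
    qed
  qed
  \<comment> \<open>What \<open>\<sigma> z\<close> fixes is \<open>g\<close> times what the
    translation fixes, so the affine computations apply to \<open>W\<close> moved back by the
    inverse of \<open>g\<close>.\<close>
  have act: "lact Y (\<sigma> z) W = lact Y g (lact Y (trans_cls z) (lact Y (inv\<^bsub>G\<^esub> g) W))"
    if "finite_biset G unit_group Y" "W \<in> bset Y" for Y :: "(pgl_elem, unit, 'y) biset" and z W
    using finite_bisetD(2,4)[OF that(1)] that(2) g(1) trans_cls_closed by (simp add: \<sigma>_def)
  have act_trans: "lact (proj_biset R T) (trans_cls (i, j)) W
      = mat_vec 3 R (F.translation (i mod int p) (j mod int p)) ` W"
    if "F.scalar_closed_set W" for i j W T
    using F.lact_plane[OF F.translation_Units that] by (simp add: trans_cls_def)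
  interpret central_action A P S \<sigma> \<beta>
    using \<beta>_hom \<beta>_center \<sigma>_hom finP finite_G subgroup.subset[OF subgroup_X] group_S
    by (intro central_action.intro central_action_axioms.intro)
       (auto simp: S_sel A.is_group P.is_group intro: finite_subset)
  have bsets: "bset lines = proj_lines R" "bset points = proj_points R"
    by (simp_all add: proj_biset_def)
  have residue: "k mod int p = k" if "k \<in> carrier R" for k
    using that by (simp add: F.res_carrier_eq)
  \<comment> \<open>An element of the carrier, being a reduced residue, is divisible by
    \<open>p\<close> only if it is 0.\<close>
  have nonzero: "\<beta> (i, j) \<noteq> \<one>\<^bsub>P\<^esub>"
    if "i \<in> carrier R" "j \<in> carrier R" "\<not> (i = \<zero>\<^bsub>R\<^esub> \<and> j = \<zero>\<^bsub>R\<^esub>)" for i j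
    using that residue by (auto simp: \<beta>_one dvd_eq_mod_eq_0 F.res_zero_eq)
  have one_nz: "\<one>\<^bsub>R\<^esub> \<noteq> \<zero>\<^bsub>R\<^esub>" by (simp add: F.res_zero_eq F.res_one_eq)
  have lines: "free_orbits lines = {}"
  proof (rule free_orbits_empty[OF finite_plane_S(2)])
    fix W assume W: "W \<in> bset lines"
    let ?W = "lact lines (inv\<^bsub>G\<^esub> g) W"
    have W': "?W \<in> proj_lines R" using finite_bisetD(2)[OF finite_plane(2) _ W] g(1) bsets by simp
    obtain i j where ij: "i \<in> carrier R" "j \<in> carrier R" "\<not> (i = \<zero>\<^bsub>R\<^esub> \<and> j = \<zero>\<^bsub>R\<^esub>)"
      "mat_vec 3 R (F.translation i j) ` ?W = ?W"
      using F.line_fixed_by_translation[OF F.finite one_nz W'] .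
    have "lact lines (trans_cls (i, j)) ?W = ?W"
      using act_trans[OF F.lines_scalar_closed[OF W']] ij residue by simp
    then have "lact lines (\<sigma> (i, j)) W = W"
      using act[OF finite_plane(2) W] finite_biset_lact_inv(2)[OF finite_plane(2) group_G g(1) W] by simp
    then show "\<exists>z\<in>carrier A. lact lines (\<sigma> z) W = W \<and> \<beta> z \<noteq> \<one>\<^bsub>P\<^esub>"
      using nonzero[OF ij(1-3)] by (intro bexI[of _ "(i, j)"]) auto
  qed
  have points: "card (free_orbits points) = 1"
  proof (rule free_orbits_single[OF finite_plane_S(1)])
    have orig: "F.origin \<in> bset points" using F.origin_point[OF one_nz] by (simp add: bsets)
    \<comment> \<open>The single free orbit is that of the affine origin moved by
      \<open>g\<close>.\<close>
    let ?origin = "lact points g F.origin"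
    show W0: "?origin \<in> bset points" using finite_bisetD(2)[OF finite_plane(1) g(1) orig] .
    have origin_back: "lact points (inv\<^bsub>G\<^esub> g) ?origin = F.origin"
      using finite_biset_lact_inv(1)[OF finite_plane(1) group_G g(1) orig] .
    have move: "lact points (\<sigma> z) ?origin = lact points g (lact points (trans_cls z) F.origin)" for z
      using act[OF finite_plane(1) W0] origin_back by simp
    note origin_closed = F.points_scalar_closed[OF F.origin_point[OF one_nz]]
    show "\<beta> z = \<one>\<^bsub>P\<^esub>" if "z \<in> carrier A" "lact points (\<sigma> z) ?origin = ?origin" for z
    proof -
      obtain i j where z: "z = (i, j)" by (cases z)
      have "lact points (trans_cls z) F.origin \<in> bset points"
        using finite_bisetD(2)[OF finite_plane(1) trans_cls_closed orig] .
      from finite_biset_lact_inv(1)[OF finite_plane(1) group_G g(1) this]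
      have "lact points (trans_cls z) F.origin = F.origin"
        using that(2) move origin_back by simp
      then have "mat_vec 3 R (F.translation (i mod int p) (j mod int p)) ` F.origin = F.origin"
        using act_trans[OF origin_closed] z by simp
      then have "i mod int p = \<zero>\<^bsub>R\<^esub> \<and> j mod int p = \<zero>\<^bsub>R\<^esub>"
        using F.translation_fixes_origin[of "i mod int p" "j mod int p"] by simp
      then show ?thesis by (simp add: z \<beta>_one dvd_eq_mod_eq_0 F.res_zero_eq)
    qed
    show "(\<exists>z\<in>carrier A. W = lact points (\<sigma> z) ?origin) \<or>
        (\<exists>z\<in>carrier A. lact points (\<sigma> z) W = W \<and> \<beta> z \<noteq> \<one>\<^bsub>P\<^esub>)" if W: "W \<in> bset points" for W
    proof -
      let ?W = "lact points (inv\<^bsub>G\<^esub> g) W"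
      have W': "?W \<in> proj_points R" using finite_bisetD(2)[OF finite_plane(1) _ W] g(1) bsets by simp
      have gW: "lact points g ?W = W" using finite_biset_lact_inv(2)[OF finite_plane(1) group_G g(1) W] .
      show ?thesis
      proof (rule F.point_cases[OF W'])
        assume "\<And>a b. a \<in> carrier R \<Longrightarrow> b \<in> carrier R \<Longrightarrow> mat_vec 3 R (F.translation a b) ` ?W = ?W"
        \<comment> \<open>At infinity every translation fixes the point, so any nonzero pair would
          do as a witness; (1, 0) is taken.\<close>
        then have "lact points (trans_cls (1, 0)) ?W = ?W"
          using act_trans[OF F.points_scalar_closed[OF W']] by simp
        then have "lact points (\<sigma> (1, 0)) W = W" using act[OF finite_plane(1) W] gW by simp
        moreover have "\<beta> (1, 0) \<noteq> \<one>\<^bsub>P\<^esub>" using nonzero[of 1 0] one_nz F.one_closed F.zero_closed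
          by (simp add: F.res_one_eq F.res_zero_eq)
        ultimately show ?thesis by (intro disjI2 bexI[of _ "(1, 0)"]) auto
      next
        fix i j assume ij: "i \<in> carrier R" "j \<in> carrier R" "?W = mat_vec 3 R (F.translation i j) ` F.origin"
        then have "lact points (trans_cls (i, j)) F.origin = ?W"
          using act_trans[OF origin_closed] residue by simp
        then have "W = lact points (\<sigma> (i, j)) ?origin" using move gW by simp
        then show ?thesis by (intro disjI1 bexI[of _ "(i, j)"]) auto
      qed
    qed
  qed
  interpret central_action_difference A P S \<sigma> \<beta> lines points
    using lines points by unfold_locales auto
  show ?thesis
    using f_one_in_ideal by (simp add: B_delta2_eq P.is_group)
qed

section \<open>Zero morphisms and the zero object\<close>

lemma p_group_group: "p_group p P \<Longrightarrow> group P"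
  by (simp add: p_group_def)

lemma subgroup_B_delta2:
  assumes "group Q" "group P"
  shows "subgroup (B_delta2 p X Q P) (burnside Q P)"
proof -
  interpret B: comm_group "burnside Q P" by (rule comm_group_burnside[OF assms])
  note sub = D.ideal_marks_subset[OF assms]
  have car: "vclass Q P d \<in> carrier (burnside Q P)" if "d \<in> vmarks Q P" for d
    using that by (simp add: carrier_burnside[OF assms])
  have inv: "inv\<^bsub>burnside Q P\<^esub> (vclass Q P d) = vclass Q P (- d)" if "d \<in> vmarks Q P" for d
    using that
    by (intro B.inv_equality) (simp_all add: car minus_in_vmarks mult_burnside[OF assms] one_burnside[OF assms])
  show ?thesis
    unfolding B_delta2_eq[OF assms]
  proof (rule B.subgroupI)
    show "vclass Q P ` D.ideal_marks Q P \<subseteq> carrier (burnside Q P)" using sub car by blast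
    show "vclass Q P ` D.ideal_marks Q P \<noteq> {}" using D.zero_in_ideal[OF assms] by blast
  next
    fix x assume "x \<in> vclass Q P ` D.ideal_marks Q P"
    then obtain d where d: "d \<in> D.ideal_marks Q P" "x = vclass Q P d" by blast
    then have "inv\<^bsub>burnside Q P\<^esub> x = vclass Q P (- d)" using inv sub by blast
    then show "inv\<^bsub>burnside Q P\<^esub> x \<in> vclass Q P ` D.ideal_marks Q P"
      using D.minus_in_ideal[OF assms d(1)] by blast
  next
    fix x y assume "x \<in> vclass Q P ` D.ideal_marks Q P" "y \<in> vclass Q P ` D.ideal_marks Q P"
    then obtain d e where d: "d \<in> D.ideal_marks Q P" "x = vclass Q P d"
      and e: "e \<in> D.ideal_marks Q P" "y = vclass Q P e" by blast
    have "x \<otimes>\<^bsub>burnside Q P\<^esub> y = vclass Q P (d + e)"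
      unfolding d(2) e(2) using d(1) e(1) sub by (intro mult_burnside[OF assms]) auto
    then show "x \<otimes>\<^bsub>burnside Q P\<^esub> y \<in> vclass Q P ` D.ideal_marks Q P"
      using D.add_in_ideal[OF assms d(1) e(1)] by blast
  qed
qed

lemma comp_B_delta2_left:
  assumes "group R'" "group Q" "group P" "b \<in> carrier (burnside R' Q)" "a \<in> B_delta2 p X Q P"
  shows "burnside_comp R' Q P b a \<in> B_delta2 p X R' P"
  using assms D.comp_left_in_ideal[OF assms(1-3)]
  by (auto simp: B_delta2_eq carrier_burnside)

lemma comp_B_delta2_right:
  assumes "group R'" "group Q" "group P" "b \<in> B_delta2 p X R' Q" "a \<in> carrier (burnside Q P)"
  shows "burnside_comp R' Q P b a \<in> B_delta2 p X R' P"
  using assms D.comp_right_in_ideal[OF assms(1-3)]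
  by (auto simp: B_delta2_eq carrier_burnside)

lemma burnside_comp_closed:
  assumes G: "group R'" "group Q" "group P" and "b \<in> carrier (burnside R' Q)" "a \<in> carrier (burnside Q P)"
  shows "burnside_comp R' Q P b a \<in> carrier (burnside R' P)"
proof -
  obtain d e where "d \<in> vmarks R' Q" "b = vclass R' Q d" "e \<in> vmarks Q P" "a = vclass Q P e"
    using assms by (auto simp: carrier_burnside)
  then obtain V V' U U' where V: "finite_biset R' Q (V :: ('a, 'b, nat) biset)" "finite_biset R' Q (V' :: ('a, 'b, nat) biset)"
    "b = vclass R' Q (mark R' Q V - mark R' Q V')"
    and U: "finite_biset Q P (U :: ('b, 'c, nat) biset)" "finite_biset Q P (U' :: ('b, 'c, nat) biset)"
    "a = vclass Q P (mark Q P U - mark Q P U')"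
    by (metis vmarksE)
  note t = mark_diff_in_vmarks[OF finite_biset_tensor[OF _ _ G(2,1,3)] finite_biset_tensor[OF _ _ G(2,1,3)]]
  have "(mark R' P (biset_tensor Q V U) - mark R' P (biset_tensor Q V U'))
      + - (mark R' P (biset_tensor Q V' U) - mark R' P (biset_tensor Q V' U')) \<in> vmarks R' P"
    by (rule add_in_vmarks[OF t[OF V(1) U(1) V(1) U(2)] minus_in_vmarks[OF t[OF V(2) U(1) V(2) U(2)]]])
  then show ?thesis
    unfolding V(3) U(3) burnside_comp_vclass[OF G V(1,2) U(1,2)] carrier_burnside[OF G(1,3)]
    by (intro imageI) (simp only: diff_conv_add_uminus)
qed

abbreviation "C \<equiv> roquette_sharp p X"

lemma roquette_class_B_delta2:
  assumes "group Q" "group P" "a \<in> B_delta2 p X Q P"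
  shows "roquette_class p X Q P a = B_delta2 p X Q P"
  unfolding roquette_class_def
  using subgroup.rcos_const[OF subgroup_B_delta2[OF assms(1,2)] _ assms(3)]
    comm_group.axioms(2)[OF comm_group_burnside[OF assms(1,2)]] by blast

text \<open>\<open>Comp\<close> is a union over representatives, so an empty argument would yield
  the empty set in place of the zero coset; hence nonemptiness is recorded.\<close>

lemma Hom_C:
  assumes "group Q" "group P" "\<phi> \<in> carrier (Hom C P Q)"
  shows "\<phi> \<noteq> {}" "\<phi> \<subseteq> carrier (burnside Q P)"
proof -
  interpret B: comm_group "burnside Q P" by (rule comm_group_burnside[OF assms(1,2)])
  note sub = subgroup_B_delta2[OF assms(1,2)]
  obtain a where a: "a \<in> carrier (burnside Q P)" "\<phi> = B_delta2 p X Q P #>\<^bsub>burnside Q P\<^esub> a"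
    using assms(3) by (auto simp: roquette_sharp_def FactGroup_def RCOSETS_def)
  show "\<phi> \<noteq> {}" using B.rcos_self[OF a(1) sub] a(2) by blast
  show "\<phi> \<subseteq> carrier (burnside Q P)"
    using B.r_coset_subset_G[OF subgroup.subset[OF sub] a(1)] a(2) by simp
qed

lemma B_delta2_in_Hom:
  assumes "group Q" "group P"
  shows "B_delta2 p X Q P \<in> carrier (Hom C P Q)"
proof -
  interpret B: comm_group "burnside Q P" by (rule comm_group_burnside[OF assms])
  show ?thesis
    using subgroup.subgroup_in_rcosets[OF subgroup_B_delta2[OF assms] B.is_group]
    by (simp add: roquette_sharp_def FactGroup_def)
qed

lemma Comp_C: "Comp C P Q R' g f = (\<Union>b\<in>g. \<Union>a\<in>f. roquette_class p X R' P (burnside_comp R' Q P b a))"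
  by (simp add: roquette_sharp_def)

text \<open>Keeps the inner composite in \<open>idem_hom\<close> within the hypotheses of
  \<open>Comp_zero_left\<close>.\<close>

lemma Comp_C_subset:
  assumes G: "group R'" "group Q" "group P"
    and "g \<noteq> {}" "g \<subseteq> carrier (burnside R' Q)" "f \<noteq> {}" "f \<subseteq> carrier (burnside Q P)"
  shows "Comp C P Q R' g f \<noteq> {}" "Comp C P Q R' g f \<subseteq> carrier (burnside R' P)"
proof -
  interpret B: comm_group "burnside R' P" by (rule comm_group_burnside[OF G(1,3)])
  note sub = subgroup_B_delta2[OF G(1,3)]
  have cl: "burnside_comp R' Q P b a \<in> carrier (burnside R' P)" if "b \<in> g" "a \<in> f" for a b
    using that assms by (intro burnside_comp_closed) auto
  show "Comp C P Q R' g f \<noteq> {}"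
    unfolding Comp_C roquette_class_def using assms(4,6) B.rcos_self[OF cl sub] by blast
  show "Comp C P Q R' g f \<subseteq> carrier (burnside R' P)"
    unfolding Comp_C roquette_class_def
    using B.r_coset_subset_G[OF subgroup.subset[OF sub] cl] by blast
qed

text \<open>All composites of representatives fall into the ideal, so the union runs over copies of
  one and the same zero coset.\<close>

lemma Comp_zero_right:
  assumes G: "group R'" "group Q" "group P" and g: "g \<noteq> {}" "g \<subseteq> carrier (burnside R' Q)"
  shows "Comp C P Q R' g (B_delta2 p X Q P) = B_delta2 p X R' P"
proof -
  have "roquette_class p X R' P (burnside_comp R' Q P b a) = B_delta2 p X R' P"
    if "b \<in> g" "a \<in> B_delta2 p X Q P" for a b
    using that g by (intro roquette_class_B_delta2 comp_B_delta2_left G) auto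
  moreover have "B_delta2 p X Q P \<noteq> {}" using subgroup.one_closed[OF subgroup_B_delta2[OF G(2,3)]] by blast
  ultimately show ?thesis unfolding Comp_C using g(1) by simp
qed

lemma Comp_zero_left:
  assumes G: "group R'" "group Q" "group P" and f: "f \<noteq> {}" "f \<subseteq> carrier (burnside Q P)"
  shows "Comp C P Q R' (B_delta2 p X R' Q) f = B_delta2 p X R' P"
proof -
  have "roquette_class p X R' P (burnside_comp R' Q P b a) = B_delta2 p X R' P"
    if "b \<in> B_delta2 p X R' Q" "a \<in> f" for a b
    using that f by (intro roquette_class_B_delta2 comp_B_delta2_right G) auto
  moreover have "B_delta2 p X R' Q \<noteq> {}" using subgroup.one_closed[OF subgroup_B_delta2[OF G(1,2)]] by blast
  ultimately show ?thesis unfolding Comp_C using f(1) by simp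
qed

text \<open>A morphism between pairs is sandwiched between their idempotents, and the zero
  idempotent of \<open>P\<close> absorbs whatever it is composed with, on whichever side it
  stands.\<close>

lemma idem_hom_zero:
  assumes P: "group P" and Y: "Y \<in> idem_objs C"
  shows "idem_hom C (P, B_delta2 p X P P) Y = {B_delta2 p X (fst Y) P}"
    "idem_hom C Y (P, B_delta2 p X P P) = {B_delta2 p X P (fst Y)}"
proof -
  obtain Q f where Yeq: "Y = (Q, f)" by (cases Y)
  have Q: "group Q" and f: "f \<in> carrier (Hom C Q Q)"
    using Y by (auto simp: Yeq idem_objs_def roquette_sharp_def p_group_def)
  note f' = Hom_C[OF Q Q f]
  have "Comp C P Q Q f (Comp C P P Q \<phi> (B_delta2 p X P P)) = B_delta2 p X Q P"
    if "\<phi> \<in> carrier (Hom C P Q)" for \<phi>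
    using Comp_zero_right[OF Q P P Hom_C[OF Q P that]] Comp_zero_right[OF Q Q P f'] by simp
  then show "idem_hom C (P, B_delta2 p X P P) Y = {B_delta2 p X (fst Y) P}"
    unfolding idem_hom_def Yeq using B_delta2_in_Hom[OF Q P] by auto
  have "Comp C Q P P (B_delta2 p X P P) (Comp C Q Q P \<phi> f) = B_delta2 p X P Q"
    if "\<phi> \<in> carrier (Hom C Q P)" for \<phi>
    by (rule Comp_zero_left[OF P P Q Comp_C_subset[OF P Q Q Hom_C[OF P Q that] f']])
  then show "idem_hom C Y (P, B_delta2 p X P P) = {B_delta2 p X P (fst Y)}"
    unfolding idem_hom_def Yeq using B_delta2_in_Hom[OF P Q] by auto
qed

text \<open>The class of \<open>f_one\<close> is the zero coset, so the edge is literally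
  \<open>P\<close> with the zero idempotent, and every entry of a matrix to or from it has a single
  possible value.\<close>

lemma zero_edge:
  fixes P :: "'a monoid"
  assumes P: "p_group p P" and nc: "\<not> cyclic_group (P\<lparr>carrier := group_center P\<rparr>)"
  shows "zero_object (roquette p X) (edge p X P)"
proof -
  note gP = p_group_group[OF P]
  let ?Z = "(P, B_delta2 p X P P)"
  have edge: "edge p X P = [?Z]"
    unfolding edge_def roquette_class_B_delta2[OF gP gP f_one_in_B_delta2[OF P nc]] ..
  have Z: "?Z \<in> idem_objs C"
    using P B_delta2_in_Hom[OF gP gP] Comp_zero_right[OF gP gP gP Hom_C[OF gP gP B_delta2_in_Hom[OF gP gP]]]
    by (simp add: idem_objs_def) (simp add: roquette_sharp_def)
  \<comment> \<open>A dependent product of singletons is a singleton, also over the empty index set,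
    which occurs for the empty direct sum.\<close>
  have uniq: "\<exists>!h. h \<in> PiE I T" if "\<And>i. i \<in> I \<Longrightarrow> \<exists>t. T i = {t}" for I :: "(nat \<times> nat) set" and T :: "_ \<Rightarrow> ('a, 'a) vbiset set set"
  proof -
    have "\<forall>i\<in>I. T i = {the_elem (T i)}" using that by fastforce
    then have "PiE I T = {\<lambda>i\<in>I. the_elem (T i)}" by (simp only: PiE_eq_singleton)
    then show ?thesis by simp
  qed
  have obj: "Ys ! j \<in> idem_objs C" if "set Ys \<subseteq> idem_objs C" "j < length Ys"
    for Ys :: "('a monoid \<times> ('a, 'a) vbiset set) list" and j
    using that by (meson nth_mem subsetD)
  show ?thesis
    unfolding zero_object_def edge
  proof (intro conjI ballI)
    show "[?Z] \<in> Obj (roquette p X)"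
      using Z by (simp add: roquette_def idem_add_completion_def)
  next
    fix Ys :: "('a monoid \<times> ('a, 'a) vbiset set) list"
    assume "Ys \<in> Obj (roquette p X)"
    then have Ys: "set Ys \<subseteq> idem_objs C" by (simp add: roquette_def idem_add_completion_def)
    show "\<exists>!h. h \<in> carrier (Hom (roquette p X) [?Z] Ys)"
      unfolding roquette_def idem_add_completion_def precat.simps partial_object.simps
      by (rule uniq) (use obj[OF Ys] in \<open>auto simp: idem_hom_zero(1)[OF gP]\<close>)
    show "\<exists>!h. h \<in> carrier (Hom (roquette p X) Ys [?Z])"
      unfolding roquette_def idem_add_completion_def precat.simps partial_object.simps
      by (rule uniq) (use obj[OF Ys] in \<open>auto simp: idem_hom_zero(2)[OF gP]\<close>)
  qed
qed

end

theorem corollary3p12: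
  fixes p :: nat and X :: "pgl_elem set" and P :: "'a monoid"
  assumes "prime p"
    and "sylow_subgroup p (PGL 3 (prime_field p)) X"
    and "p_group p P"
    and "\<not> cyclic_group (P\<lparr>carrier := group_center P\<rparr>)"
  shows "zero_object (roquette p X) (edge p X P)"
  using roquette_setting.zero_edge[OF roquette_setting.intro[OF assms(1,2)] assms(3,4)] .

end
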